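(* Let $G$ be a finite non-abelian group and let $\Gamma_G$ be its commuting graph. If $\Gamma_G$ is toroidal, then $\Gamma_G$ is integral.
   Context: For a finite non-abelian group $G$ with centre $Z(G)$, the commuting graph $\Gamma_G$ is the simple undirected graph with vertex set $G\setminus Z(G)$ in which two distinct vertices $x,y$ are adjacent if and only if $xy=yx$. A graph is integral if all eigenvalues of its adjacency matrix are integers. The genus of a graph is the smallest non-negative integer $n$ such that the graph can be embedded on the surface obtained by attaching $n$ handles to a sphere; a graph is toroidal if its genus is $1$. *)

theory Defs
  imports
    "HOL-Analysis.Analysis"
    "HOL-Algebra.Group"
    "HOL-Library.Extended_Nat"
    "Jordan_Normal_Form.Char_Poly"
begin

(* A simple graph is given by its vertex set V and its set E of edges, each edge being a
   two-element subset of V. *)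

definition group_centre :: "('a, 'b) monoid_scheme \<Rightarrow> 'a set" where
  "group_centre G = {z \<in> carrier G. \<forall>x \<in> carrier G. z \<otimes>\<^bsub>G\<^esub> x = x \<otimes>\<^bsub>G\<^esub> z}"

definition commuting_vertices :: "('a, 'b) monoid_scheme \<Rightarrow> 'a set" where
  "commuting_vertices G = carrier G - group_centre G"

definition commuting_edges :: "('a, 'b) monoid_scheme \<Rightarrow> 'a set set" where
  "commuting_edges G =
     {{x, y} | x y. x \<in> commuting_vertices G \<and> y \<in> commuting_vertices G \<and>
                    x \<noteq> y \<and> x \<otimes>\<^bsub>G\<^esub> y = y \<otimes>\<^bsub>G\<^esub> x}"

definition adjacency_matrix :: "'a list \<Rightarrow> 'a set set \<Rightarrow> complex mat" where
  "adjacency_matrix vs E =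
     mat (length vs) (length vs) (\<lambda>(i, j). if {vs ! i, vs ! j} \<in> E then 1 else 0)"

(* The matrix depends on the enumeration vs of the vertices only up to simultaneous
   permutation of rows and columns.  Only meant for finite V. *)

definition integral_graph :: "'a set \<Rightarrow> 'a set set \<Rightarrow> bool" where
  "integral_graph V E \<longleftrightarrow>
     (\<forall>vs. distinct vs \<and> set vs = V \<longrightarrow>
        (\<forall>k. eigenvalue (adjacency_matrix vs E) k \<longrightarrow> k \<in> \<int>))"

(* Topological embedding of a finite graph into S: p places the vertices, c e is the arc
   drawn for the edge e.  Arcs meet vertices only at their own ends, and two arcs meet
   only at common ends. *)

definition embeds_in :: "'a set \<Rightarrow> 'a set set \<Rightarrow> 'b::topological_space set \<Rightarrow> bool" where
  "embeds_in V E S \<longleftrightarrow>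
     (\<exists>(p :: 'a \<Rightarrow> 'b) (c :: 'a set \<Rightarrow> real \<Rightarrow> 'b).
        inj_on p V \<and> p ` V \<subseteq> S \<and>
        (\<forall>e \<in> E. arc (c e) \<and> path_image (c e) \<subseteq> S \<and>
                 {pathstart (c e), pathfinish (c e)} = p ` e \<and>
                 path_image (c e) \<inter> p ` V = p ` e) \<and>
        (\<forall>e \<in> E. \<forall>f \<in> E. e \<noteq> f \<longrightarrow>
                 path_image (c e) \<inter> path_image (c f) = p ` (e \<inter> f)))"

(* The sphere with n handles, realised in Euclidean 3-space, written as complex * real.
   The i-th vertical tube is the part inside the sphere of the cylinder over the unit circle
   around 3 * i.  The two open caps that the tube cuts out of the sphere are removed, and the
   tube (a copy of a circle times an interval) is glued in along their boundary circles.
   The closed unit discs around 0, 3, ..., 3 * (n - 1) are pairwise disjoint and lie inside the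
   disc of radius 3 * n + 1, so the tubes are disjoint and each meets the sphere exactly in its
   two boundary circles.  The result bounds a solid, so the handles are orientable ones. *)

definition sphere_with_handles :: "nat \<Rightarrow> (complex \<times> real) set" where
  "sphere_with_handles n =
     {q \<in> sphere 0 (3 * real n + 1). \<forall>i<n. fst q \<notin> ball (of_nat (3 * i)) 1} \<union>
     (\<Union>i<n. {q \<in> cball 0 (3 * real n + 1). fst q \<in> sphere (of_nat (3 * i)) 1})"

(* Inf in enat is the least element of a non-empty set, and infinity on the empty set. *)

definition graph_genus :: "'a set \<Rightarrow> 'a set set \<Rightarrow> enat" where
  "graph_genus V E = Inf (enat ` {n. embeds_in V E (sphere_with_handles n)})"

definition toroidal :: "'a set \<Rightarrow> 'a set set \<Rightarrow> bool" where
  "toroidal V E \<longleftrightarrow> graph_genus V E = 1"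

lemma sphere_with_handles_0: "sphere_with_handles 0 = sphere 0 1"
  by (auto simp: sphere_with_handles_def)

lemma graph_genus_eq_enat_iff:
  "graph_genus V E = enat n \<longleftrightarrow>
     embeds_in V E (sphere_with_handles n) \<and>
     (\<forall>m<n. \<not> embeds_in V E (sphere_with_handles m))"
proof -
  define N where "N = {n. embeds_in V E (sphere_with_handles n)}"
  have "Inf (enat ` N) = enat n \<longleftrightarrow> n \<in> N \<and> (\<forall>m<n. m \<notin> N)"
  proof
    assume inf: "Inf (enat ` N) = enat n"
    have "enat ` N \<noteq> {}"
      using inf by (auto simp: Inf_enat_def)
    then have "Inf (enat ` N) \<in> enat ` N"
      by (auto simp: Inf_enat_def intro: LeastI)
    moreover have "\<not> m < n" if "m \<in> N" for m
      using Inf_lower[of "enat m" "enat ` N"] that inf by auto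
    ultimately show "n \<in> N \<and> (\<forall>m<n. m \<notin> N)"
      using inf by auto
  next
    assume "n \<in> N \<and> (\<forall>m<n. m \<notin> N)"
    then show "Inf (enat ` N) = enat n"
      by (intro antisym Inf_lower Inf_greatest) (auto simp: not_less[symmetric])
  qed
  then show ?thesis
    by (simp add: graph_genus_def N_def)
qed

end

theory Submission
  imports Defs "HOL-Algebra.Sylow" "HOL-Algebra.Group_Action" "HOL-Algebra.Multiplicative_Group"
begin

text \<open>If all centralizers of noncentral elements are abelian, commuting is an equivalence relation on the vertices, so the graph
  is a disjoint union of complete graphs and hence integral. Otherwise the group is forced to be so close to
  \<open>S\<^sub>4\<close> that its commuting graph is planar, hence not toroidal.

  Topology enters through two facts about graphs on the torus: \<open>|E| \<le> 3 |V|\<close>, and two disjoint copies of \<open>K\<^sub>5\<close> do not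
  embed. Both follow from \<open>|E| \<le> 3 |V| - 6\<close> in the plane. For the first, lift a drawing to the universal cover of the torus and
  count in a large square. For the second, the lift of a nonplanar graph has two independent periods, as otherwise
  the graph embeds in a cylinder; and curves with independent periods intersect.

  The first fact bounds the number of commuting pairs in every set of noncentral elements. It shows that if some centralizer is not
  abelian, then the centre is trivial and each such centralizer belongs to an involution generating its centre. The second fact
  then excludes abelian subgroups of order greater than 5, these centralizers have order 8, and the class equation leaves
  \<open>|G| = 24\<close> with the commuting graph of \<open>S\<^sub>4\<close>.\<close>

section \<open>Plane graphs\<close>

text \<open>The two sides of an arbitrary continuous arc are hard to speak of. A stretch of every
  edge is therefore replaced by a straight chord of a small disc that meets no other edge. Sides
  become half discs, a face is incident with an edge if it meets the disc, and the theorems of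
  Jordan and Janiszewski yield Euler's inequality. On the torus the edge bound still allows a
  complete graph on seven vertices. So it bounds commuting sets of noncentral elements by 7 and,
  once the centre is trivial, abelian subgroups by 8. Going down to 5 needs disjoint copies of K5,
  which conjugate subgroups with small intersection would provide. Counting cannot exclude two
  copies, with 20 edges on 10 vertices; hence the separate argument with periods. The class equation
  admits the order 40 besides 24; a commuting set of six elements excludes it. For order 24 a
  drawing without crossings on the sphere contradicts genus 1.\<close>

lemma arc_first_last_hit:
  fixes c :: "real \<Rightarrow> complex"
  assumes c: "arc c" and mid: "x = c (1/2)" and r: "r > 0"
    and ends: "pathstart c \<notin> cball x r" "pathfinish c \<notin> cball x r"
  obtains g1 g2 where "arc g1" "arc g2" "pathstart g1 = pathstart c" "pathfinish g2 = pathfinish c"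
    "path_image g1 \<subseteq> path_image c" "path_image g2 \<subseteq> path_image c"
    "path_image g1 \<inter> path_image g2 = {}"
    "path_image g1 \<inter> cball x r = {pathfinish g1}" "path_image g2 \<inter> cball x r = {pathstart g2}"
    "dist x (pathfinish g1) = r" "dist x (pathstart g2) = r"
proof -
  have cont: "continuous_on {0..1} c" and inj: "inj_on c {0..1}"
    using c by (auto simp: arc_def path_def)
  define K where "K = {t \<in> {0..1}. c t \<in> cball x r}"
  have "K = {0..1} \<inter> c -` cball x r" by (auto simp: K_def)
  then have cK: "closed K" by (metis cont closed_cball closed_atLeastAtMost continuous_on_closed_vimage Int_commute)
  have hK: "1/2 \<in> K" using r mid by (auto simp: K_def)
  have K01: "K \<subseteq> {0..1}" by (auto simp: K_def)
  have bdd: "bdd_below K" "bdd_above K" using K01 by (meson bdd_below_Icc bdd_below_mono bdd_above_Icc bdd_above_mono)+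
  \<comment> \<open>The arc may enter the disc many times. Only the stretches before the first hit
    and after the last hit are kept; whatever happens in between will give way to a chord.\<close>
  define s where "s = Inf K"
  define t where "t = Sup K"
  have sK: "s \<in> K" unfolding s_def using closed_contains_Inf[OF _ bdd(1) cK] hK by auto
  have tK: "t \<in> K" unfolding t_def using closed_contains_Sup[OF _ bdd(2) cK] hK by auto
  have s_le: "s \<le> k" and t_ge: "k \<le> t" if "k \<in> K" for k
    unfolding s_def t_def using that bdd by (auto intro: cInf_lower cSup_upper)
  have s0: "0 < s" using sK ends unfolding K_def pathstart_def by (metis (mono_tags, lifting) atLeastAtMost_iff mem_Collect_eq order_le_less)
  have t1: "t < 1" using tK ends unfolding K_def pathfinish_def by (metis (mono_tags, lifting) atLeastAtMost_iff mem_Collect_eq order_le_less)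
  have sh: "s \<le> 1/2" and th: "1/2 \<le> t" using s_le[OF hK] t_ge[OF hK] by auto
  \<comment> \<open>A parameter mapped strictly inside the disc has a neighbourhood in
    \<open>K\<close>, so the extreme parameters of \<open>K\<close> can only be mapped to the
    circle.\<close>
  have near: "\<exists>d>0. \<forall>u\<in>{0..1}. \<bar>u - v\<bar> < d \<longrightarrow> u \<in> K" if v: "v \<in> {0..1}" "dist x (c v) < r" for v
  proof -
    obtain d where "d > 0" "\<forall>u\<in>{0..1}. dist u v < d \<longrightarrow> dist (c u) (c v) < r - dist x (c v)"
      using cont[unfolded continuous_on_iff, rule_format, OF v(1), of "r - dist x (c v)"] v(2) by auto
    moreover have "dist x (c u) \<le> r" if "dist (c u) (c v) < r - dist x (c v)" for u
      using that by (smt (verit) dist_commute dist_triangle)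
    ultimately show ?thesis unfolding K_def by (intro exI[of _ d]) (auto simp: dist_real_def)
  qed
  have ds: "dist x (c s) = r"
  proof (rule ccontr)
    assume "dist x (c s) \<noteq> r"
    then have "dist x (c s) < r" using sK by (auto simp: K_def)
    then obtain d where d: "d > 0" "\<forall>u\<in>{0..1}. \<bar>u - s\<bar> < d \<longrightarrow> u \<in> K"
      using near sK K01 by blast
    have "max 0 (s - d/2) \<in> K" using d s0 sh by (intro d(2)[rule_format]) (auto simp: max_def)
    then show False using s_le[of "max 0 (s - d/2)"] d s0 by auto
  qed
  have dt: "dist x (c t) = r"
  proof (rule ccontr)
    assume "dist x (c t) \<noteq> r"
    then have "dist x (c t) < r" using tK by (auto simp: K_def)
    then obtain d where d: "d > 0" "\<forall>u\<in>{0..1}. \<bar>u - t\<bar> < d \<longrightarrow> u \<in> K"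
      using near tK K01 by blast
    have "min 1 (t + d/2) \<in> K" using d t1 th by (intro d(2)[rule_format]) (auto simp: min_def)
    then show False using t_ge[of "min 1 (t + d/2)"] d t1 by auto
  qed
  have "dist x (c (1/2)) = 0" using mid by simp
  then have snh: "s \<noteq> 1/2" "t \<noteq> 1/2" using ds dt r by (metis order_less_irrefl, metis order_less_irrefl)
  have st: "s < t" using sh th snh by auto
  have im1: "path_image (subpath 0 s c) = c ` {0..s}" and im2: "path_image (subpath t 1 c) = c ` {t..1}"
    using s0 t1 by (auto simp: path_image_subpath)
  show ?thesis
  proof
    show "arc (subpath 0 s c)" "arc (subpath t 1 c)"
      using s0 t1 st sh th by (auto intro!: arc_subpath_arc c)
    show "pathstart (subpath 0 s c) = pathstart c" "pathfinish (subpath t 1 c) = pathfinish c"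
      by (auto simp: pathstart_def pathfinish_def subpath_def)
    show "path_image (subpath 0 s c) \<subseteq> path_image c" "path_image (subpath t 1 c) \<subseteq> path_image c"
      unfolding im1 im2 unfolding path_image_def using s0 t1 sh th by auto
    show "path_image (subpath 0 s c) \<inter> path_image (subpath t 1 c) = {}"
      unfolding im1 im2 using inj st s0 t1 sh th by (subst inj_on_image_Int[OF inj, symmetric]) auto
    show "path_image (subpath 0 s c) \<inter> cball x r = {pathfinish (subpath 0 s c)}"
    proof -
      have "u = s" if "u \<in> {0..s}" "c u \<in> cball x r" for u
        using that s_le[of u] sh by (auto simp: K_def)
      then have "path_image (subpath 0 s c) \<inter> cball x r \<subseteq> {c s}" unfolding im1 by blast
      moreover have "c s \<in> path_image (subpath 0 s c) \<inter> cball x r" unfolding im1 using s0 ds by auto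
      ultimately show ?thesis by (auto simp: pathfinish_def subpath_def)
    qed
    show "path_image (subpath t 1 c) \<inter> cball x r = {pathstart (subpath t 1 c)}"
    proof -
      have "u = t" if "u \<in> {t..1}" "c u \<in> cball x r" for u
        using that t_ge[of u] th by (auto simp: K_def)
      then have "path_image (subpath t 1 c) \<inter> cball x r \<subseteq> {c t}" unfolding im2 by blast
      moreover have "c t \<in> path_image (subpath t 1 c) \<inter> cball x r" unfolding im2 using t1 dt by auto
      ultimately show ?thesis by (auto simp: pathstart_def subpath_def)
    qed
    show "dist x (pathfinish (subpath 0 s c)) = r" "dist x (pathstart (subpath t 1 c)) = r"
      using ds dt by (auto simp: pathstart_def pathfinish_def subpath_def)
  qed
qed

text \<open>For \<open>e = \<plusminus>1\<close> these are the two parts into which the chord from \<open>p\<close> to \<open>q\<close> cuts the disc.\<close>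
definition half_disc :: "complex \<Rightarrow> real \<Rightarrow> complex \<Rightarrow> complex \<Rightarrow> real \<Rightarrow> complex set" where
  "half_disc x r p q e = {z \<in> ball x r. e * Im ((z - p) * cnj (q - p)) > 0}"

text \<open>\<open>Im ((z - p) * cnj (q - p))\<close> is the inner product of \<open>z - p\<close>
  with \<open>\<i> * (q - p)\<close>, so its sign picks one side of the line through
  \<open>p\<close> and \<open>q\<close>.\<close>

lemma convex_half_disc: "convex (half_disc x r p q e)"
proof -
  have "half_disc x r p q e = ball x r \<inter> {z. (e *\<^sub>R (\<i> * (q - p))) \<bullet> z > e * Re (cnj (\<i> * (q - p)) * p)}"
    unfolding half_disc_def by (auto simp: inner_complex_def algebra_simps)
  then show ?thesis by (simp only: convex_Int convex_halfspace_gt convex_ball)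
qed

lemma chord_disc:
  assumes "dist x p = r" "dist x q = r" "p \<noteq> q"
  shows "ball x r - closed_segment p q = half_disc x r p q 1 \<union> half_disc x r p q (-1)"
    and "closed_segment p q \<inter> half_disc x r p q e = {}"
    and "closed_segment p q - {p, q} \<subseteq> ball x r"
proof -
  have key: "z \<in> closed_segment p q" if "z \<in> ball x r" "Im ((z - p) * cnj (q - p)) = 0" for z
  proof -
    define s where "s = (z - p) / (q - p)"
    have "(z - p) * cnj (q - p) = s * of_real ((cmod (q - p))^2)"
      using assms unfolding s_def complex_norm_square by (metis (no_types, lifting) divide_self_if eq_iff_diff_eq_0 mult.assoc mult.left_neutral times_divide_eq_left times_divide_eq_right)
    then have "Im s * (cmod (q - p))^2 = 0" using that(2) by (metis Im_complex_of_real Re_complex_of_real add.left_neutral mult_zero_right times_complex.sel(2))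
    then have "Im s = 0" using assms by simp
    then obtain a where a: "s = of_real a" by (metis complex_is_Real_iff Reals_cases)
    then have z: "z = p + a * (q - p)" using assms unfolding s_def by (simp add: field_simps)
    \<comment> \<open>Stewart's identity for \<open>z\<close> on the line through \<open>p\<close>
      and \<open>q\<close>: as both ends have distance \<open>r\<close> from \<open>x\<close>,
      \<open>z\<close> is inside the circle exactly when \<open>a * (1 - a) > 0\<close>.\<close>
    have "(dist x z)^2 = (1 - a) * (dist x p)^2 + a * (dist x q)^2 - a * (1 - a) * (dist p q)^2"
      unfolding z dist_norm cmod_power2 by (simp add: power2_eq_square algebra_simps)
    also have "\<dots> = r^2 - a * (1 - a) * (dist p q)^2" using assms by (simp add: algebra_simps)
    finally have "r^2 - a * (1 - a) * (dist p q)^2 < r^2"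
      using that(1) by (metis mem_ball pos2 power_strict_mono zero_le_dist)
    then have "a * (1 - a) > 0" using assms by (simp add: zero_less_mult_iff)
    then have "0 \<le> a" "a \<le> 1" by (auto simp: zero_less_mult_iff)
    then show ?thesis unfolding z closed_segment_def
      by (intro CollectI exI[of _ a]) (auto simp: algebra_simps scaleR_conv_of_real)
  qed
  have on: "Im ((z - p) * cnj (q - p)) = 0" if zs: "z \<in> closed_segment p q" for z
    proof -
    obtain u where "z = (1 - u) *\<^sub>R p + u *\<^sub>R q" using zs unfolding closed_segment_def by blast
    then have "z - p = of_real u * (q - p)" by (simp add: scaleR_conv_of_real algebra_simps)
    then have "(z - p) * cnj (q - p) = of_real (u * (cmod (q - p))^2)"
      unfolding of_real_mult complex_norm_square by (simp only: mult.assoc)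
    then show ?thesis by (simp only: Im_complex_of_real)
  qed
  show "ball x r - closed_segment p q = half_disc x r p q 1 \<union> half_disc x r p q (-1)"
    (is "?B = ?H")
  proof (rule Set.set_eqI)
    fix z
    have "z \<in> ?B \<longleftrightarrow> z \<in> ball x r \<and> Im ((z - p) * cnj (q - p)) \<noteq> 0" using key[of z] on[of z] by blast
    also have "\<dots> \<longleftrightarrow> z \<in> ?H" unfolding half_disc_def by (simp only: mem_Collect_eq Un_iff) linarith
    finally show "z \<in> ?B \<longleftrightarrow> z \<in> ?H" .
  qed
  show "closed_segment p q \<inter> half_disc x r p q e = {}"
    using on unfolding half_disc_def by auto
  show "closed_segment p q - {p, q} \<subseteq> ball x r"
  proof
    fix z assume "z \<in> closed_segment p q - {p, q}"
    then obtain a where a: "0 < a" "a < 1" "z = (1 - a) *\<^sub>R p + a *\<^sub>R q"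
      by (metis DiffE in_segment(2) insert_iff open_segment_def) 
    have z: "z = p + a * (q - p)" using a by (simp add: scaleR_conv_of_real algebra_simps)
    have "(dist x z)^2 = (1 - a) * (dist x p)^2 + a * (dist x q)^2 - a * (1 - a) * (dist p q)^2"
      unfolding z dist_norm cmod_power2 by (simp add: power2_eq_square algebra_simps)
    also have "\<dots> = r^2 - a * (1 - a) * (dist p q)^2" using assms by (simp add: algebra_simps)
    also have "\<dots> < r^2" using a assms by simp
    finally show "z \<in> ball x r" using assms by (metis mem_ball power2_less_imp_less zero_le_dist)
  qed
qed

text \<open>A drawing \<open>X\<close> and one further edge, made of \<open>g1\<close>, a chord of a small disc, and \<open>g2\<close>. The chord makes the
  two sides of the edge visible: they are the two half discs.\<close>

locale chord_edge =
  fixes X :: "complex set" and g1 g2 :: "real \<Rightarrow> complex" and x :: complex and r :: real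
  assumes compX: "compact X" and arc1: "arc g1" and arc2: "arc g2"
    and Xg1: "X \<inter> path_image g1 = {pathstart g1}" and Xg2: "X \<inter> path_image g2 = {pathfinish g2}"
    and g12: "path_image g1 \<inter> path_image g2 = {}"
    and Xdisc: "X \<inter> cball x r = {}"
    and g1disc: "path_image g1 \<inter> cball x r = {pathfinish g1}"
    and g2disc: "path_image g2 \<inter> cball x r = {pathstart g2}"
    and dist1: "dist x (pathfinish g1) = r" and dist2: "dist x (pathstart g2) = r"
begin

definition "Y = X \<union> path_image g1 \<union> path_image g2"
definition "chord = closed_segment (pathfinish g1) (pathstart g2)"
definition "Z = Y \<union> chord"
definition "half e = half_disc x r (pathfinish g1) (pathstart g2) e"
text \<open>\<open>half e\<close> is connected and lies off \<open>Z\<close>, so any other point of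
  it would give the same component.\<close>

definition "side e = connected_component_set (- Z) (SOME z. z \<in> half e)"

lemma ends_ne: "pathfinish g1 \<noteq> pathstart g2"
  using g12 by (metis IntI emptyE pathfinish_in_path_image pathstart_in_path_image)

lemma r_pos: "r > 0"
  using dist1 dist2 ends_ne by (metis dist_eq_0_iff less_eq_real_def zero_le_dist)

lemma disc_Y: "ball x r \<inter> Y = {}"
proof -
  have "z \<notin> ball x r" if "z \<in> Y" for z
  proof
    assume z: "z \<in> ball x r"
    then have "z \<in> cball x r" by simp
    then have "z = pathfinish g1 \<or> z = pathstart g2"
      using that Xdisc g1disc g2disc unfolding Y_def by blast
    then show False using z dist1 dist2 by auto
  qed
  then show ?thesis by auto
qed

lemma disc_Z: "ball x r - Z = half 1 \<union> half (-1)" "Z \<inter> half e = {}"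
proof -
  show "ball x r - Z = half 1 \<union> half (-1)"
    using disc_Y chord_disc(1)[OF dist1 dist2 ends_ne] unfolding Z_def chord_def half_def by blast
  have "half e \<subseteq> ball x r" unfolding half_def half_disc_def by auto
  then show "Z \<inter> half e = {}"
    using disc_Y chord_disc(2)[OF dist1 dist2 ends_ne] unfolding Z_def chord_def half_def by blast
qed

lemma chord_sub: "chord \<subseteq> ball x r \<union> Y"
  using chord_disc(3)[OF dist1 dist2 ends_ne] unfolding chord_def Y_def by auto

lemma compact_Z: "compact Z"
  using compX arc1 arc2 unfolding Y_def Z_def chord_def
  by (auto intro!: compact_Un compact_arc_image)

lemma half_nonempty:
  assumes "e = 1 \<or> e = -1"
  shows "half e \<noteq> {}"
proof -
  let ?p = "pathfinish g1" and ?q = "pathstart g2"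
  define m where "m = midpoint ?p ?q"
  have "m \<in> closed_segment ?p ?q - {?p, ?q}" using ends_ne unfolding m_def by (simp add: midpoint_eq_endpoint)
  then have "m \<in> ball x r" using chord_disc(3)[OF dist1 dist2 ends_ne] by blast
  then obtain d where d: "d > 0" "ball m d \<subseteq> ball x r" by (metis open_ball open_contains_ball)
  \<comment> \<open>Moving the midpoint of the chord perpendicularly by \<open>s\<close> times the
    chord vector shifts it by \<open>d / 2\<close>, which stays inside the disc.\<close>
  define s where "s = d / (2 * cmod (?q - ?p))"
  have qp: "cmod (?q - ?p) > 0" using ends_ne by auto
  have s: "s > 0" using d qp unfolding s_def by simp
  define z where "z = m + of_real (e * s) * (\<i> * (?q - ?p))"
  have "dist m z = d / 2" using assms s qp d unfolding z_def dist_norm s_def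
    by (auto simp: norm_mult norm_divide)
  then have "z \<in> ball m d" using d by auto
  then have "z \<in> ball x r" using d by blast
  moreover have "e * Im ((z - ?p) * cnj (?q - ?p)) > 0"
  proof -
    have "z - ?p = of_real (1/2) * (?q - ?p) + of_real (e * s) * (\<i> * (?q - ?p))"
      unfolding z_def m_def midpoint_def by (simp add: scaleR_conv_of_real field_simps)
    then have "(z - ?p) * cnj (?q - ?p) = (of_real (1/2) + of_real (e * s) * \<i>) * ((?q - ?p) * cnj (?q - ?p))"
      by (simp only: distrib_right mult.assoc)
    also have "\<dots> = (of_real (1/2) + of_real (e * s) * \<i>) * of_real ((cmod (?q - ?p))^2)"
      by (simp only: complex_norm_square)
    finally have "e * Im ((z - ?p) * cnj (?q - ?p)) = e * (e * s * (cmod (?q - ?p))^2)"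
      by (simp only:) simp
    also have "\<dots> = s * (cmod (?q - ?p))^2" using assms by auto
    also have "\<dots> > 0" using s qp by (intro mult_pos_pos zero_less_power)
    finally show ?thesis .
  qed
  ultimately have "z \<in> half e" unfolding half_def half_disc_def by (intro CollectI conjI)
  then show ?thesis by (metis empty_iff)
qed

lemma half_connected: "connected (half e)"
  unfolding half_def by (simp add: convex_half_disc convex_connected)

lemma side_half: assumes "e = 1 \<or> e = -1"
  shows "half e \<subseteq> side e" "side e \<in> components (- Z)"
proof -
  have a: "(SOME z. z \<in> half e) \<in> half e" using half_nonempty[OF assms] by (simp add: some_in_eq)
  then show "half e \<subseteq> side e" unfolding side_def
    using disc_Z(2)[of e] by (intro connected_component_maximal half_connected) auto
  show "side e \<in> components (- Z)" unfolding side_def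
    using a disc_Z(2)[of e] by (intro componentsI) auto
qed

lemma touching: assumes "U \<in> components (- Z)" "U \<inter> ball x r \<noteq> {}"
  shows "U = side 1 \<or> U = side (-1)"
proof -
  have "U \<subseteq> - Z" using assms in_components_subset by blast
  then have "U \<inter> half 1 \<noteq> {} \<or> U \<inter> half (-1) \<noteq> {}" using disc_Z(1) assms(2) by blast
  then have "U \<inter> side 1 \<noteq> {} \<or> U \<inter> side (-1) \<noteq> {}" using side_half(1)[of 1] side_half(1)[of "-1"] by blast
  then show ?thesis using components_nonoverlap[OF assms(1) side_half(2)[of 1]] components_nonoverlap[OF assms(1) side_half(2)[of "-1"]]
    by auto
qed

text \<open>Arcs attached to \<open>X\<close> at one point only do not separate anything.\<close>

lemma pendant: assumes "connected_component (- X) a b" "a \<notin> Y" "b \<notin> Y"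
  shows "connected_component (- Y) a b"
proof -
  have 1: "connected_component (- path_image g) a b" if "arc g" "a \<notin> path_image g" "b \<notin> path_image g" for g
    using connected_arc_complement[OF that(1)] that by (simp add: connected_iff_connected_component)
  have cl: "closed (path_image g1)" "closed (path_image g2)" "compact (path_image g1)"
    using arc1 arc2 by (simp_all add: closed_arc_image compact_arc_image)
  have n: "a \<notin> path_image g1" "b \<notin> path_image g1" "a \<notin> path_image g2" "b \<notin> path_image g2"
    using assms unfolding Y_def by auto
  have 2: "connected_component (- (X \<union> path_image g1)) a b"
    by (rule Janiszewski[OF compX cl(1) _ assms(1) 1[OF arc1 n(1,2)]]) (simp add: Xg1)
  have "(X \<union> path_image g1) \<inter> path_image g2 = {pathfinish g2}" using Xg2 g12 by auto
  then have 3: "connected ((X \<union> path_image g1) \<inter> path_image g2)" by simp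
  show ?thesis unfolding Y_def
    by (rule Janiszewski[OF compact_Un[OF compX cl(3)] cl(2) 3 2 1[OF arc2 n(3,4)]])
qed

text \<open>If such a face contained a point of \<open>g1\<close> or \<open>g2\<close>, it would
  contain the rest of that arc up to the circle, since this rest misses \<open>X\<close>. But an
  open set disjoint from the open disc has no point on the circle.\<close>

lemma face_off_disc:
  assumes W: "W \<in> components (- X)" "W \<inter> ball x r = {}"
  shows "W \<subseteq> - Z"
proof -
  have openW: "open W" using W(1) compX by (meson compact_imp_closed open_Compl open_components)
  have no_pt: "w \<notin> W" if "dist x w = r" for w
  proof
    assume "w \<in> W"
    moreover have "w \<in> closure (ball x r)" using that r_pos by simp
    ultimately show False using openW W(2) by (metis disjoint_iff open_Int_closure_eq_empty)
  qed
  have sub: "T \<subseteq> W" if "connected T" "T \<subseteq> - X" "T \<inter> W \<noteq> {}" for T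
    using that W(1) by (metis components_maximal inf_commute)
  have "y \<notin> W" if "y \<in> path_image g1" for y
  proof
    assume yW: "y \<in> W"
    obtain t where t: "t \<in> {0..1}" "y = g1 t" using \<open>y \<in> path_image g1\<close> by (auto simp: path_image_def)
    have yX: "y \<notin> X" using yW W(1) in_components_subset by blast
    then have t0: "t \<noteq> 0" using Xg1 t by (auto simp: pathstart_def)
    have im: "path_image (subpath t 1 g1) = g1 ` {t..1}" using t by (auto simp: path_image_subpath)
    have "g1 0 \<noteq> g1 u" if "u \<in> {t..1}" for u using arc1 t t0 that inj_onD[of g1 "{0..1}" 0 u] by (auto simp: arc_def)
    then have "g1 0 \<notin> g1 ` {t..1}" by blast
    then have "path_image (subpath t 1 g1) \<subseteq> - X" 
    proof -
      have "g1 ` {t..1} \<subseteq> path_image g1" using t by (auto simp: path_image_def)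
      then have "z = g1 0" if "z \<in> X" "z \<in> g1 ` {t..1}" for z
      proof -
        have "z \<in> X \<inter> path_image g1" using that \<open>g1 ` {t..1} \<subseteq> path_image g1\<close> by blast
        then show ?thesis by (simp add: Xg1 pathstart_def)
      qed
      then show ?thesis using \<open>g1 0 \<notin> g1 ` {t..1}\<close> unfolding im by (metis ComplI subsetI)
    qed
    moreover have "connected (path_image (subpath t 1 g1))"
      using arc1 t by (intro connected_path_image path_subpath) (auto simp: arc_imp_path)
    moreover have "y \<in> path_image (subpath t 1 g1)" "g1 1 \<in> path_image (subpath t 1 g1)" unfolding im using t by auto
    ultimately have "g1 1 \<in> W" using sub yW by blast
    then show False using no_pt[OF dist1] by (simp add: pathfinish_def)
  qed
  moreover have "y \<notin> W" if "y \<in> path_image g2" for y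
  proof
    assume yW: "y \<in> W"
    obtain t where t: "t \<in> {0..1}" "y = g2 t" using \<open>y \<in> path_image g2\<close> by (auto simp: path_image_def)
    have yX: "y \<notin> X" using yW W(1) in_components_subset by blast
    then have t0: "t \<noteq> 1" using Xg2 t by (auto simp: pathfinish_def)
    have im: "path_image (subpath 0 t g2) = g2 ` {0..t}" using t by (auto simp: path_image_subpath)
    have "g2 1 \<noteq> g2 u" if "u \<in> {0..t}" for u using arc2 t t0 that inj_onD[of g2 "{0..1}" 1 u] by (auto simp: arc_def)
    then have "g2 1 \<notin> g2 ` {0..t}" by blast
    then have "path_image (subpath 0 t g2) \<subseteq> - X" 
    proof -
      have "g2 ` {0..t} \<subseteq> path_image g2" using t by (auto simp: path_image_def)
      then have "z = g2 1" if "z \<in> X" "z \<in> g2 ` {0..t}" for z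
      proof -
        have "z \<in> X \<inter> path_image g2" using that \<open>g2 ` {0..t} \<subseteq> path_image g2\<close> by blast
        then show ?thesis by (simp add: Xg2 pathfinish_def)
      qed
      then show ?thesis using \<open>g2 1 \<notin> g2 ` {0..t}\<close> unfolding im by (metis ComplI subsetI)
    qed
    moreover have "connected (path_image (subpath 0 t g2))"
      using arc2 t by (intro connected_path_image path_subpath) (auto simp: arc_imp_path)
    moreover have "y \<in> path_image (subpath 0 t g2)" "g2 0 \<in> path_image (subpath 0 t g2)" unfolding im using t by auto
    ultimately have "g2 0 \<in> W" using sub yW by blast
    then show False using no_pt[OF dist2] by (simp add: pathstart_def)
  qed
  moreover have "W \<subseteq> - X" using W(1) in_components_subset by blast
  ultimately have "W \<inter> Y = {}" unfolding Y_def by blast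
  then show ?thesis using chord_sub W(2) unfolding Z_def by blast
qed

text \<open>From \<open>Z\<close> to \<open>X\<close> the danger is that a face grows when the edge
  is removed. If the larger face reached the disc, \<open>pendant\<close> would connect it to the
  disc off \<open>Y\<close>; this connection would leave the old face at a frontier point in
  \<open>Z\<close> but not in \<open>Y\<close>, hence inside the disc, which the closure of the old
  face misses.\<close>

lemma components_off_disc:
  assumes "W \<inter> ball x r = {}"
  shows "W \<in> components (- X) \<longleftrightarrow> W \<in> components (- Z)"
proof
  have XZ: "- Z \<subseteq> - X" unfolding Z_def Y_def by auto
  assume W: "W \<in> components (- X)"
  then obtain a where a: "W = connected_component_set (- X) a" "a \<in> - X" by (rule componentsE) auto
  then have aW: "a \<in> W" by simp
  have "W \<subseteq> - Z" using face_off_disc[OF W assms] .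
  moreover have "connected W" using W in_components_connected by blast
  ultimately have "W \<subseteq> connected_component_set (- Z) a" using aW by (intro connected_component_maximal)
  moreover have "connected_component_set (- Z) a \<subseteq> W" unfolding a(1) using XZ by (rule connected_component_mono)
  ultimately have "W = connected_component_set (- Z) a" by simp
  then show "W \<in> components (- Z)" using aW \<open>W \<subseteq> - Z\<close> componentsI[of a "- Z"] by auto
next
  have XZ: "- Z \<subseteq> - X" and YZ: "- Z \<subseteq> - Y" unfolding Z_def Y_def by auto
  assume U: "W \<in> components (- Z)"
  then obtain a where a2: "W = connected_component_set (- Z) a" and aZ: "a \<in> - Z" by (rule componentsE) auto
  then have aW: "a \<in> W" by simp
  note a = aW a2
  have openW: "open W" using U compact_Z by (meson compact_imp_closed open_Compl open_components)
  define W' where "W' = connected_component_set (- X) a"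
  have W': "W' \<in> components (- X)" unfolding W'_def using aZ XZ by (intro componentsI) auto
  have WW': "W \<subseteq> W'" unfolding W'_def a(2) using XZ by (rule connected_component_mono)
  have "W' \<inter> ball x r = {}"
  proof (rule ccontr)
    assume "W' \<inter> ball x r \<noteq> {}"
    then obtain b where b: "connected_component (- X) a b" "b \<in> ball x r" unfolding W'_def by auto
    define V where "V = connected_component_set (- Y) a"
    have "connected_component (- Y) a b"
      using b disc_Y aZ unfolding Z_def by (intro pendant) auto
    then have bV: "b \<in> V" unfolding V_def by simp
    have WV: "W \<subseteq> V" unfolding V_def a(2) using YZ by (rule connected_component_mono)
    have "connected V" unfolding V_def by simp
    moreover have "V \<inter> W \<noteq> {}" using a(1) WV by blast
    moreover have "V - W \<noteq> {}" using bV b assms by auto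
    ultimately obtain z where z: "z \<in> V" "z \<in> frontier W" using connected_Int_frontier by blast
    have "frontier W \<subseteq> frontier (- Z)" unfolding a(2) by (rule frontier_of_connected_component_subset)
    also have "\<dots> \<subseteq> Z" using compact_Z by (simp add: frontier_complement compact_imp_closed frontier_subset_closed)
    finally have "z \<in> Z" using z by auto
    moreover have "z \<notin> Y" using z unfolding V_def using connected_component_subset by blast
    ultimately have "z \<in> ball x r" using chord_sub unfolding Z_def by blast
    moreover have "z \<in> closure W" using z by (simp add: frontier_def)
    ultimately show False using assms by (metis IntI Int_commute empty_iff open_Int_closure_eq_empty open_ball)
  qed
  then have "W' \<subseteq> - Z" using face_off_disc[OF W'] by blast
  then have "W' \<subseteq> W" unfolding a(2) using aW WW' by (intro connected_component_maximal) (auto simp: W'_def)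
  then show "W \<in> components (- X)" using W' WW' by auto
qed

text \<open>The disc misses \<open>X\<close>, so it lies in one face of \<open>X\<close>. This is
  the only face that the new edge changes: it gives way to the two sides, which may
  coincide.\<close>

lemma components_eq_sides:
  obtains W where "W \<in> components (- X)" "components (- Z) = (components (- X) - {W}) \<union> {side 1, side (-1)}"
    "side 1 \<notin> components (- X) - {W}" "side (-1) \<notin> components (- X) - {W}"
proof -
  define W where "W = connected_component_set (- X) x"
  have bX: "ball x r \<subseteq> - X" "x \<notin> X" using disc_Y r_pos centre_in_ball[of x r] unfolding Y_def by blast+
  have W: "W \<in> components (- X)" unfolding W_def using bX r_pos by (intro componentsI) auto
  have bW: "ball x r \<subseteq> W" unfolding W_def using bX r_pos by (intro connected_component_maximal) auto
  have off: "V \<inter> ball x r = {} \<longleftrightarrow> V \<noteq> W" if "V \<in> components (- X)" for V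
  proof -
    have "x \<in> W" using bW r_pos by auto
    then show ?thesis using components_nonoverlap[OF that W] bW r_pos centre_in_ball[of x r] by blast
  qed
  have s: "side e \<inter> ball x r \<noteq> {}" if "e = 1 \<or> e = -1" for e
    using side_half[OF that] half_nonempty[OF that] unfolding half_def half_disc_def by blast
  have e1: "components (- Z) = (components (- X) - {W}) \<union> {side 1, side (-1)}"
  proof (intro Set.set_eqI iffI)
    fix V assume V: "V \<in> components (- Z)"
    show "V \<in> (components (- X) - {W}) \<union> {side 1, side (-1)}"
    proof (cases "V \<inter> ball x r = {}")
      case True
      then have "V \<in> components (- X)" using components_off_disc V by simp
      then show ?thesis using off True by simp
    next
      case False
      then show ?thesis using touching[OF V] by auto
    qed
  next
    fix V assume "V \<in> (components (- X) - {W}) \<union> {side 1, side (-1)}"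
    then consider "V \<in> components (- X)" "V \<noteq> W" | "V = side 1" | "V = side (-1)" by auto
    then show "V \<in> components (- Z)"
    proof cases
      case 1
      then show ?thesis using off[of V] components_off_disc[of V] by blast
    qed (use side_half in simp_all)
  qed
  have e2: "side 1 \<notin> components (- X) - {W}" "side (-1) \<notin> components (- X) - {W}"
    using s[of 1] s[of "-1"] off by auto
  show ?thesis by (rule that[OF W e1 e2])
qed

lemma card_components:
  assumes "finite (components (- X))"
  shows "finite (components (- Z))" "card (components (- X)) \<le> card (components (- Z))"
    "side 1 \<noteq> side (-1) \<Longrightarrow> card (components (- X)) < card (components (- Z))"
proof -
  obtain W where W: "W \<in> components (- X)" "components (- Z) = (components (- X) - {W}) \<union> {side 1, side (-1)}"
    "side 1 \<notin> components (- X) - {W}" "side (-1) \<notin> components (- X) - {W}"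
    using components_eq_sides by blast
  show "finite (components (- Z))" unfolding W(2) using assms by simp
  have "card (components (- Z)) = card (components (- X) - {W}) + card {side 1, side (-1)}"
    unfolding W(2) using W assms by (intro card_Un_disjoint) auto
  moreover have "card (components (- X)) = Suc (card (components (- X) - {W}))"
    using W assms by (metis card.remove)
  ultimately show "card (components (- X)) \<le> card (components (- Z))"
    "side 1 \<noteq> side (-1) \<Longrightarrow> card (components (- X)) < card (components (- Z))"
    by (auto simp: card_insert_if)
qed

lemma card_touching:
  "finite {U \<in> components (- Z). U \<inter> ball x r \<noteq> {}}" "card {U \<in> components (- Z). U \<inter> ball x r \<noteq> {}} \<le> 2"
proof -
  have *: "{U \<in> components (- Z). U \<inter> ball x r \<noteq> {}} \<subseteq> {side 1, side (-1)}" using touching by auto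
  then show "finite {U \<in> components (- Z). U \<inter> ball x r \<noteq> {}}" by (rule finite_subset) simp
  have "card {U \<in> components (- Z). U \<inter> ball x r \<noteq> {}} \<le> card {side 1, side (-1)}" by (rule card_mono[OF _ *]) simp
  also have "\<dots> \<le> 2" by (simp add: card_insert_if)
  finally show "card {U \<in> components (- Z). U \<inter> ball x r \<noteq> {}} \<le> 2" .
qed

definition "whole = g1 +++ linepath (pathfinish g1) (pathstart g2) +++ g2"

lemma whole:
  "arc whole" "pathstart whole = pathstart g1" "pathfinish whole = pathfinish g2"
  "path_image whole = path_image g1 \<union> chord \<union> path_image g2"
proof -
  have c1: "chord \<inter> path_image g1 = {pathfinish g1}"
  proof -
    have "chord - {pathfinish g1, pathstart g2} \<subseteq> ball x r"
      unfolding chord_def by (rule chord_disc(3)[OF dist1 dist2 ends_ne])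
    then have "chord \<inter> path_image g1 \<subseteq> {pathfinish g1, pathstart g2}" using disc_Y unfolding Y_def by blast
    moreover have "pathstart g2 \<notin> path_image g1" using g12 by auto
    ultimately show ?thesis unfolding chord_def by auto
  qed
  have c2: "chord \<inter> path_image g2 = {pathstart g2}"
  proof -
    have "chord - {pathfinish g1, pathstart g2} \<subseteq> ball x r"
      unfolding chord_def by (rule chord_disc(3)[OF dist1 dist2 ends_ne])
    then have "chord \<inter> path_image g2 \<subseteq> {pathfinish g1, pathstart g2}" using disc_Y unfolding Y_def by blast
    moreover have "pathfinish g1 \<notin> path_image g2" using g12 by auto
    ultimately show ?thesis unfolding chord_def by auto
  qed
  have a2: "arc (linepath (pathfinish g1) (pathstart g2) +++ g2)"
    using c2 ends_ne by (intro arc_join[OF _ arc2] arc_linepath) (auto simp: chord_def)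
  show "arc whole" unfolding whole_def
    using arc1 a2 c1 g12 by (intro arc_join[OF arc1 a2]) (auto simp: chord_def path_image_join)
  show "pathstart whole = pathstart g1" "pathfinish whole = pathfinish g2" by (auto simp: whole_def)
  show "path_image whole = path_image g1 \<union> chord \<union> path_image g2"
    by (auto simp: whole_def path_image_join chord_def)
qed

text \<open>The edge and an arc in \<open>X\<close> between its ends form a Jordan curve. Near the
  midpoint of the chord only the two half discs are off the curve, and both the inside and the
  outside come arbitrarily close to that point; so the curve separates the half discs.\<close>

lemma sides_ne:
  assumes "path_component X (pathstart g1) (pathfinish g2)"
  shows "side 1 \<noteq> side (-1)"
proof -
  have une: "pathstart g1 \<noteq> pathfinish g2" using g12 by (metis IntI emptyE pathfinish_in_path_image pathstart_in_path_image)
  obtain h where h: "path h" "path_image h \<subseteq> X" "pathstart h = pathfinish g2" "pathfinish h = pathstart g1"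
    using assms path_component_sym unfolding path_component_def by blast
  obtain k where k: "arc k" "path_image k \<subseteq> X" "pathstart k = pathfinish g2" "pathfinish k = pathstart g1"
    using path_contains_arc[of h "pathfinish g2" "pathstart g1"] h une by (metis order_trans)
  define j where "j = whole +++ k"
  have "path_image whole \<inter> path_image k \<subseteq> {pathstart g1, pathstart k}"
  proof -
    have "path_image whole \<inter> X \<subseteq> {pathstart g1, pathfinish g2}"
    proof
      fix z assume z: "z \<in> path_image whole \<inter> X"
      then have "z \<notin> ball x r" using disc_Y unfolding Y_def by blast
      then have "z \<in> path_image g1 \<union> path_image g2"
        using z chord_disc(3)[OF dist1 dist2 ends_ne] unfolding whole chord_def by auto
      then show "z \<in> {pathstart g1, pathfinish g2}" using z Xg1 Xg2 by auto
    qed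
    then show ?thesis using k by auto
  qed
  then have sj: "simple_path j" "pathfinish j = pathstart j" unfolding j_def
    using k whole by (auto intro!: simple_path_join_loop)
  have pij: "path_image j = path_image whole \<union> path_image k"
    unfolding j_def using k whole by (simp add: path_image_join)
  have jZ: "path_image j \<subseteq> Z" unfolding pij whole Z_def Y_def using k by auto
  have J: "open (inside (path_image j))" "open (outside (path_image j))"
    "connected (inside (path_image j))" "connected (outside (path_image j))"
    "inside (path_image j) \<inter> outside (path_image j) = {}"
    "frontier (inside (path_image j)) = path_image j" "frontier (outside (path_image j)) = path_image j"
    "inside (path_image j) \<union> outside (path_image j) = - path_image j"
    using Jordan_inside_outside[OF sj] by auto
  define m where "m = midpoint (pathfinish g1) (pathstart g2)"
  have "m \<in> chord - {pathfinish g1, pathstart g2}"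
    using ends_ne unfolding m_def chord_def by (simp add: midpoint_eq_endpoint)
  then have m: "m \<in> ball x r" "m \<in> path_image j"
    using chord_disc(3)[OF dist1 dist2 ends_ne] unfolding pij whole chord_def by auto
  have disc: "ball x r - path_image j \<subseteq> half 1 \<union> half (-1)"
  proof -
    have "ball x r \<inter> Z \<subseteq> chord" using disc_Y unfolding Z_def by blast
    then show ?thesis using disc_Z(1) unfolding pij whole by blast
  qed
  have meets: "T \<inter> (half 1 \<union> half (-1)) \<noteq> {}" if "open T" "frontier T = path_image j" "T \<subseteq> - path_image j" for T
  proof -
    have "m \<in> frontier T" using that m by simp
    then have "m \<in> closure T" by (simp add: frontier_def)
    then have "ball x r \<inter> T \<noteq> {}" using m by (metis disjoint_iff open_Int_closure_eq_empty open_ball)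
    then show ?thesis using disc that by blast
  qed
  have half_in: "half e \<subseteq> inside (path_image j) \<or> half e \<subseteq> outside (path_image j)" for e
  proof -
    have "half e \<subseteq> inside (path_image j) \<union> outside (path_image j)"
      using J(8) jZ disc_Z(2)[of e] by blast
    then show ?thesis using connectedD[OF half_connected J(1,2)] J(5) by blast
  qed
  have "inside (path_image j) \<inter> (half 1 \<union> half (-1)) \<noteq> {}" "outside (path_image j) \<inter> (half 1 \<union> half (-1)) \<noteq> {}"
    using meets[OF J(1,6)] meets[OF J(2,7)] J(8) by blast+
  then have sep: "half 1 \<subseteq> inside (path_image j) \<and> half (-1) \<subseteq> outside (path_image j) \<or>
      half (-1) \<subseteq> inside (path_image j) \<and> half 1 \<subseteq> outside (path_image j)"
    using half_in J(5) by blast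
  have "False" if eq: "side 1 = side (-1)"
  proof -
    have c: "connected (side 1)" using side_half(2)[of 1] in_components_connected by blast
    have "side 1 \<subseteq> inside (path_image j) \<union> outside (path_image j)"
      using side_half(2)[of 1] in_components_subset J(8) jZ by blast
    moreover have "side 1 \<inter> inside (path_image j) \<noteq> {}" "side 1 \<inter> outside (path_image j) \<noteq> {}"
      using sep side_half(1)[of 1] side_half(1)[of "-1"] half_nonempty[of 1] half_nonempty[of "-1"] eq by blast+
    ultimately show False using connectedD[OF c J(1,2)] J(5) by blast
  qed
  then show ?thesis by blast
qed

end

section \<open>Euler's inequality and the edge bound for plane drawings\<close>

definition nice_image :: "('i \<Rightarrow> real \<Rightarrow> complex) \<Rightarrow> ('i \<Rightarrow> real \<Rightarrow> complex) \<Rightarrow> 'i \<Rightarrow> complex set" where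
  "nice_image g1 g2 i =
     path_image (g1 i) \<union> closed_segment (pathfinish (g1 i)) (pathstart (g2 i)) \<union> path_image (g2 i)"

text \<open>Condition \<open>edge\<close> is required for every set \<open>J\<close> of other edges,
  so that edges can be added one by one for Euler's inequality and removed one by one for the
  degrees of faces.\<close>

locale chord_drawing =
  fixes P :: "complex set" and I :: "'i set" and g1 g2 :: "'i \<Rightarrow> real \<Rightarrow> complex"
    and x :: "'i \<Rightarrow> complex" and r :: "'i \<Rightarrow> real"
  assumes finP: "finite P" and finI: "finite I" and P_ne: "P \<noteq> {}"
    and edge: "\<And>i J. i \<in> I \<Longrightarrow> J \<subseteq> I - {i} \<Longrightarrow>
      chord_edge (P \<union> (\<Union>j\<in>J. nice_image g1 g2 j)) (g1 i) (g2 i) (x i) (r i)"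
    and ends: "\<And>i. i \<in> I \<Longrightarrow> pathstart (g1 i) \<in> P" "\<And>i. i \<in> I \<Longrightarrow> pathfinish (g2 i) \<in> P"
    and simple: "\<And>i j. i \<in> I \<Longrightarrow> j \<in> I \<Longrightarrow> i \<noteq> j \<Longrightarrow>
      {pathstart (g1 i), pathfinish (g2 i)} \<noteq> {pathstart (g1 j), pathfinish (g2 j)}"
begin

abbreviation "N \<equiv> nice_image g1 g2"
definition "G J = P \<union> (\<Union>j\<in>J. N j)"

lemma edge_G: "i \<in> I \<Longrightarrow> J \<subseteq> I - {i} \<Longrightarrow> chord_edge (G J) (g1 i) (g2 i) (x i) (r i)"
  unfolding G_def by (rule edge)

lemma Z_eq: assumes "i \<in> I" "J \<subseteq> I - {i}"
  shows "chord_edge.Z (G J) (g1 i) (g2 i) = G (insert i J)"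
proof -
  interpret chord_edge "G J" "g1 i" "g2 i" "x i" "r i" using edge_G assms by blast
  show ?thesis unfolding Z_def Y_def chord_def by (auto simp: G_def nice_image_def)
qed

lemma N_whole: assumes "i \<in> I"
  obtains w where "arc w" "path_image w = N i" "pathstart w = pathstart (g1 i)" "pathfinish w = pathfinish (g2 i)"
proof -
  interpret chord_edge "G {}" "g1 i" "g2 i" "x i" "r i" using edge_G assms by blast
  show ?thesis by (rule that[OF whole(1) _ whole(2,3)]) (simp add: whole(4) chord_def nice_image_def)
qed

lemma N_inter: assumes "i \<in> I" "J \<subseteq> I - {i}"
  shows "G J \<inter> N i = {pathstart (g1 i), pathfinish (g2 i)}"
proof -
  interpret chord_edge "G J" "g1 i" "g2 i" "x i" "r i" using edge_G assms by blast
  have "chord \<subseteq> cball (x i) (r i)" unfolding chord_def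
    using g1disc g2disc by (intro closed_segment_subset convex_cball) auto
  then have "G J \<inter> chord = {}" using Xdisc by blast
  moreover have "G J \<inter> N i = (G J \<inter> path_image (g1 i)) \<union> (G J \<inter> chord) \<union> (G J \<inter> path_image (g2 i))"
    unfolding nice_image_def chord_def by (simp only: Int_Un_distrib)
  ultimately show ?thesis unfolding Xg1 Xg2 by auto
qed

lemma connected_compl_finite: "finite (S :: complex set) \<Longrightarrow> connected (- S)"
  by (metis DIM_complex countable_finite order_refl path_connected_complement_countable path_connected_imp_connected)

text \<open>Lower bound in Euler's formula, by induction on the edges. The function \<open>f\<close> labels the vertices such that equal labels
  imply being connected in the drawing: an edge between equal labels splits a face, and otherwise two labels are merged.\<close>

lemma faces:
  assumes "J \<subseteq> I"
  shows "finite (components (- G J)) \<and>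
    (\<exists>f :: complex \<Rightarrow> complex. (\<forall>u\<in>P. \<forall>v\<in>P. f u = f v \<longrightarrow> path_component (G J) u v) \<and>
      card J + 1 + card (f ` P) \<le> card (components (- G J)) + card P)"
proof -
  have "finite J" using assms finI finite_subset by blast
  then show ?thesis using assms
  proof (induction J)
    case empty
    have "P \<noteq> UNIV" using finP infinite_UNIV_char_0 by metis
    then have "- P \<noteq> {}" by blast
    then have "components (- P) = {- P}" using connected_compl_finite[OF finP] by (simp add: components_eq_sing_iff)
    moreover have "path_component P u u" if "u \<in> P" for u using that by (rule path_component_refl)
    ultimately have "finite (components (- P))" "card {} + 1 + card ((\<lambda>z. z) ` P) \<le> card (components (- P)) + card P"
      "\<forall>u\<in>P. \<forall>v\<in>P. u = v \<longrightarrow> path_component P u v" by simp_all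
    then show ?case unfolding G_def by (intro conjI exI[of _ "\<lambda>z. z"]) simp_all
  next
    case (insert i J)
    then have i: "i \<in> I" "J \<subseteq> I - {i}" by auto
    interpret E: chord_edge "G J" "g1 i" "g2 i" "x i" "r i" using edge_G i by blast
    note Z = Z_eq[OF i]
    obtain f :: "complex \<Rightarrow> complex" where fin: "finite (components (- G J))"
      and f: "\<And>u v. u \<in> P \<Longrightarrow> v \<in> P \<Longrightarrow> f u = f v \<Longrightarrow> path_component (G J) u v"
      and le: "card J + 1 + card (f ` P) \<le> card (components (- G J)) + card P"
      using insert by auto
    have sub: "G J \<subseteq> G (insert i J)" unfolding G_def by auto
    have pc: "path_component (G (insert i J)) a b" if "path_component (G J) a b" for a b
      using that sub by (rule path_component_of_subset[rotated])
    define u where "u = pathstart (g1 i)"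
    define v where "v = pathfinish (g2 i)"
    have uv: "u \<in> P" "v \<in> P" using ends i unfolding u_def v_def by auto
    show ?case
    proof (cases "f u = f v")
      case True
      then have "path_component (G J) u v" using f uv by blast
      then have "card (components (- G J)) < card (components (- G (insert i J)))"
        using E.card_components(3)[OF fin] E.sides_ne unfolding Z u_def v_def by blast
      moreover have "finite (components (- G (insert i J)))" using E.card_components(1)[OF fin] unfolding Z .
      ultimately show ?thesis using le f pc insert.hyps by (auto intro!: exI[of _ f])
    next
      case False
      define f' where "f' a = (if f a = f v then f u else f a)" for a
      have "f' ` P \<subseteq> f ` P - {f v}" using False uv unfolding f'_def by auto
      then have "card (f' ` P) \<le> card (f ` P - {f v})" using finP by (intro card_mono) auto
      also have "\<dots> < card (f ` P)" using uv finP by (intro card_Diff1_less) auto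
      finally have c: "card (f' ` P) < card (f ` P)" .
      obtain w where w: "arc w" "path_image w = N i" "pathstart w = u" "pathfinish w = v"
        using N_whole[OF i(1)] unfolding u_def v_def by metis
      have "path_image w \<subseteq> G (insert i J)" unfolding w(2) G_def by auto
      then have vu: "path_component (G (insert i J)) u v" unfolding path_component_def
        using w arc_imp_path by blast
      have "path_component (G (insert i J)) a b" if ab: "a \<in> P" "b \<in> P" "f' a = f' b" for a b
      proof -
        consider "f a = f b" | "f a = f v" "f b = f u" | "f a = f u" "f b = f v"
          using ab(3) unfolding f'_def by (auto split: if_splits)
        then show ?thesis
        proof cases
          case 1
          then show ?thesis using f ab pc by blast
        next
          case 2
          have "path_component (G (insert i J)) a v" "path_component (G (insert i J)) u b"
            using 2 f ab uv pc by metis+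
          then show ?thesis using vu path_component_sym path_component_trans by metis
        next
          case 3
          have "path_component (G (insert i J)) a u" "path_component (G (insert i J)) v b"
            using 3 f ab uv pc by metis+
          then show ?thesis using vu path_component_trans by metis
        qed
      qed
      moreover have "finite (components (- G (insert i J)))"
        "card (components (- G J)) \<le> card (components (- G (insert i J)))"
        using E.card_components(1,2)[OF fin] unfolding Z .
      ultimately show ?thesis using c le insert.hyps by (auto intro!: exI[of _ f'])
    qed
  qed
qed

text \<open>Two edges of a simple graph share at most one end, so the arcs meet in a connected set,
  empty or a single point, and by Janiszewski's theorem their union does not separate the plane. The
  remaining points of \<open>P\<close> are added by the same theorem.\<close>

lemma few_edges_connected:
  assumes "J \<subseteq> I" "card J \<le> 2"
  shows "connected (- G J)"
proof -
  have fJ: "finite J" using assms finI finite_subset by blast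
  have NJ: "compact (N i)" "connected (- N i)" if i: "i \<in> I" for i
  proof -
    obtain w where w: "arc w" "path_image w = N i" using N_whole[OF i] by metis
    show "compact (N i)" using compact_arc_image[OF w(1)] w(2) by simp
    show "connected (- N i)" using connected_arc_complement[OF w(1)] w(2) by simp
  qed
  have add: "connected (- (S \<union> P))" if "compact S" "connected (- S)" for S
  proof -
    have "connected (- (S \<union> (P - S)))"
    proof (rule Janiszewski_connected[OF that(1) _ _ that(2)])
      show "connected (- (P - S))" using finP by (intro connected_compl_finite) simp
    qed (use finP in \<open>auto intro: finite_imp_closed\<close>)
    then show ?thesis by simp
  qed
  have "card J = 0 \<or> card J = 1 \<or> card J = 2" using assms(2) by linarith
  then consider "J = {}" | i where "J = {i}" | i j where "J = {i, j}" "i \<noteq> j"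
    using fJ by (metis card_0_eq card_1_singletonE card_2_iff)
  then show ?thesis
  proof cases
    case 1
    then show ?thesis using connected_compl_finite[OF finP] by (simp add: G_def)
  next
    case 2
    then show ?thesis using add[OF NJ(1) NJ(2), of i] assms by (simp add: G_def Un_commute)
  next
    case 3
    then have ij: "i \<in> I" "j \<in> I" using assms by auto
    have sub: "N i \<inter> N j \<subseteq> {pathstart (g1 i), pathfinish (g2 i)} \<inter> {pathstart (g1 j), pathfinish (g2 j)}"
    proof -
      have "G {j} \<inter> N i = {pathstart (g1 i), pathfinish (g2 i)}" "G {i} \<inter> N j = {pathstart (g1 j), pathfinish (g2 j)}"
        using N_inter 3 ij by auto
      then show ?thesis unfolding G_def by auto
    qed
    have "\<exists>z. {pathstart (g1 i), pathfinish (g2 i)} \<inter> {pathstart (g1 j), pathfinish (g2 j)} \<subseteq> {z}"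
      using simple[OF ij 3(2)] by (cases "pathstart (g1 i) \<in> {pathstart (g1 j), pathfinish (g2 j)}") auto
    then obtain z where "N i \<inter> N j \<subseteq> {z}" using sub by blast
    then have "N i \<inter> N j = {} \<or> N i \<inter> N j = {z}" by blast
    then have "connected (N i \<inter> N j)" by auto
    then have "connected (- (N i \<union> N j))"
      using NJ ij by (intro Janiszewski_connected) (auto intro: compact_imp_closed)
    then have "connected (- ((N i \<union> N j) \<union> P))" using NJ ij by (intro add) auto
    then show ?thesis unfolding G_def 3 by (simp add: Un_ac)
  qed
qed

text \<open>A face remains a face when all edges whose disc it does not meet are deleted, and the complement of at most
  two edges is connected.\<close>

lemma face_degree:
  assumes U: "U \<in> components (- G I)" and I3: "card I \<ge> 3"
  shows "card {i \<in> I. U \<inter> ball (x i) (r i) \<noteq> {}} \<ge> 3"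
proof -
  define J where "J = {i \<in> I. U \<inter> ball (x i) (r i) \<noteq> {}}"
  have JI: "J \<subseteq> I" unfolding J_def by auto
  have *: "U \<in> components (- G (I - K))" if "finite K" "K \<subseteq> I - J" for K
    using that
  proof (induction K)
    case empty
    then show ?case using U by simp
  next
    case (insert k K)
    then have k: "k \<in> I" "I - insert k K \<subseteq> I - {k}" by auto
    interpret E: chord_edge "G (I - insert k K)" "g1 k" "g2 k" "x k" "r k" using edge_G k by blast
    have "insert k (I - insert k K) = I - K" using insert by auto
    then have "U \<in> components (- E.Z)" using insert Z_eq[OF k] by simp
    moreover have "U \<inter> ball (x k) (r k) = {}" using insert unfolding J_def by auto
    ultimately show ?case using E.components_off_disc by blast
  qed
  have "U \<in> components (- G J)"
    using *[of "I - J"] finI JI by (simp add: double_diff)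
  have "\<not> card J \<le> 2"
  proof
    assume "card J \<le> 2"
    then have con: "connected (- G J)" using few_edges_connected JI by blast
    then have "components (- G J) = {- G J}"
      using \<open>U \<in> components (- G J)\<close> by (metis components_empty components_eq_sing_iff empty_iff)
    then have "U = - G J" using \<open>U \<in> components (- G J)\<close> by simp
    \<comment> \<open>Now \<open>U\<close> is the whole complement of \<open>G J\<close>. The disc
      centre of an edge outside \<open>J\<close> lies in that complement, so \<open>U\<close> meets
      the disc and the edge belongs to \<open>J\<close> after all.\<close>
    have "J \<noteq> I" using \<open>card J \<le> 2\<close> I3 by auto
    then obtain i where i: "i \<in> I" "i \<notin> J" using JI by blast
    then have i2: "J \<subseteq> I - {i}" using JI by auto
    interpret E: chord_edge "G J" "g1 i" "g2 i" "x i" "r i" using edge_G i(1) i2 by blast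
    have "x i \<in> - G J" using E.Xdisc E.r_pos by auto
    then have "x i \<in> U \<inter> ball (x i) (r i)" using E.r_pos \<open>U = - G J\<close> by (metis IntI centre_in_ball)
    then have "i \<in> J" using i(1) unfolding J_def by blast
    then show False using i by simp
  qed
  then show ?thesis unfolding J_def by linarith
qed

text \<open>A face meets at least three discs and a disc at most two faces, so
  \<open>3 * card F \<le> 2 * card I\<close>. Combined with
  \<open>card I + 2 \<le> card F + card P\<close> from \<open>faces\<close> this is the
  claim.\<close>

theorem edge_bound:
  assumes "card I \<ge> 3"
  shows "card I + 6 \<le> 3 * card P"
proof -
  define F where "F = components (- G I)"
  have finF: "finite F" using faces[of I] unfolding F_def by blast
  obtain f :: "complex \<Rightarrow> complex" where f: "card I + 1 + card (f ` P) \<le> card F + card P"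
    using faces[of I] unfolding F_def by blast
  have "card (f ` P) \<ge> 1" using finP P_ne by (simp add: Suc_leI card_gt_0_iff)
  define R where "R = {(U, i) \<in> F \<times> I. U \<inter> ball (x i) (r i) \<noteq> {}}"
  have "R = (SIGMA U:F. {i \<in> I. U \<inter> ball (x i) (r i) \<noteq> {}})" unfolding R_def by auto
  then have "card R = (\<Sum>U\<in>F. card {i \<in> I. U \<inter> ball (x i) (r i) \<noteq> {}})" using finF finI by simp
  also have "\<dots> \<ge> (\<Sum>U\<in>F. 3)" using face_degree assms unfolding F_def by (intro sum_mono) auto
  finally have 1: "3 * card F \<le> card R" by simp
  have "R = prod.swap ` (SIGMA i:I. {U \<in> F. U \<inter> ball (x i) (r i) \<noteq> {}})" 
    unfolding R_def by (auto simp: image_iff simp del: mem_ball disjoint_iff)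
  then have "card R = card (SIGMA i:I. {U \<in> F. U \<inter> ball (x i) (r i) \<noteq> {}})" by (simp add: card_image)
  also have "\<dots> = (\<Sum>i\<in>I. card {U \<in> F. U \<inter> ball (x i) (r i) \<noteq> {}})" using finF finI by simp
  also have "\<dots> \<le> (\<Sum>i\<in>I. 2)"
  proof (rule sum_mono)
    fix i assume i: "i \<in> I"
    then have i2: "I - {i} \<subseteq> I - {i}" by auto
    interpret E: chord_edge "G (I - {i})" "g1 i" "g2 i" "x i" "r i" using edge_G i i2 by blast
    have "insert i (I - {i}) = I" using i by auto
    then have "E.Z = G I" using Z_eq[OF i i2] by simp
    then show "card {U \<in> F. U \<inter> ball (x i) (r i) \<noteq> {}} \<le> 2" using E.card_touching(2) unfolding F_def by simp
  qed
  finally have 2: "card R \<le> 2 * card I" by simp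
  show ?thesis using 1 2 f \<open>card (f ` P) \<ge> 1\<close> by linarith
qed

end

theorem planar_edge_bound:
  fixes P :: "complex set" and c :: "'i \<Rightarrow> real \<Rightarrow> complex"
  assumes finP: "finite P" and finI: "finite I"
    and arcs: "\<And>i. i \<in> I \<Longrightarrow> arc (c i)"
    and ends: "\<And>i. i \<in> I \<Longrightarrow> pathstart (c i) \<in> P" "\<And>i. i \<in> I \<Longrightarrow> pathfinish (c i) \<in> P"
    and cP: "\<And>i. i \<in> I \<Longrightarrow> path_image (c i) \<inter> P \<subseteq> {pathstart (c i), pathfinish (c i)}"
    and cc: "\<And>i j. i \<in> I \<Longrightarrow> j \<in> I \<Longrightarrow> i \<noteq> j \<Longrightarrow> path_image (c i) \<inter> path_image (c j) \<subseteq> P"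
    and simple: "\<And>i j. i \<in> I \<Longrightarrow> j \<in> I \<Longrightarrow> i \<noteq> j \<Longrightarrow>
      {pathstart (c i), pathfinish (c i)} \<noteq> {pathstart (c j), pathfinish (c j)}"
    and I3: "card I \<ge> 3"
  shows "card I + 6 \<le> 3 * card P"
proof -
  define x where "x i = c i (1/2)" for i
  define Ob where "Ob i = P \<union> (\<Union>j\<in>I - {i}. path_image (c j))" for i
  have xc: "x i \<in> path_image (c i)" for i unfolding x_def path_image_def by auto
  have xP: "x i \<notin> P" if i: "i \<in> I" for i
  proof
    assume "x i \<in> P"
    then have "x i = c i 0 \<or> x i = c i 1" using cP[OF i] xc by (auto simp: pathstart_def pathfinish_def)
    then show False using arcs[OF i] inj_onD[of "c i" "{0..1}" "1/2" 0] inj_onD[of "c i" "{0..1}" "1/2" 1]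
      unfolding x_def arc_def by auto
  qed
  have "\<exists>e>0. \<forall>y\<in>Ob i. e \<le> dist (x i) y" if i: "i \<in> I" for i
  proof (rule separate_point_closed)
    show "closed (Ob i)" unfolding Ob_def using finP finI arcs
      by (intro closed_Un closed_UN finite_imp_closed) (auto intro: closed_arc_image)
    show "x i \<notin> Ob i" unfolding Ob_def using xP[OF i] cc[OF i] xc by blast
  qed
  then obtain e where e: "\<And>i. i \<in> I \<Longrightarrow> e i > 0" "\<And>i y. i \<in> I \<Longrightarrow> y \<in> Ob i \<Longrightarrow> e i \<le> dist (x i) y"
    by metis
  \<comment> \<open>\<open>e i\<close> bounds the distance from \<open>x i\<close> to the rest of
    the drawing from below. A third of it keeps the discs off the other edges and, as
    \<open>e i\<close> and \<open>e j\<close> are both at most the distance of the centres, pairwise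
    disjoint.\<close>
  define r where "r i = e i / 3" for i
  have r: "r i > 0" if "i \<in> I" for i using e that unfolding r_def by simp
  have cbOb: "cball (x i) (r i) \<inter> Ob i = {}" if "i \<in> I" for i
    using e[OF that] unfolding r_def by fastforce
  have cbcb: "cball (x i) (r i) \<inter> cball (x j) (r j) = {}" if "i \<in> I" "j \<in> I" "i \<noteq> j" for i j
  proof -
    have "x j \<in> Ob i" "x i \<in> Ob j" using xc that unfolding Ob_def by auto
    then have "e i \<le> dist (x i) (x j)" "e j \<le> dist (x i) (x j)" using e(2)[OF that(1), of "x j"] e(2)[OF that(2), of "x i"] by (simp_all add: dist_commute)
    then have "r i + r j < dist (x i) (x j)" using e(1)[OF that(1)] unfolding r_def by linarith
    then show ?thesis by (intro disjoint_cballI)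
  qed
  have "\<exists>g1 g2. arc g1 \<and> arc g2 \<and> pathstart g1 = pathstart (c i) \<and> pathfinish g2 = pathfinish (c i) \<and>
    path_image g1 \<subseteq> path_image (c i) \<and> path_image g2 \<subseteq> path_image (c i) \<and>
    path_image g1 \<inter> path_image g2 = {} \<and>
    path_image g1 \<inter> cball (x i) (r i) = {pathfinish g1} \<and> path_image g2 \<inter> cball (x i) (r i) = {pathstart g2} \<and>
    dist (x i) (pathfinish g1) = r i \<and> dist (x i) (pathstart g2) = r i" if i: "i \<in> I" for i
  proof -
    have "pathstart (c i) \<notin> cball (x i) (r i)" "pathfinish (c i) \<notin> cball (x i) (r i)"
      using cbOb[OF i] ends[OF i] unfolding Ob_def by blast+
    then show ?thesis using arc_first_last_hit[OF arcs[OF i] x_def r[OF i]] by metis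
  qed
  then obtain g1 g2 where g: "\<And>i. i \<in> I \<Longrightarrow> arc (g1 i) \<and> arc (g2 i) \<and> pathstart (g1 i) = pathstart (c i) \<and>
    pathfinish (g2 i) = pathfinish (c i) \<and>
    path_image (g1 i) \<subseteq> path_image (c i) \<and> path_image (g2 i) \<subseteq> path_image (c i) \<and>
    path_image (g1 i) \<inter> path_image (g2 i) = {} \<and>
    path_image (g1 i) \<inter> cball (x i) (r i) = {pathfinish (g1 i)} \<and>
    path_image (g2 i) \<inter> cball (x i) (r i) = {pathstart (g2 i)} \<and>
    dist (x i) (pathfinish (g1 i)) = r i \<and> dist (x i) (pathstart (g2 i)) = r i" by metis
  have N: "nice_image g1 g2 j \<subseteq> path_image (c j) \<union> cball (x j) (r j)" if "j \<in> I" for j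
  proof -
    have "pathfinish (g1 j) \<in> cball (x j) (r j)" "pathstart (g2 j) \<in> cball (x j) (r j)" using g[OF that] by auto
    then have "closed_segment (pathfinish (g1 j)) (pathstart (g2 j)) \<subseteq> cball (x j) (r j)"
      by (rule closed_segment_subset[OF _ _ convex_cball])
    moreover have "path_image (g1 j) \<subseteq> path_image (c j)" "path_image (g2 j) \<subseteq> path_image (c j)" using g[OF that] by blast+
    ultimately show ?thesis unfolding nice_image_def by blast
  qed
  have cN: "compact (nice_image g1 g2 j)" if "j \<in> I" for j
    unfolding nice_image_def using g[OF that] by (auto intro!: compact_Un compact_arc_image)
  have Ncap: "path_image (c i) \<inter> nice_image g1 g2 j \<subseteq> P" "cball (x i) (r i) \<inter> nice_image g1 g2 j = {}"
    if ij: "i \<in> I" "j \<in> I" "i \<noteq> j" for i j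
  proof -
    have "path_image (c i) \<subseteq> Ob j" "path_image (c j) \<subseteq> Ob i" using ij unfolding Ob_def by auto
    then show "path_image (c i) \<inter> nice_image g1 g2 j \<subseteq> P" "cball (x i) (r i) \<inter> nice_image g1 g2 j = {}"
      using N[OF ij(2)] cc[OF ij] cbOb[OF ij(1)] cbOb[OF ij(2)] cbcb[OF ij] by blast+
  qed
  have "chord_drawing P I g1 g2 x r"
  proof (rule chord_drawing.intro)
    obtain i where "i \<in> I" using I3 by fastforce
    then show "P \<noteq> {}" using ends by blast
  next
    fix i J assume i: "i \<in> I" and J: "J \<subseteq> I - {i}"
    note gi = g[OF i]
    have XP: "(P \<union> (\<Union>j\<in>J. nice_image g1 g2 j)) \<inter> path_image (c i) \<subseteq> {pathstart (c i), pathfinish (c i)}"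
      using Ncap(1)[OF i] J cP[OF i] by blast
    show "chord_edge (P \<union> (\<Union>j\<in>J. nice_image g1 g2 j)) (g1 i) (g2 i) (x i) (r i)"
    proof (rule chord_edge.intro)
      show "compact (P \<union> (\<Union>j\<in>J. nice_image g1 g2 j))"
        using J finI finP
        by (intro compact_Un compact_UN cN) (auto intro: finite_subset finite_imp_compact)
      have "pathstart (g1 i) \<notin> path_image (g2 i)" "pathfinish (g2 i) \<notin> path_image (g1 i)"
        using gi pathstart_in_path_image[of "g1 i"] pathfinish_in_path_image[of "g2 i"] by blast+
      then show "(P \<union> (\<Union>j\<in>J. nice_image g1 g2 j)) \<inter> path_image (g1 i) = {pathstart (g1 i)}"
        "(P \<union> (\<Union>j\<in>J. nice_image g1 g2 j)) \<inter> path_image (g2 i) = {pathfinish (g2 i)}"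
        using XP gi ends[OF i] pathstart_in_path_image[of "g1 i"] pathfinish_in_path_image[of "g2 i"] by auto
      have "P \<inter> cball (x i) (r i) = {}" using cbOb[OF i] unfolding Ob_def by blast
      then show "(P \<union> (\<Union>j\<in>J. nice_image g1 g2 j)) \<inter> cball (x i) (r i) = {}"
        using Ncap(2)[OF i] J by blast
    qed (use gi in blast)+
  next
    fix i assume "i \<in> I"
    then show "pathstart (g1 i) \<in> P" "pathfinish (g2 i) \<in> P" using g ends by simp_all
  next
    fix i j assume "i \<in> I" "j \<in> I" "i \<noteq> j"
    then show "{pathstart (g1 i), pathfinish (g2 i)} \<noteq> {pathstart (g1 j), pathfinish (g2 j)}"
      using g simple by metis
  qed (fact finP finI)+
  then show ?thesis using chord_drawing.edge_bound I3 by blast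
qed

section \<open>Graphs on the torus\<close>

definition lat :: "int \<times> int \<Rightarrow> complex" where "lat w = Complex (of_int (fst w)) (of_int (snd w))"

text \<open>The universal covering of the product of two unit circles; its deck transformations are
  the translations by \<open>lat w\<close>.\<close>

definition tor :: "complex \<Rightarrow> complex \<times> complex" where
  "tor z = (cis (2 * pi * Re z), cis (2 * pi * Im z))"

lemma lat_add: "lat (v + w) = lat v + lat w" and lat_0 [simp]: "lat 0 = 0"
  by (auto simp: lat_def complex_eq_iff)

lemma lat_inject [simp]: "lat v = lat w \<longleftrightarrow> v = w"
  by (auto simp: lat_def prod_eq_iff)

lemma cis_2pi_eq_iff: "cis (2 * pi * a) = cis (2 * pi * b) \<longleftrightarrow> (\<exists>n::int. a = b + of_int n)"
proof -
  have "cis (2 * pi * a) = cis (2 * pi * b) \<longleftrightarrow> sin (2 * pi * a) = sin (2 * pi * b) \<and> cos (2 * pi * a) = cos (2 * pi * b)"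
    by (auto simp: complex_eq_iff)
  also have "\<dots> \<longleftrightarrow> (\<exists>n::int. 2 * pi * a = 2 * pi * b + 2 * pi * of_int n)"
    using sin_cos_eq_iff[of "2 * pi * a" "2 * pi * b"] by (simp add: mult.commute mult.left_commute)
  also have "\<dots> \<longleftrightarrow> (\<exists>n::int. a = b + of_int n)"
    by (simp add: distrib_left[symmetric])
  finally show ?thesis .
qed

lemma tor_eq_iff: "tor z = tor z' \<longleftrightarrow> (\<exists>w. z = z' + lat w)"
  unfolding tor_def prod.inject cis_2pi_eq_iff by (auto simp: lat_def complex_eq_iff)

lemma tor_add_lat [simp]: "tor (z + lat w) = tor z"
  unfolding tor_eq_iff by blast

lemma circle_lift:
  assumes "continuous_on {0..1::real} h" "\<And>t. t \<in> {0..1} \<Longrightarrow> cmod (h t) = 1"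
  obtains a where "continuous_on {0..1} a" "\<And>t. t \<in> {0..1} \<Longrightarrow> h t = cis (2 * pi * a t)"
proof -
  have "h t \<noteq> 0" if "t \<in> {0..1}" for t using assms(2)[OF that] by auto
  then obtain g where g: "continuous_on {0..1} g" "\<And>t. t \<in> {0..1} \<Longrightarrow> h t = exp (g t)"
    using continuous_logarithm_on_contractible[OF assms(1) convex_imp_contractible] by auto
  show ?thesis
  proof
    show "continuous_on {0..1} (\<lambda>t. Im (g t) / (2 * pi))" using g(1) by (intro continuous_intros) auto
    fix t :: real assume t: "t \<in> {0..1}"
    have "exp (Re (g t)) = 1" using assms(2)[OF t] g(2)[OF t] by simp
    then show "h t = cis (2 * pi * (Im (g t) / (2 * pi)))"
      using g(2)[OF t] by (simp add: exp_eq_polar)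
  qed
qed

lemma torus_lift:
  assumes "path g" "path_image g \<subseteq> range tor"
  obtains l where "path l" "\<And>t. t \<in> {0..1} \<Longrightarrow> tor (l t) = g t"
proof -
  have cg: "continuous_on {0..1} g" using assms(1) by (simp add: path_def)
  have "\<exists>z. g t = tor z" if "t \<in> {0..1}" for t
    using assms(2) that unfolding path_image_def by blast
  then have n: "cmod (fst (g t)) = 1" "cmod (snd (g t)) = 1" if "t \<in> {0..1}" for t
    using that unfolding tor_def by force+
  obtain a where a: "continuous_on {0..1} a" "\<And>t. t \<in> {0..1} \<Longrightarrow> fst (g t) = cis (2 * pi * a t)"
    using circle_lift[of "\<lambda>t. fst (g t)"] cg n by (auto intro!: continuous_on_fst)
  obtain b where b: "continuous_on {0..1} b" "\<And>t. t \<in> {0..1} \<Longrightarrow> snd (g t) = cis (2 * pi * b t)"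
    using circle_lift[of "\<lambda>t. snd (g t)"] cg n by (auto intro!: continuous_on_snd)
  show ?thesis
  proof
    show "path (\<lambda>t. Complex (a t) (b t))"
      using a(1) b(1) unfolding path_def Complex_eq by (intro continuous_intros) auto
    show "tor (Complex (a t) (b t)) = g t" if "t \<in> {0..1}" for t
      using a(2)[OF that] b(2)[OF that] by (simp add: tor_def prod_eq_iff)
  qed
qed

section \<open>Curves with independent periods meet\<close>

definition det2 :: "int \<times> int \<Rightarrow> int \<times> int \<Rightarrow> int" where
  "det2 v w = fst v * snd w - snd v * fst w"

text \<open>Translates of \<open>f\<close> are joined end to end. As \<open>Y\<close> is invariant
  under translation by \<open>d\<close>, its bound on \<open>f\<close> controls the path however
  long it gets.\<close>

lemma repeat_path:
  assumes f: "path f" "pathstart f = z" "pathfinish f = z + d" "path_image f \<subseteq> S"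
    and S: "\<And>z. z \<in> S \<Longrightarrow> z + d \<in> S"
    and Y: "\<And>z. Y (z + d) = Y z" "\<And>z. z \<in> path_image f \<Longrightarrow> \<bar>Y z :: real\<bar> \<le> C"
  shows "\<exists>h. path h \<and> pathstart h = z \<and> pathfinish h = z + of_nat (Suc n) * (d :: complex) \<and>
    path_image h \<subseteq> S \<and> (\<forall>z\<in>path_image h. \<bar>Y z\<bar> \<le> C)"
proof (induction n)
  case 0
  show ?case using f Y by (intro exI[of _ f]) auto
next
  case (Suc n)
  then obtain h where h: "path h" "pathstart h = z" "pathfinish h = z + of_nat (Suc n) * d"
    "path_image h \<subseteq> S" "\<And>z. z \<in> path_image h \<Longrightarrow> \<bar>Y z\<bar> \<le> C" by blast
  define k where "k = (\<lambda>t. h t + d)"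
  have k: "path k" "pathstart k = z + d" "pathfinish k = z + of_nat (Suc (Suc n)) * d"
    "path_image k = (\<lambda>z. z + d) ` path_image h"
    using h unfolding k_def path_def pathstart_def pathfinish_def path_image_def
    by (auto intro!: continuous_intros simp: algebra_simps)
  show ?case
  proof (intro exI conjI ballI)
    show "path (f +++ k)" using f k by simp
    show "pathstart (f +++ k) = z" "pathfinish (f +++ k) = z + of_nat (Suc (Suc n)) * d"
      using f k by simp_all
    have im: "path_image (f +++ k) = path_image f \<union> (\<lambda>z. z + d) ` path_image h"
      using f k by (simp add: path_image_join)
    show "path_image (f +++ k) \<subseteq> S" unfolding im using f(4) h(4) S by auto
    show "\<bar>Y y\<bar> \<le> C" if "y \<in> path_image (f +++ k)" for y
      using that Y h(5) unfolding im by auto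
  qed
qed

text \<open>In coordinates with respect to \<open>m\<close> and \<open>m'\<close>, repeating the two paths gives a long horizontal and a long vertical curve,
  each of bounded width. Clamping the long coordinate turns them into curves in a square that join opposite sides,
  as the Fashoda meet theorem requires; the clamped curves can only meet where no clamping takes place.\<close>

lemma crossing_periods:
  assumes S: "\<And>z w. z \<in> S \<Longrightarrow> z + lat w \<in> S" and S': "\<And>z w. z \<in> S' \<Longrightarrow> z + lat w \<in> S'"
    and disj: "S \<inter> S' = {}"
    and f: "path_component S z (z + lat m)" and g: "path_component S' z' (z' + lat m')"
  shows "det2 m m' = 0"
proof (rule ccontr)
  assume D0: "det2 m m' \<noteq> 0"
  define D where "D = real_of_int (det2 m m')"
  have D: "D \<noteq> 0" "D = fst m * snd m' - snd m * fst m'" using D0 unfolding D_def by (simp, simp add: det2_def)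
  \<comment> \<open>Cramer's rule: \<open>X z\<close> and \<open>Y z\<close> are the coordinates of
    \<open>z\<close> in the basis \<open>lat m\<close>, \<open>lat m'\<close>.\<close>
  define X where "X z = (Re z * snd m' - Im z * fst m') / D" for z
  define Y where "Y z = (Im z * fst m - Re z * snd m) / D" for z
  have X_add: "X (a + b) = X a + X b" and Y_add: "Y (a + b) = Y a + Y b" for a b
    unfolding X_def Y_def by (simp_all add: field_simps add_divide_distrib diff_divide_distrib)
  have X_n: "X (of_real s * a) = s * X a" and Y_n: "Y (of_real s * a) = s * Y a" for s a
    unfolding X_def Y_def by (simp_all add: field_simps)
  have Xm: "X (lat m) = 1" "X (lat m') = 0" and Ym: "Y (lat m) = 0" "Y (lat m') = 1"
    using D unfolding X_def Y_def lat_def by (simp_all add: field_simps)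
  have XY: "a = b" if "X a = X b" "Y a = Y b" for a b
  proof -
    have "Re a = X a * fst m + Y a * fst m'" "Im a = X a * snd m + Y a * snd m'" for a
    proof -
      have XD: "X a * D = Re a * snd m' - Im a * fst m'" "Y a * D = Im a * fst m - Re a * snd m"
        using D(1) unfolding X_def Y_def by simp_all
      have "(X a * fst m + Y a * fst m') * D = (X a * D) * fst m + (Y a * D) * fst m'"
        "(X a * snd m + Y a * snd m') * D = (X a * D) * snd m + (Y a * D) * snd m'"
        by (simp_all add: algebra_simps)
      then have "(X a * fst m + Y a * fst m') * D = Re a * D" "(X a * snd m + Y a * snd m') * D = Im a * D"
        unfolding XD by (simp_all add: D(2) algebra_simps)
      then show "Re a = X a * fst m + Y a * fst m'" "Im a = X a * snd m + Y a * snd m'"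
        using D(1) by simp_all
    qed
    then show ?thesis using that by (simp add: complex_eq_iff)
  qed
  have contXY: "continuous_on T X" "continuous_on T Y" for T
    unfolding X_def Y_def by (intro continuous_intros; use D in simp)+
  obtain f where f: "path f" "path_image f \<subseteq> S" "pathstart f = z" "pathfinish f = z + lat m"
    using f unfolding path_component_def by blast
  obtain g where g: "path g" "path_image g \<subseteq> S'" "pathstart g = z'" "pathfinish g = z' + lat m'"
    using g unfolding path_component_def by blast
  have bdd: "\<exists>C. \<forall>z\<in>path_image h. \<bar>F z\<bar> \<le> C" if "path h" "continuous_on UNIV F" for h :: "real \<Rightarrow> complex" and F :: "complex \<Rightarrow> real"
  proof -
    have "compact (F ` path_image h)"
      using that by (intro compact_continuous_image compact_path_image continuous_on_subset[OF that(2)]) auto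
    then have "bounded (F ` path_image h)" by (rule compact_imp_bounded)
    then show ?thesis by (auto simp: bounded_iff)
  qed
  obtain C where C: "\<And>z. z \<in> path_image f \<Longrightarrow> \<bar>Y z\<bar> \<le> C" using bdd[OF f(1) contXY(2)] by blast
  obtain C' where C': "\<And>z. z \<in> path_image g \<Longrightarrow> \<bar>X z\<bar> \<le> C'" using bdd[OF g(1) contXY(1)] by blast
  have "0 \<le> \<bar>Y z\<bar>" "\<bar>Y z\<bar> \<le> C" "0 \<le> \<bar>X z'\<bar>" "\<bar>X z'\<bar> \<le> C'"
    using C[of z] C'[of z'] f g pathstart_in_path_image[of f] pathstart_in_path_image[of g] by auto
  then have C0: "0 \<le> C" "0 \<le> C'" by linarith+
  \<comment> \<open>Strictly larger than both widths \<open>C\<close> and \<open>C'\<close>, so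
    neither narrow coordinate reaches the border of the square.\<close>
  define R where "R = C + C' + 1"
  \<comment> \<open>\<open>2 * N\<close> periods, shifted back by \<open>N\<close> of them, run from
    beyond one side of the square to beyond the opposite one, wherever the base points lie.\<close>
  obtain N :: nat where N: "real N > R + \<bar>X z\<bar> + \<bar>Y z'\<bar>" using reals_Archimedean2 by blast
  have N1: "2 * N = Suc (2 * N - 1)" using N C0 unfolding R_def by (cases N) auto
  have shift: "z + of_nat k * lat w = z + lat (int k * fst w, int k * snd w)" for z k w
    by (simp add: lat_def complex_eq_iff)
  have shiftN: "- (of_nat k * lat w) = lat (- int k * fst w, - int k * snd w)" for k w
    by (simp add: lat_def complex_eq_iff)
  obtain h0 where h0: "path h0" "pathstart h0 = z" "pathfinish h0 = z + of_nat (2 * N) * lat m"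
    "path_image h0 \<subseteq> S" "\<forall>z\<in>path_image h0. \<bar>Y z\<bar> \<le> C"
    using repeat_path[OF f(1,3,4,2) S, of Y C "2 * N - 1"] C unfolding N1[symmetric] by (auto simp: Y_add Ym)
  obtain k0 where k0: "path k0" "pathstart k0 = z'" "pathfinish k0 = z' + of_nat (2 * N) * lat m'"
    "path_image k0 \<subseteq> S'" "\<forall>z\<in>path_image k0. \<bar>X z\<bar> \<le> C'"
    using repeat_path[OF g(1,3,4,2) S', of X C' "2 * N - 1"] C' unfolding N1[symmetric] by (auto simp: X_add Xm)
  define h where "h t = h0 t - of_nat N * lat m" for t
  define k where "k t = k0 t - of_nat N * lat m'" for t
  have XN: "X (of_nat n * a) = n * X a" "Y (of_nat n * a) = n * Y a" "X (- a) = - X a" "Y (- a) = - Y a" for n a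
    using X_n[of "of_nat n" a] Y_n[of "of_nat n" a] X_n[of "-1" a] Y_n[of "-1" a] by simp_all
  have h: "continuous_on {0..1} h" "X (h 0) = X z - N" "X (h 1) = X z + N"
    "\<And>t. t \<in> {0..1} \<Longrightarrow> h t \<in> S" "\<And>t. t \<in> {0..1} \<Longrightarrow> \<bar>Y (h t)\<bar> \<le> C"
  proof -
    show "continuous_on {0..1} h" using h0(1) unfolding h_def path_def by (intro continuous_intros) auto
    have h01: "h 0 = z + - (of_nat N * lat m)" "h 1 = z + of_nat N * lat m"
      using h0(2,3) unfolding h_def pathstart_def pathfinish_def by (auto simp: algebra_simps)
    show "X (h 0) = X z - N" "X (h 1) = X z + N" unfolding h01 X_add XN Xm by simp_all
    fix t :: real assume "t \<in> {0..1}"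
    then have t: "h0 t \<in> path_image h0" by (auto simp: path_image_def)
    have ht: "h t = h0 t + - (of_nat N * lat m)" unfolding h_def by simp
    show "h t \<in> S" using t h0(4) S unfolding ht shiftN by blast
    show "\<bar>Y (h t)\<bar> \<le> C" using t h0(5) unfolding ht Y_add XN Ym by simp
  qed
  have k: "continuous_on {0..1} k" "Y (k 0) = Y z' - N" "Y (k 1) = Y z' + N"
    "\<And>t. t \<in> {0..1} \<Longrightarrow> k t \<in> S'" "\<And>t. t \<in> {0..1} \<Longrightarrow> \<bar>X (k t)\<bar> \<le> C'"
  proof -
    show "continuous_on {0..1} k" using k0(1) unfolding k_def path_def by (intro continuous_intros) auto
    have k01: "k 0 = z' + - (of_nat N * lat m')" "k 1 = z' + of_nat N * lat m'"
      using k0(2,3) unfolding k_def pathstart_def pathfinish_def by (auto simp: algebra_simps)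
    show "Y (k 0) = Y z' - N" "Y (k 1) = Y z' + N" unfolding k01 Y_add XN Ym by simp_all
    fix t :: real assume "t \<in> {0..1}"
    then have t: "k0 t \<in> path_image k0" by (auto simp: path_image_def)
    have kt: "k t = k0 t + - (of_nat N * lat m')" unfolding k_def by simp
    show "k t \<in> S'" using t k0(4) S' unfolding kt shiftN by blast
    show "\<bar>X (k t)\<bar> \<le> C'" using t k0(5) unfolding kt X_add XN Xm by simp
  qed
  define cl where "cl t = max (- R) (min R t)" for t
  define F where "F t = (vector [cl (X (h t)), Y (h t)] :: real^2)" for t
  define K where "K t = (vector [X (k t), cl (Y (k t))] :: real^2)" for t
  have vec: "(vector [a, b] :: real^2) \<in> cbox (vector [- R, - R]) (vector [R, R]) \<longleftrightarrow> \<bar>a\<bar> \<le> R \<and> \<bar>b\<bar> \<le> R" for a b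
    by (auto simp: mem_box_cart forall_2)
  have pv: "path (\<lambda>t. vector [a t, b t] :: real^2)" if "continuous_on {0..1} a" "continuous_on {0..1} b" for a b
  proof -
    have "(\<lambda>t. vector [a t, b t] :: real^2) = (\<lambda>t. \<chi> i. if i = 1 then a t else b t)"
      by (intro ext) (simp add: Finite_Cartesian_Product.vec_eq_iff forall_2)
    moreover have "continuous_on {0..1} (\<lambda>t. if i = (1::2) then a t else b t)" for i
      using that by (cases "i = 1") simp_all
    then have "continuous_on {0..1} (\<lambda>t. \<chi> i. if i = (1::2) then a t else b t)"
      by (intro continuous_on_vec_lambda)
    ultimately show ?thesis by (simp add: path_def)
  qed
  have comp: "continuous_on {0..1} (\<lambda>t. cl (X (h t)))" "continuous_on {0..1} (\<lambda>t. Y (h t))"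
    "continuous_on {0..1} (\<lambda>t. X (k t))" "continuous_on {0..1} (\<lambda>t. cl (Y (k t)))"
    unfolding cl_def
    by (intro continuous_intros continuous_on_compose2[OF contXY(1)[of UNIV]] continuous_on_compose2[OF contXY(2)[of UNIV]] h(1) k(1); simp)+
  have R0: "R > 0" "C < R" "C' < R" using C0 unfolding R_def by auto
  obtain y where y: "y \<in> path_image F" "y \<in> path_image K"
  proof (rule fashoda[of F K "vector [- R, - R]" "vector [R, R]"])
    show "path F" "path K" unfolding F_def K_def using comp by (intro pv; simp)+
    have "\<bar>cl a\<bar> \<le> R" for a unfolding cl_def using R0 by (auto simp: max_def min_def)
    moreover have "\<bar>Y (h t)\<bar> \<le> R" "\<bar>X (k t)\<bar> \<le> R" if "t \<in> {0..1}" for t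
      using h(5)[OF that] k(5)[OF that] R0 by linarith+
    ultimately show "path_image F \<subseteq> cbox (vector [- R, - R]) (vector [R, R])"
      "path_image K \<subseteq> cbox (vector [- R, - R]) (vector [R, R])"
      unfolding path_image_def F_def K_def image_subset_iff vec by auto
    have "cl (X (h 0)) = - R" "cl (X (h 1)) = R" "cl (Y (k 0)) = - R" "cl (Y (k 1)) = R"
      unfolding h k cl_def using N R0 by (auto simp: max_def min_def)
    then show "pathstart F $ 1 = (vector [- R, - R] :: real^2) $ 1" "pathfinish F $ 1 = (vector [R, R] :: real^2) $ 1"
      "pathstart K $ 2 = (vector [- R, - R] :: real^2) $ 2" "pathfinish K $ 2 = (vector [R, R] :: real^2) $ 2"
      by (simp_all add: pathstart_def pathfinish_def F_def K_def)
  qed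
  then obtain s t where st: "s \<in> {0..1}" "t \<in> {0..1}" "F s = K t" unfolding path_image_def by auto
  have eq: "cl (X (h s)) = X (k t)" "Y (h s) = cl (Y (k t))"
    using arg_cong[OF st(3), of "\<lambda>v :: real^2. v $ 1"] arg_cong[OF st(3), of "\<lambda>v :: real^2. v $ 2"]
    unfolding F_def K_def by simp_all
  \<comment> \<open>At a common point the clamped coordinate of one curve equals the narrow
    coordinate of the other, which is strictly between \<open>- R\<close> and \<open>R\<close>. So
    no clamping happened there and the original curves meet.\<close>
  have "X (h s) = X (k t)" "Y (h s) = Y (k t)"
    using eq h(5)[OF st(1)] k(5)[OF st(2)] R0 unfolding cl_def by (auto simp: max_def min_def split: if_splits)
  then have "h s = k t" by (rule XY)
  then show False using h(4)[OF st(1)] k(4)[OF st(2)] disj by auto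
qed

section \<open>Lifting a toroidal drawing to the plane\<close>

definition all_pairs :: "'a set \<Rightarrow> 'a set set" where
  "all_pairs A = {e. \<exists>u v. e = {u, v} \<and> u \<noteq> v \<and> u \<in> A \<and> v \<in> A}"

text \<open>Every edge has one lift \<open>l e\<close> and every vertex one lift \<open>b v\<close>,
  chosen independently: the ends of \<open>l e\<close> need not be of the form \<open>b v\<close>,
  only translates of such points.\<close>

locale torus_drawing =
  fixes V :: "'a set" and E :: "'a set set" and p :: "'a \<Rightarrow> complex \<times> complex"
    and c :: "'a set \<Rightarrow> real \<Rightarrow> complex \<times> complex"
    and l :: "'a set \<Rightarrow> real \<Rightarrow> complex" and b :: "'a \<Rightarrow> complex"
  assumes finV: "finite V"
    and E: "\<And>e. e \<in> E \<Longrightarrow> \<exists>u v. e = {u, v} \<and> u \<noteq> v \<and> u \<in> V \<and> v \<in> V"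
    and inj: "inj_on p V"
    and c_arc: "\<And>e. e \<in> E \<Longrightarrow> arc (c e)"
    and c_ends: "\<And>e. e \<in> E \<Longrightarrow> {pathstart (c e), pathfinish (c e)} = p ` e"
    and c_V: "\<And>e. e \<in> E \<Longrightarrow> path_image (c e) \<inter> p ` V = p ` e"
    and cc: "\<And>e f. e \<in> E \<Longrightarrow> f \<in> E \<Longrightarrow> e \<noteq> f \<Longrightarrow> path_image (c e) \<inter> path_image (c f) = p ` (e \<inter> f)"
    and l_path: "\<And>e. e \<in> E \<Longrightarrow> path (l e)"
    and l_tor: "\<And>e t. e \<in> E \<Longrightarrow> t \<in> {0..1} \<Longrightarrow> tor (l e t) = c e t"
    and b_tor: "\<And>v. v \<in> V \<Longrightarrow> tor (b v) = p v"
begin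

lemma E_sub: "e \<in> E \<Longrightarrow> e \<subseteq> V" using E by blast

lemma finE: "finite E"
  using finV E_sub by (meson PowI finite_Pow_iff finite_subset subsetI)

definition "tr e w = (\<lambda>t. l e t + lat w)"

lemma tor_tr: "e \<in> E \<Longrightarrow> t \<in> {0..1} \<Longrightarrow> tor (tr e w t) = c e t"
  by (simp add: tr_def l_tor)

lemma c_inj: "e \<in> E \<Longrightarrow> s \<in> {0..1} \<Longrightarrow> t \<in> {0..1} \<Longrightarrow> c e s = c e t \<Longrightarrow> s = t"
  using c_arc[of e] by (auto simp: arc_def dest: inj_onD)

lemma tr_arc: assumes "e \<in> E" shows "arc (tr e w)"
proof -
  have "path (tr e w)" using l_path[OF assms] unfolding tr_def path_def by (intro continuous_intros) auto
  moreover have "inj_on (tr e w) {0..1}"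
    using c_inj[OF assms] tor_tr[OF assms] by (intro inj_onI) metis
  ultimately show ?thesis by (simp add: arc_def)
qed

lemma tr_ends: "pathstart (tr e w) = l e 0 + lat w" "pathfinish (tr e w) = l e 1 + lat w"
  by (auto simp: tr_def pathstart_def pathfinish_def)

lemma tor_ends: assumes "e \<in> E"
  shows "{tor (pathstart (tr e w)), tor (pathfinish (tr e w))} = p ` e"
  using c_ends[OF assms] l_tor[OF assms, of 0] l_tor[OF assms, of 1] unfolding tr_ends
  by (simp add: pathstart_def pathfinish_def)

lemma tr_image: assumes "e \<in> E" "z \<in> path_image (tr e w)"
  obtains t where "t \<in> {0..1}" "z = tr e w t" "tor z = c e t" "tor z \<in> path_image (c e)"
proof -
  obtain t where t: "t \<in> {0..1}" "z = tr e w t" using assms(2) unfolding path_image_def by blast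
  then have "tor z = c e t" using tor_tr[OF assms(1)] by blast
  moreover have "c e t \<in> path_image (c e)" using t(1) unfolding path_image_def by blast
  ultimately show ?thesis by (intro that[OF t]) simp_all
qed

lemma tr_vertex: assumes "e \<in> E" "z \<in> path_image (tr e w)" "tor z \<in> p ` V"
  shows "z \<in> {pathstart (tr e w), pathfinish (tr e w)}"
proof -
  obtain t where t: "t \<in> {0..1}" "z = tr e w t" "tor z = c e t" "tor z \<in> path_image (c e)"
    using tr_image assms by blast
  then have "c e t \<in> p ` e" using c_V[OF assms(1)] assms(3) by auto
  then have "c e t = c e 0 \<or> c e t = c e 1" using c_ends[OF assms(1)] by (auto simp: pathstart_def pathfinish_def)
  then have "t = 0 \<or> t = 1" using c_inj[OF assms(1) t(1)] by force
  then show ?thesis using t(2) by (auto simp: pathstart_def pathfinish_def)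
qed

text \<open>Different edges meet on the torus only in vertices. Two lifts of one edge could only
  meet at equal parameters because \<open>c e\<close> is injective, and then the translations agree;
  so this case does not occur.\<close>

lemma tr_meet: assumes "e \<in> E" "e' \<in> E" "(e, w) \<noteq> (e', w')"
  "z \<in> path_image (tr e w)" "z \<in> path_image (tr e' w')"
  shows "tor z \<in> p ` V"
proof (cases "e = e'")
  case False
  have "tor z \<in> path_image (c e) \<inter> path_image (c e')"
    using tr_image[OF assms(1,4)] tr_image[OF assms(2,5)] by (metis IntI)
  then show ?thesis using cc[OF assms(1,2) False] E_sub[OF assms(1)] by auto
next
  case True
  obtain t where t: "t \<in> {0..1}" "z = tr e w t" "tor z = c e t" using tr_image[OF assms(1,4)] by blast
  obtain s where s: "s \<in> {0..1}" "z = tr e w' s" "tor z = c e s" using tr_image[OF assms(2,5)] True by blast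
  have "s = t" using c_inj[OF assms(1) s(1) t(1)] s t by simp
  then have "w = w'" using s t by (simp add: tr_def)
  then show ?thesis using assms(3) True by simp
qed

lemma c_ne: "e \<in> E \<Longrightarrow> c e 0 \<noteq> c e 1" using c_inj[of e 0 1] by auto

lemma edge_eq: "e \<in> E \<Longrightarrow> e' \<in> E \<Longrightarrow> p ` e = p ` e' \<Longrightarrow> e = e'"
  using inj E_sub by (metis inj_on_image_eq_iff)

text \<open>This makes the lifted graph simple. Two lifts of one edge cannot share their ends in
  swapped order, as the two ends project to different vertices; and equal starts force equal
  translations.\<close>

lemma tr_ends_ne: assumes "e \<in> E" "e' \<in> E" "(e, w) \<noteq> (e', w')"
  shows "{pathstart (tr e w), pathfinish (tr e w)} \<noteq> {pathstart (tr e' w'), pathfinish (tr e' w')}"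
proof
  assume eq: "{pathstart (tr e w), pathfinish (tr e w)} = {pathstart (tr e' w'), pathfinish (tr e' w')}"
  have "tor ` {pathstart (tr e w), pathfinish (tr e w)} = tor ` {pathstart (tr e' w'), pathfinish (tr e' w')}"
    using eq by simp
  then have "p ` e = p ` e'" using tor_ends[OF assms(1), of w] tor_ends[OF assms(2), of w'] by simp
  then have ee: "e = e'" using edge_eq assms by blast
  have "l e 0 + lat w \<noteq> l e 1 + lat w'"
    using c_ne[OF assms(1)] l_tor[OF assms(1), of 0] l_tor[OF assms(1), of 1] by (metis atLeastAtMost_iff order_refl tor_add_lat zero_le_one)
  then have "l e 0 + lat w = l e 0 + lat w'" using eq ee unfolding tr_ends by (auto simp: doubleton_eq_iff)
  then show False using ee assms(3) by simp
qed

lemma plane_bound: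
  assumes Q: "finite Q" "Q \<subseteq> E \<times> UNIV" "card Q \<ge> 3" and P: "finite P" "tor ` P \<subseteq> p ` V"
    and ends: "\<And>e w. (e, w) \<in> Q \<Longrightarrow> pathstart (tr e w) \<in> P \<and> pathfinish (tr e w) \<in> P"
  shows "card Q + 6 \<le> 3 * card P"
proof (rule planar_edge_bound[where c = "\<lambda>(e, w). tr e w"])
  fix i assume i: "i \<in> Q"
  obtain e w where ew: "i = (e, w)" "e \<in> E" using i Q(2) by auto
  show "arc (case i of (e, w) \<Rightarrow> tr e w)" using ew tr_arc by simp
  show "pathstart (case i of (e, w) \<Rightarrow> tr e w) \<in> P" "pathfinish (case i of (e, w) \<Rightarrow> tr e w) \<in> P"
    using ends i unfolding ew by auto
  show "path_image (case i of (e, w) \<Rightarrow> tr e w) \<inter> P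
    \<subseteq> {pathstart (case i of (e, w) \<Rightarrow> tr e w), pathfinish (case i of (e, w) \<Rightarrow> tr e w)}"
    unfolding ew split_conv
  proof
    fix z assume "z \<in> path_image (tr e w) \<inter> P"
    then show "z \<in> {pathstart (tr e w), pathfinish (tr e w)}" using tr_vertex[OF ew(2)] P(2) by blast
  qed
  fix j assume j: "j \<in> Q" "i \<noteq> j"
  obtain e' w' where ew': "j = (e', w')" "e' \<in> E" using j Q(2) by auto
  show "{pathstart (case i of (e, w) \<Rightarrow> tr e w), pathfinish (case i of (e, w) \<Rightarrow> tr e w)}
    \<noteq> {pathstart (case j of (e, w) \<Rightarrow> tr e w), pathfinish (case j of (e, w) \<Rightarrow> tr e w)}"
    using tr_ends_ne[OF ew(2) ew'(2), of w w'] j(2) unfolding ew ew' by simp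
  show "path_image (case i of (e, w) \<Rightarrow> tr e w) \<inter> path_image (case j of (e, w) \<Rightarrow> tr e w) \<subseteq> P"
  proof
    fix z assume "z \<in> path_image (case i of (e, w) \<Rightarrow> tr e w) \<inter> path_image (case j of (e, w) \<Rightarrow> tr e w)"
    then have z: "z \<in> path_image (tr e w)" "z \<in> path_image (tr e' w')" unfolding ew ew' by auto
    have "(e, w) \<noteq> (e', w')" using j(2) unfolding ew ew' .
    then have "tor z \<in> p ` V" using tr_meet[OF ew(2) ew'(2) _ z] by blast
    then have "z \<in> {pathstart (tr e w), pathfinish (tr e w)}" using tr_vertex[OF ew(2) z(1)] by blast
    then show "z \<in> P" using ends[of e w] i unfolding ew by auto
  qed
qed (use Q P in auto)

definition "isquare m n = {m..<n} \<times> {m..<n::int}"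

lemma card_isquare: "m \<le> n \<Longrightarrow> card (isquare m n) = nat (n - m) ^ 2"
  by (simp add: isquare_def card_cartesian_product power2_eq_square)

text \<open>An end of \<open>l e\<close> lies over a vertex, so it differs from the chosen lift of
  that vertex by a lattice vector; as there are finitely many edges, one \<open>M\<close> bounds all
  these vectors.\<close>

lemma end_offsets: obtains M :: nat where
  "\<And>e. e \<in> E \<Longrightarrow> \<exists>u\<in>V. \<exists>i j. l e 0 = b u + lat (i, j) \<and> \<bar>i\<bar> \<le> M \<and> \<bar>j\<bar> \<le> M"
  "\<And>e. e \<in> E \<Longrightarrow> \<exists>u\<in>V. \<exists>i j. l e 1 = b u + lat (i, j) \<and> \<bar>i\<bar> \<le> M \<and> \<bar>j\<bar> \<le> M"
proof -
  have *: "\<exists>M::nat. \<forall>e\<in>E. \<exists>u\<in>V. \<exists>i j. l e s = b u + lat (i, j) \<and> \<bar>i\<bar> \<le> M \<and> \<bar>j\<bar> \<le> M" if s: "s = 0 \<or> s = 1" for s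
  proof -
    have "\<exists>m::nat. \<exists>u\<in>V. \<exists>i j. l e s = b u + lat (i, j) \<and> \<bar>i\<bar> \<le> m \<and> \<bar>j\<bar> \<le> m" if e: "e \<in> E" for e
    proof -
      have "c e s \<in> p ` e" using c_ends[OF e] s by (auto simp: pathstart_def pathfinish_def)
      then obtain u where u: "u \<in> V" "c e s = p u" using E_sub[OF e] by auto
      then have "tor (l e s) = tor (b u)" using l_tor[OF e, of s] b_tor[of u] s by auto
      then obtain i j where "l e s = b u + lat (i, j)" unfolding tor_eq_iff by auto
      then show ?thesis using u by (intro exI[of _ "nat (max \<bar>i\<bar> \<bar>j\<bar>)"] bexI[of _ u] exI[of _ i] exI[of _ j]) auto
    qed
    then obtain m :: "'a set \<Rightarrow> nat" where m: "\<And>e. e \<in> E \<Longrightarrow> \<exists>u\<in>V. \<exists>i j. l e s = b u + lat (i, j) \<and> \<bar>i\<bar> \<le> m e \<and> \<bar>j\<bar> \<le> m e"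
      by metis
    have "m e \<le> Max (insert 0 (m ` E))" if "e \<in> E" for e using finE that by (intro Max_ge) auto
    then have "\<forall>e\<in>E. \<exists>u\<in>V. \<exists>i j. l e s = b u + lat (i, j) \<and> \<bar>i\<bar> \<le> Max (insert 0 (m ` E)) \<and> \<bar>j\<bar> \<le> Max (insert 0 (m ` E))"
      using m by (meson of_nat_mono order_trans)
    then show ?thesis by blast
  qed
  obtain M0 :: nat where M0: "\<forall>e\<in>E. \<exists>u\<in>V. \<exists>i j. l e 0 = b u + lat (i, j) \<and> \<bar>i\<bar> \<le> M0 \<and> \<bar>j\<bar> \<le> M0" using * by blast
  obtain M1 :: nat where M1: "\<forall>e\<in>E. \<exists>u\<in>V. \<exists>i j. l e 1 = b u + lat (i, j) \<and> \<bar>i\<bar> \<le> M1 \<and> \<bar>j\<bar> \<le> M1" using * by blast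
  have mono: "\<exists>u\<in>V. \<exists>i j. z = b u + lat (i, j) \<and> \<bar>i\<bar> \<le> int (max M0 M1) \<and> \<bar>j\<bar> \<le> int (max M0 M1)"
    if u: "\<exists>u\<in>V. \<exists>i j. z = b u + lat (i, j) \<and> \<bar>i\<bar> \<le> int M' \<and> \<bar>j\<bar> \<le> int M'" and "M' \<le> max M0 M1" for z M'
  proof -
    obtain v i j where "v \<in> V" "z = b v + lat (i, j)" "\<bar>i\<bar> \<le> int M'" "\<bar>j\<bar> \<le> int M'" using u by blast
    moreover have "int M' \<le> int (max M0 M1)" using \<open>M' \<le> max M0 M1\<close> by simp
    ultimately show ?thesis by (intro bexI[of _ v] exI[of _ i] exI[of _ j]) auto
  qed
  show ?thesis
    by (rule that[of "max M0 M1"]; rule mono[OF bspec[OF M0]] mono[OF bspec[OF M1]]; simp)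
qed

text \<open>The lifts of the edges over an \<open>n \<times> n\<close> block of fundamental squares form a plane graph with \<open>n\<^sup>2 |E|\<close> edges and
  \<open>n\<^sup>2 |V| + O(n)\<close> vertices.\<close>

theorem torus_edge_bound: "card E \<le> 3 * card V"
proof (rule ccontr)
  assume "\<not> card E \<le> 3 * card V"
  then have big: "card E \<ge> 3 * card V + 1" by simp
  obtain M :: nat where M:
    "\<And>e. e \<in> E \<Longrightarrow> \<exists>u\<in>V. \<exists>i j. l e 0 = b u + lat (i, j) \<and> \<bar>i\<bar> \<le> M \<and> \<bar>j\<bar> \<le> M"
    "\<And>e. e \<in> E \<Longrightarrow> \<exists>u\<in>V. \<exists>i j. l e 1 = b u + lat (i, j) \<and> \<bar>i\<bar> \<le> M \<and> \<bar>j\<bar> \<le> M"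
    using end_offsets by blast
  obtain e0 where "e0 \<in> E" using big by fastforce
  then have "V \<noteq> {}" using E_sub E by blast
  then have V1: "card V \<ge> 1" using finV by (simp add: Suc_leI card_gt_0_iff)
  \<comment> \<open>Comparing edges and vertices will give
    \<open>n\<^sup>2 < 12 |V| M n + 12 |V| M\<^sup>2\<close>, hence
    \<open>n\<^sup>2 < (n - 1) * n\<close> for this choice.\<close>
  define n where "n = 12 * card V * M + 12 * card V * M ^ 2 + 1"
  define Q where "Q = E \<times> isquare 0 (int n)"
  \<comment> \<open>The block of vertices has a margin of \<open>M\<close> on each side, so that
    both ends of every lifted edge of the inner block lie in \<open>P\<close>.\<close>
  define P where "P = (\<lambda>(v, w). b v + lat w) ` (V \<times> isquare (- int M) (int n + int M))"
  have cQ: "card Q = card E * n ^ 2" unfolding Q_def by (simp add: card_cartesian_product card_isquare)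
  have finP: "finite P" unfolding P_def isquare_def using finV by auto
  have "card P \<le> card (V \<times> isquare (- int M) (int n + int M))" unfolding P_def
    using finV by (intro card_image_le) (auto simp: isquare_def)
  also have "\<dots> = card V * (n + 2 * M) ^ 2"
  proof -
    have "nat (int n + int M - - int M) = n + 2 * M" by linarith
    then show ?thesis by (simp add: card_cartesian_product card_isquare)
  qed
  finally have cP: "card P \<le> card V * (n + 2 * M) ^ 2" .
  have n1: "n ^ 2 \<ge> 1" unfolding n_def by simp
  have E4: "card E \<ge> 4" using big V1 by linarith
  have Q3: "card Q \<ge> 3"
  proof -
    have "3 * 1 \<le> card E * n ^ 2" using E4 n1 by (intro mult_le_mono) auto
    then show ?thesis unfolding cQ by simp
  qed
  have in_P: "b u + lat (i, j) + lat w \<in> P" if "u \<in> V" "\<bar>i\<bar> \<le> M" "\<bar>j\<bar> \<le> M" "w \<in> isquare 0 (int n)" for u i j w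
  proof -
    have "(i, j) + w \<in> isquare (- int M) (int n + int M)" using that by (auto simp: isquare_def)
    then have "b u + lat ((i, j) + w) \<in> P" unfolding P_def using that(1) by (intro image_eqI[of _ _ "(u, (i, j) + w)"]) auto
    then show ?thesis by (simp add: lat_add add.assoc)
  qed
  have "card Q + 6 \<le> 3 * card P"
  proof (rule plane_bound)
    show "finite Q" unfolding Q_def isquare_def using finE by auto
    show "tor ` P \<subseteq> p ` V" unfolding P_def using b_tor by auto
    fix e w assume "(e, w) \<in> Q"
    then have ew: "e \<in> E" "w \<in> isquare 0 (int n)" unfolding Q_def by auto
    show "pathstart (tr e w) \<in> P \<and> pathfinish (tr e w) \<in> P"
      using M(1)[OF ew(1)] M(2)[OF ew(1)] in_P ew(2) unfolding tr_ends by metis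
  qed (use finP Q3 in \<open>auto simp: Q_def\<close>)
  also have "\<dots> \<le> 3 * (card V * (n + 2 * M) ^ 2)" using cP by simp
  finally have 1: "card E * n ^ 2 + 6 \<le> 3 * card V * (n + 2 * M) ^ 2" unfolding cQ by simp
  have "(3 * card V + 1) * n ^ 2 \<le> card E * n ^ 2" using big by (intro mult_right_mono) auto
  then have "(3 * card V + 1) * n ^ 2 < 3 * card V * (n + 2 * M) ^ 2" using 1 by linarith
  then have "n ^ 2 < 12 * card V * M * n + 12 * card V * M ^ 2" by (simp add: power2_eq_square algebra_simps)
  moreover have "12 * card V * M ^ 2 * 1 \<le> 12 * card V * M ^ 2 * n"
    by (rule mult_le_mono2) (simp add: n_def)
  ultimately have "n ^ 2 < 12 * card V * M * n + 12 * card V * M ^ 2 * n" by linarith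
  then have "n * n < (12 * card V * M + 12 * card V * M ^ 2) * n" by (simp only: power2_eq_square distrib_right)
  then show False unfolding n_def by simp
qed

definition "L A = tor -` (\<Union>e\<in>all_pairs A. path_image (c e))"

lemma L_lat: "z \<in> L A \<Longrightarrow> z + lat w \<in> L A" by (simp add: L_def)

lemma tr_L: assumes "all_pairs A \<subseteq> E" "e \<in> all_pairs A" shows "path_image (tr e w) \<subseteq> L A"
proof
  fix z assume z: "z \<in> path_image (tr e w)"
  have "e \<in> E" using assms by blast
  then have "tor z \<in> path_image (c e)" using tr_image[OF _ z] by blast
  then show "z \<in> L A" using assms(2) unfolding L_def by auto
qed

lemma pc_shift: assumes "path_component (L A) x y" shows "path_component (L A) (x + lat w) (y + lat w)"
proof -
  obtain g where g: "path g" "path_image g \<subseteq> L A" "pathstart g = x" "pathfinish g = y"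
    using assms unfolding path_component_def by blast
  have "path (\<lambda>t. g t + lat w)" using g(1) unfolding path_def by (intro continuous_intros)
  moreover have "path_image (\<lambda>t. g t + lat w) \<subseteq> L A" using g(2) L_lat unfolding path_image_def by blast
  ultimately show ?thesis unfolding path_component_def using g(3,4)
    by (intro exI[of _ "\<lambda>t. g t + lat w"]) (auto simp: pathstart_def pathfinish_def)
qed

lemma tr_connected: assumes "all_pairs A \<subseteq> E" "e \<in> all_pairs A" "x \<in> path_image (tr e w)" "y \<in> path_image (tr e w)"
  shows "path_component (L A) x y"
proof -
  have "e \<in> E" using assms by blast
  then have "path_connected (path_image (tr e w))" using tr_arc by (intro path_connected_path_image arc_imp_path)
  then have "path_component (path_image (tr e w)) x y" using assms by (simp add: path_connected_component)
  then show ?thesis using tr_L[OF assms(1,2)] by (rule path_component_of_subset[rotated])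
qed

text \<open>The displacements obtained when closed paths at \<open>p a\<close> within the drawing of
  the complete graph on \<open>A\<close> are lifted from \<open>b a\<close>.\<close>

definition "periods A a = {w. path_component (L A) (b a) (b a + lat w)}"

text \<open>If all periods of the lift of a complete graph lie in \<open>\<int>w\<^sub>0\<close>, then \<open>exp (2 \<pi> i z / w\<^sub>0)\<close> maps a component of that
  lift to a drawing of the graph in the plane.\<close>

lemma K5_periods:
  assumes A: "A \<subseteq> V" "card A = 5" "all_pairs A \<subseteq> E" "a \<in> A" and w0: "w0 \<noteq> 0"
    and per: "\<And>w. w \<in> periods A a \<Longrightarrow> \<exists>k. lat w = of_int k * lat w0"
  shows False
proof -
  define K where "K = {z. path_component (L A) (b a) z}"
  have KI: "y \<in> K" if "x \<in> K" "path_component (L A) x y" for x y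
    using that unfolding K_def by (auto intro: path_component_trans)
  have finA: "finite A" using A finV finite_subset by blast
  have lift: "\<exists>z\<in>K. tor z = p v" if v: "v \<in> A" for v
  proof (cases "v = a")
    case True
    obtain u where u: "u \<in> A" "u \<noteq> a"
    proof -
      have "A \<noteq> {a}" using A(2) by auto
      then show ?thesis using that A(4) by blast
    qed
    have e: "{a, u} \<in> all_pairs A" using u A(4) unfolding all_pairs_def by blast
    then have "p a \<in> path_image (c {a, u})" using c_V[of "{a, u}"] A(3) by blast
    moreover have "tor (b a) = p a" using b_tor A by blast
    ultimately have "b a \<in> L A" using e unfolding L_def by (metis UN_I vimageI)
    then have "b a \<in> K" unfolding K_def by (simp add: path_component_refl)
    then show ?thesis using True b_tor A by auto
  next
    case False
    define e where "e = {a, v}"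
    have "e \<in> all_pairs A" unfolding all_pairs_def e_def
      using False v A(4) by (intro CollectI exI[of _ a] exI[of _ v]) auto
    then have e: "e \<in> all_pairs A" "e \<in> E" using A(3) by auto
    have "{tor (l e 0), tor (l e 1)} = {p a, p v}" using tor_ends[OF e(2), of 0] unfolding tr_ends e_def by simp
    then obtain s t where st: "s \<in> {0, 1}" "t \<in> {0, 1}" "tor (l e s) = p a" "tor (l e t) = p v"
      by (auto simp: doubleton_eq_iff)
    then have "tor (b a) = tor (l e s)" using b_tor A by auto
    then obtain w where w: "b a = l e s + lat w" unfolding tor_eq_iff by blast
    have "tr e w s \<in> path_image (tr e w)" "tr e w t \<in> path_image (tr e w)" using st unfolding path_image_def by auto
    then have "path_component (L A) (tr e w s) (tr e w t)" using tr_connected A(3) e(1) by blast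
    then have "tr e w t \<in> K" unfolding K_def tr_def w by simp
    moreover have "tor (tr e w t) = p v" using st unfolding tr_def by simp
    ultimately show ?thesis by blast
  qed
  have "\<exists>w. path_image (tr e w) \<subseteq> K" if e: "e \<in> all_pairs A" for e
  proof -
    have eE: "e \<in> E" using e A by blast
    have "tor (l e 0) \<in> p ` e" using tor_ends[OF eE, of 0] unfolding tr_ends by auto
    moreover have "e \<subseteq> A" using e unfolding all_pairs_def by auto
    ultimately obtain v where v: "v \<in> A" "tor (l e 0) = p v" by auto
    obtain z where z: "z \<in> K" "tor z = p v" using lift[OF v(1)] by blast
    then have "tor z = tor (l e 0)" using v by simp
    then obtain w where w: "z = l e 0 + lat w" unfolding tor_eq_iff by blast
    have "z \<in> path_image (tr e w)" unfolding w path_image_def tr_def by auto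
    then have "path_image (tr e w) \<subseteq> K" using tr_connected[OF A(3) e] KI[OF z(1)] by blast
    then show ?thesis by blast
  qed
  then obtain w where w: "\<And>e. e \<in> all_pairs A \<Longrightarrow> path_image (tr e (w e)) \<subseteq> K" by metis
  have lw0: "lat w0 \<noteq> 0" using w0 lat_inject[of w0 0] by simp
  \<comment> \<open>The quotient map of the plane by the multiples of \<open>lat w0\<close>: a
    cylinder, realized as the plane without 0.\<close>
  define Ph where "Ph z = exp (2 * pi * \<i> * z / lat w0)" for z
  have Ph_eq: "Ph z = Ph z' \<longleftrightarrow> (\<exists>k::int. z = z' + of_int k * lat w0)" for z z'
  proof -
    have "Ph z = Ph z' \<longleftrightarrow> (\<exists>k::int. 2 * pi * \<i> * z / lat w0 = 2 * pi * \<i> * z' / lat w0 + (of_int (2 * k) * pi) * \<i>)"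
      unfolding Ph_def by (rule exp_eq)
    also have "\<dots> \<longleftrightarrow> (\<exists>k::int. z = z' + of_int k * lat w0)"
    proof (rule ex_cong1)
      fix k :: int
      have "2 * pi * \<i> * z / lat w0 = 2 * pi * \<i> * z' / lat w0 + (of_int (2 * k) * pi) * \<i> \<longleftrightarrow>
        (2 * pi * \<i>) * z = (2 * pi * \<i>) * (z' + of_int k * lat w0)"
        using lw0 by (simp add: field_simps)
      also have "\<dots> \<longleftrightarrow> z = z' + of_int k * lat w0" by simp
      finally show "2 * pi * \<i> * z / lat w0 = 2 * pi * \<i> * z' / lat w0 + (of_int (2 * k) * pi) * \<i> \<longleftrightarrow> z = z' + of_int k * lat w0" .
    qed
    finally show ?thesis .
  qed
  \<comment> \<open>The translations divided out by \<open>Ph\<close> are lattice translations, so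
    points with different images under \<open>tor\<close> keep different images. Injectivity and
    disjointness thus carry over from the torus.\<close>
  have Ph_tor: "tor z = tor z'" if Pz: "Ph z = Ph z'" for z z'
  proof -
    obtain k :: int where "z = z' + of_int k * lat w0" using Pz unfolding Ph_eq by blast
    moreover have "of_int k * lat w0 = lat (k * fst w0, k * snd w0)" by (simp add: lat_def complex_eq_iff)
    ultimately show ?thesis by simp
  qed
  \<comment> \<open>On the component \<open>K\<close>, conversely, two points over the same torus
    point differ by a period, so \<open>Ph\<close> identifies them. Here the assumption on periods
    enters; it leaves one image for each vertex.\<close>
  have Ph_K: "Ph z = Ph z'" if zz: "z \<in> K" "z' \<in> K" "tor z = tor z'" for z z'
  proof -
    obtain m where m: "z = z' + lat m" using zz(3) tor_eq_iff by blast
    have "path_component (L A) (b a + lat m) z" using pc_shift[of A "b a" z' m] zz(2) unfolding K_def m by simp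
    then have "path_component (L A) (b a) (b a + lat m)"
      using zz(1) path_component_trans path_component_sym unfolding K_def by blast
    then have "m \<in> periods A a" unfolding periods_def by simp
    then show ?thesis using per m Ph_eq by metis
  qed
  have cont: "continuous_on S Ph" for S unfolding Ph_def using lw0 by (intro continuous_intros) auto
  define C where "C e = Ph \<circ> tr e (w e)" for e
  define P where "P = Ph ` {z \<in> K. tor z \<in> p ` A}"
  define q where "q v = Ph (SOME z. z \<in> K \<and> tor z = p v)" for v
  have "P \<subseteq> q ` A"
  proof
    fix y assume "y \<in> P"
    then obtain z v where z: "y = Ph z" "z \<in> K" "v \<in> A" "tor z = p v" unfolding P_def by auto
    have "(SOME z. z \<in> K \<and> tor z = p v) \<in> K \<and> tor (SOME z. z \<in> K \<and> tor z = p v) = p v"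
      using z by (intro someI[of "\<lambda>z. z \<in> K \<and> tor z = p v" z]) auto
    then have "y = q v" unfolding q_def z(1) using z by (intro Ph_K) auto
    then show "y \<in> q ` A" using z by auto
  qed
  then have finP: "finite P" and cP: "card P \<le> 5"
    using finA A(2) by (auto intro: finite_subset) (metis card_image_le card_mono finite_imageI order_trans)
  have imC: "path_image (C e) = Ph ` path_image (tr e (w e))" for e
    unfolding C_def path_image_def by (simp add: image_comp)
  have endC: "pathstart (C e) = Ph (pathstart (tr e (w e)))" "pathfinish (C e) = Ph (pathfinish (tr e (w e)))" for e
    unfolding C_def pathstart_def pathfinish_def by simp_all
  have eA: "e \<in> E" "e \<subseteq> A" if "e \<in> all_pairs A" for e using that A(3) unfolding all_pairs_def by auto
  have endP: "pathstart (C e) \<in> P" "pathfinish (C e) \<in> P" if e: "e \<in> all_pairs A" for e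
    using w[OF e] tor_ends[OF eA(1)[OF e], of "w e"] eA(2)[OF e] pathstart_in_path_image[of "tr e (w e)"]
      pathfinish_in_path_image[of "tr e (w e)"] unfolding P_def endC by blast+
  have vtx: "y \<in> {pathstart (C e), pathfinish (C e)}" if e: "e \<in> all_pairs A" and z: "z \<in> path_image (tr e (w e))" "tor z \<in> p ` V" "y = Ph z" for e y z
    using tr_vertex[OF eA(1)[OF e] z(1,2)] unfolding endC z(3) by auto
  have card_edges: "card (all_pairs A) = 10 \<and> finite (all_pairs A)"
  proof -
    have "all_pairs A = {e. e \<subseteq> A \<and> card e = 2}" unfolding all_pairs_def by (auto simp: card_2_iff)
    moreover have "card {e. e \<subseteq> A \<and> card e = 2} = 5 choose 2" using n_subsets[OF finA, of 2] A(2) by simp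
    moreover have "(5::nat) choose 2 = 10" by (simp add: choose_two)
    moreover have "finite {e. e \<subseteq> A \<and> card e = 2}" using finA by auto
    ultimately show ?thesis by simp
  qed
  have "card (all_pairs A) + 6 \<le> 3 * card P"
  proof (rule planar_edge_bound[where c = C])
    fix e assume e: "e \<in> all_pairs A"
    note eE = eA(1)[OF e]
    have inj: "inj_on (C e) {0..1}"
    proof (rule inj_onI)
      fix s t :: real assume st: "s \<in> {0..1}" "t \<in> {0..1}" "C e s = C e t"
      then have "tor (tr e (w e) s) = tor (tr e (w e) t)" unfolding C_def by (intro Ph_tor) simp
      then show "s = t" using tor_tr[OF eE] st c_inj[OF eE] by simp
    qed
    moreover have "path (C e)" unfolding C_def using tr_arc[OF eE] cont
      by (intro path_continuous_image arc_imp_path) auto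
    ultimately show "arc (C e)" by (simp add: arc_def)
    show "pathstart (C e) \<in> P" "pathfinish (C e) \<in> P" using endP[OF e] by auto
    show "path_image (C e) \<inter> P \<subseteq> {pathstart (C e), pathfinish (C e)}"
    proof
      fix y assume "y \<in> path_image (C e) \<inter> P"
      then obtain z z' where z: "z \<in> path_image (tr e (w e))" "y = Ph z" "y = Ph z'" "tor z' \<in> p ` A"
        unfolding imC P_def by auto
      then have "tor z \<in> p ` V" using Ph_tor[of z z'] A(1) by auto
      then show "y \<in> {pathstart (C e), pathfinish (C e)}" using vtx[OF e z(1) _ z(2)] by blast
    qed
    fix f assume f: "f \<in> all_pairs A" "e \<noteq> f"
    note fE = eA(1)[OF f(1)]
    show "path_image (C e) \<inter> path_image (C f) \<subseteq> P"
    proof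
      fix y assume "y \<in> path_image (C e) \<inter> path_image (C f)"
      then obtain z z' where z: "z \<in> path_image (tr e (w e))" "y = Ph z" "z' \<in> path_image (tr f (w f))" "y = Ph z'"
        unfolding imC by auto
      have "tor z = tor z'" using z by (intro Ph_tor) simp
      moreover have "tor z \<in> path_image (c e)" "tor z' \<in> path_image (c f)"
        using tr_image[OF eE z(1)] tr_image[OF fE z(3)] by blast+
      ultimately have "tor z \<in> p ` V" using cc[OF eE fE f(2)] E_sub[OF eE] by auto
      then have "y \<in> {pathstart (C e), pathfinish (C e)}" using vtx[OF e z(1) _ z(2)] by blast
      then show "y \<in> P" using endP[OF e] by auto
    qed
    show "{pathstart (C e), pathfinish (C e)} \<noteq> {pathstart (C f), pathfinish (C f)}"
    proof
      assume eq: "{pathstart (C e), pathfinish (C e)} = {pathstart (C f), pathfinish (C f)}"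
      have "{tor (pathstart (tr e (w e))), tor (pathfinish (tr e (w e)))} = {tor (pathstart (tr f (w f))), tor (pathfinish (tr f (w f)))}"
        using eq Ph_tor unfolding endC doubleton_eq_iff by metis
      then have "p ` e = p ` f" using tor_ends[OF eE, of "w e"] tor_ends[OF fE, of "w f"] by simp
      then show False using edge_eq[OF eE fE] f(2) by blast
    qed
  qed (use finP card_edges in auto)
  \<comment> \<open>The complete graph on five vertices has 10 edges, and
    \<open>10 + 6 > 3 * 5\<close>.\<close>
  then show False using card_edges cP by simp
qed

end

text \<open>A nonzero element divided by the gcd of its entries is a primitive vector, and by Bezout
  an integer vector parallel to a primitive one is an integer multiple of it.\<close>

lemma parallel_multiples:
  assumes "\<forall>v\<in>H. \<forall>w\<in>H. det2 v w = 0"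
  shows "\<exists>w0. w0 \<noteq> 0 \<and> (\<forall>w\<in>H. \<exists>k. lat w = of_int k * lat w0)"
proof (cases "H \<subseteq> {0}")
  case True
  show ?thesis
  proof (intro exI[of _ "(1, 0)"] conjI ballI)
    show "(1, 0) \<noteq> (0 :: int \<times> int)" by (simp add: zero_prod_def)
    fix w assume "w \<in> H"
    then have "w = 0" using True by blast
    then show "\<exists>k. lat w = of_int k * lat (1, 0)" by (intro exI[of _ 0]) simp
  qed
next
  case False
  then obtain x y where xy: "(x, y) \<in> H" "(x, y) \<noteq> 0" by auto
  define g where "g = gcd x y"
  have g: "g \<noteq> 0" using xy(2) unfolding g_def by (auto simp: zero_prod_def)
  define x' where "x' = x div g"
  define y' where "y' = y div g"
  have x: "x = g * x'" and y: "y = g * y'" unfolding x'_def y'_def g_def by auto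
  obtain s t where st: "s * x + t * y = g" unfolding g_def using bezout_int by blast
  then have "g * (s * x' + t * y') = g * 1" unfolding x y by (simp add: algebra_simps)
  then have st': "s * x' + t * y' = 1" using g by simp
  show ?thesis
  proof (intro exI[of _ "(x', y')"] conjI ballI)
    show "(x', y') \<noteq> 0" using st' by (auto simp: zero_prod_def)
    fix w assume "w \<in> H"
    then have "det2 (x, y) w = 0" using assms xy by blast
    then have "g * (x' * snd w) = g * (y' * fst w)" unfolding det2_def x y by (simp add: algebra_simps)
    then have e: "x' * snd w = y' * fst w" using g by simp
    \<comment> \<open>If \<open>w\<close> is a multiple of \<open>(x', y')\<close>, pairing it with
      the Bezout coefficients returns the factor, because
      \<open>s * x' + t * y' = 1\<close>.\<close>
    define k where "k = s * fst w + t * snd w"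
    have "k * x' = s * fst w * x' + t * (x' * snd w)" unfolding k_def by (simp add: algebra_simps)
    also have "\<dots> = fst w * (s * x' + t * y')" unfolding e by (simp add: algebra_simps)
    finally have 1: "fst w = k * x'" using st' by simp
    have "k * y' = s * (y' * fst w) + t * snd w * y'" unfolding k_def by (simp add: algebra_simps)
    also have "\<dots> = snd w * (s * x' + t * y')" unfolding e[symmetric] by (simp add: algebra_simps)
    finally have 2: "snd w = k * y'" using st' by simp
    show "\<exists>k. lat w = of_int k * lat (x', y')"
      by (intro exI[of _ k]) (simp add: lat_def complex_eq_iff 1 2)
  qed
qed

context torus_drawing
begin

text \<open>Periods of disjoint subgraphs are parallel, so one of the two groups of periods has rank at most 1.\<close>

lemma two_K5:
  assumes A: "A \<subseteq> V" "card A = 5" "all_pairs A \<subseteq> E" and B: "B \<subseteq> V" "card B = 5" "all_pairs B \<subseteq> E"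
    and AB: "A \<inter> B = {}"
  shows False
proof -
  obtain a where a: "a \<in> A" using A(2) by fastforce
  obtain d where d: "d \<in> B" using B(2) by fastforce
  have disj: "L A \<inter> L B = {}"
  proof (rule ccontr)
    assume "L A \<inter> L B \<noteq> {}"
    then obtain z where "z \<in> L A" "z \<in> L B" by blast
    then obtain e f where z: "e \<in> all_pairs A" "f \<in> all_pairs B" "tor z \<in> path_image (c e) \<inter> path_image (c f)"
      unfolding L_def vimage_def by blast
    have "e \<inter> f = {}" "e \<noteq> {}" using z(1,2) AB unfolding all_pairs_def by auto
    then show False using cc[of e f] z A(3) B(3) by auto
  qed
  have det: "det2 m m' = 0" if "m \<in> periods A a" "m' \<in> periods B d" for m m'
    using crossing_periods[OF L_lat L_lat disj] that unfolding periods_def by blast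
  show False
  proof (cases "\<forall>v\<in>periods A a. \<forall>w\<in>periods A a. det2 v w = 0")
    case True
    from parallel_multiples[OF True] show False
    proof (elim exE conjE)
      fix w0 assume w0: "w0 \<noteq> 0" "\<forall>w\<in>periods A a. \<exists>k. lat w = of_int k * lat w0"
      show False by (rule K5_periods[OF A a w0(1) bspec[OF w0(2)]])
    qed
  next
    case False
    then obtain m1 m2 where m: "m1 \<in> periods A a" "m2 \<in> periods A a" "det2 m1 m2 \<noteq> 0" by blast
    \<comment> \<open>Every period of \<open>B\<close> is parallel to two independent vectors, hence
      zero.\<close>
    have zero: "w = 0" if "w \<in> periods B d" for w
    proof -
      have "det2 m1 w = 0" "det2 m2 w = 0" using det m that by auto
      then have e: "fst m1 * snd w = snd m1 * fst w" "fst m2 * snd w = snd m2 * fst w" unfolding det2_def by auto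
      have "det2 m1 m2 * fst w = fst m1 * (snd m2 * fst w) - fst m2 * (snd m1 * fst w)"
        unfolding det2_def by (simp add: algebra_simps)
      also have "\<dots> = 0" unfolding e[symmetric] by simp
      finally have "det2 m1 m2 * fst w = 0" .
      moreover have "det2 m1 m2 * snd w = snd m2 * (fst m1 * snd w) - snd m1 * (fst m2 * snd w)"
        unfolding det2_def by (simp add: algebra_simps)
      then have "det2 m1 m2 * snd w = 0" unfolding e by simp
      ultimately have "fst w = 0" "snd w = 0" using m(3) by simp_all
      then show ?thesis by (simp add: prod_eq_iff)
    qed
    have "det2 v w = 0" if "v \<in> periods B d" "w \<in> periods B d" for v w
      using zero[OF that(1)] zero[OF that(2)] by (simp add: det2_def)
    then have "\<forall>v\<in>periods B d. \<forall>w\<in>periods B d. det2 v w = 0" by blast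
    from parallel_multiples[OF this] show False
    proof (elim exE conjE)
      fix w0 assume w0: "w0 \<noteq> 0" "\<forall>w\<in>periods B d. \<exists>k. lat w = of_int k * lat w0"
      show False by (rule K5_periods[OF B d w0(1) bspec[OF w0(2)]])
    qed
  qed
qed

end

section \<open>Images of embeddings, subgraphs, and the sphere with one handle\<close>

lemma embeds_in_image:
  assumes emb: "embeds_in V E S" and cont: "continuous_on S f" and inj: "inj_on f S" and E: "\<And>e. e \<in> E \<Longrightarrow> e \<subseteq> V"
    and T: "f ` S \<subseteq> T"
  shows "embeds_in V E T"
proof -
  obtain p c where p: "inj_on p V" "p ` V \<subseteq> S"
    and c: "\<And>e. e \<in> E \<Longrightarrow> arc (c e) \<and> path_image (c e) \<subseteq> S \<and> {pathstart (c e), pathfinish (c e)} = p ` e \<and>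
      path_image (c e) \<inter> p ` V = p ` e"
    and cc: "\<And>e f. e \<in> E \<Longrightarrow> f \<in> E \<Longrightarrow> e \<noteq> f \<Longrightarrow> path_image (c e) \<inter> path_image (c f) = p ` (e \<inter> f)"
    using emb unfolding embeds_in_def by metis
  have im: "path_image (f \<circ> c e) = f ` path_image (c e)" for e by (simp add: path_image_def image_comp)
  show ?thesis unfolding embeds_in_def
  proof (intro exI[of _ "f \<circ> p"] exI[of _ "\<lambda>e. f \<circ> c e"] conjI ballI impI)
    show "inj_on (f \<circ> p) V" using p inj by (auto intro!: comp_inj_on inj_on_subset[OF inj])
    show "(f \<circ> p) ` V \<subseteq> T" using p T by auto
  next
    fix e assume e: "e \<in> E"
    note ce = c[OF e]
    have sub: "path_image (c e) \<subseteq> S" using ce by blast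
    have "path (f \<circ> c e)" using ce sub by (intro path_continuous_image continuous_on_subset[OF cont]) (auto simp: arc_imp_path)
    moreover have "inj_on (f \<circ> c e) {0..1}"
      using ce sub by (intro comp_inj_on inj_on_subset[OF inj]) (auto simp: arc_def path_image_def)
    ultimately show "arc (f \<circ> c e)" by (simp add: arc_def)
    show "path_image (f \<circ> c e) \<subseteq> T" unfolding im using sub T by auto
    have "{pathstart (f \<circ> c e), pathfinish (f \<circ> c e)} = f ` {pathstart (c e), pathfinish (c e)}"
      by (simp add: pathstart_def pathfinish_def)
    then show "{pathstart (f \<circ> c e), pathfinish (f \<circ> c e)} = (f \<circ> p) ` e" using ce by (simp add: image_comp)
    have "f ` path_image (c e) \<inter> f ` (p ` V) = f ` (path_image (c e) \<inter> p ` V)"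
      using sub p by (intro inj_on_image_Int[OF inj, symmetric])
    then show "path_image (f \<circ> c e) \<inter> (f \<circ> p) ` V = (f \<circ> p) ` e" unfolding im using ce by (simp add: image_comp)
  next
    fix e e' assume e: "e \<in> E" "e' \<in> E" "e \<noteq> e'"
    have "f ` path_image (c e) \<inter> f ` path_image (c e') = f ` (path_image (c e) \<inter> path_image (c e'))"
      using c[OF e(1)] c[OF e(2)] by (intro inj_on_image_Int[OF inj, symmetric]) auto
    then show "path_image (f \<circ> c e) \<inter> path_image (f \<circ> c e') = (f \<circ> p) ` (e \<inter> e')"
      unfolding im using cc[OF e] by (simp add: image_comp)
  qed
qed

lemma embeds_in_subgraph:
  fixes S :: "'b::topological_space set"
  assumes emb: "embeds_in V E S" and "V' \<subseteq> V" "E' \<subseteq> E" and E': "\<And>e. e \<in> E' \<Longrightarrow> e \<subseteq> V'"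
  shows "embeds_in V' E' S"
proof -
  obtain p c where p: "inj_on p V" "p ` V \<subseteq> S"
    and c: "\<And>e. e \<in> E \<Longrightarrow> arc (c e) \<and> path_image (c e) \<subseteq> S \<and> {pathstart (c e), pathfinish (c e)} = p ` e \<and>
      path_image (c e) \<inter> p ` V = p ` e"
    and cc: "\<And>e f. e \<in> E \<Longrightarrow> f \<in> E \<Longrightarrow> e \<noteq> f \<Longrightarrow> path_image (c e) \<inter> path_image (c f) = p ` (e \<inter> f)"
    using emb unfolding embeds_in_def by metis
  have sub: "T \<inter> B = C" if "T \<inter> A = C" "C \<subseteq> B" "B \<subseteq> A" for T A B C :: "'b set" using that by blast
  show ?thesis unfolding embeds_in_def
  proof (intro exI[of _ p] exI[of _ c] conjI ballI impI)
    show "inj_on p V'" "p ` V' \<subseteq> S" using p assms(2) by (auto intro: inj_on_subset)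
    fix e assume e: "e \<in> E'"
    then have eE: "e \<in> E" using assms(3) by auto
    show "arc (c e)" "path_image (c e) \<subseteq> S" "{pathstart (c e), pathfinish (c e)} = p ` e" using c[OF eE] by auto
    have "path_image (c e) \<inter> p ` V = p ` e" using c[OF eE] by (elim conjE)
    moreover have "p ` e \<subseteq> p ` V'" "p ` V' \<subseteq> p ` V" using E'[OF e] assms(2) by (simp_all only: image_mono)
    ultimately show "path_image (c e) \<inter> p ` V' = p ` e" by (rule sub)
    fix f assume f: "f \<in> E'" "e \<noteq> f"
    show "path_image (c e) \<inter> path_image (c f) = p ` (e \<inter> f)"
      by (rule cc[OF eE subsetD[OF assms(3) f(1)] f(2)])
  qed
qed

lemma torus_drawingE:
  assumes emb: "embeds_in V E (range tor)" and fin: "finite V" and E: "E \<subseteq> all_pairs V"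
  obtains p c l b where "torus_drawing V E p c l b"
proof -
  obtain p c where p: "inj_on p V" "p ` V \<subseteq> range tor"
    and c: "\<And>e. e \<in> E \<Longrightarrow> arc (c e) \<and> path_image (c e) \<subseteq> range tor \<and> {pathstart (c e), pathfinish (c e)} = p ` e \<and>
      path_image (c e) \<inter> p ` V = p ` e"
    and cc: "\<And>e f. e \<in> E \<Longrightarrow> f \<in> E \<Longrightarrow> e \<noteq> f \<Longrightarrow> path_image (c e) \<inter> path_image (c f) = p ` (e \<inter> f)"
    using emb unfolding embeds_in_def by metis
  have "\<exists>l. path l \<and> (\<forall>t\<in>{0..1}. tor (l t) = c e t)" if e: "e \<in> E" for e
  proof -
    have ce: "path (c e)" "path_image (c e) \<subseteq> range tor" using c[OF e] arc_imp_path by auto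
    obtain l where "path l" "\<And>t. t \<in> {0..1} \<Longrightarrow> tor (l t) = c e t" using torus_lift[OF ce] by blast
    then show ?thesis by blast
  qed
  then obtain l where l: "\<And>e. e \<in> E \<Longrightarrow> path (l e) \<and> (\<forall>t\<in>{0..1}. tor (l e t) = c e t)" by metis
  have "\<forall>v\<in>V. \<exists>z. tor z = p v" using p(2) by (metis imageE image_subset_iff)
  then obtain b where b: "\<And>v. v \<in> V \<Longrightarrow> tor (b v) = p v" by metis
  have "torus_drawing V E p c l b"
  proof (rule torus_drawing.intro)
    show "\<exists>u v. e = {u, v} \<and> u \<noteq> v \<and> u \<in> V \<and> v \<in> V" if "e \<in> E" for e
      using that E unfolding all_pairs_def by auto
    show "path (l e)" if "e \<in> E" for e using l[OF that] by blast
    show "tor (l e t) = c e t" if "e \<in> E" "t \<in> {0..1}" for e t using l[OF that(1)] that(2) by blast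
    show "arc (c e)" "{pathstart (c e), pathfinish (c e)} = p ` e" "path_image (c e) \<inter> p ` V = p ` e" if "e \<in> E" for e
      using c[OF that] by blast+
  qed (fact fin p(1) cc b)+
  then show ?thesis using that by blast
qed

text \<open>The surface is a surface of revolution whose profile bounds a region that is star-shaped about the point
  at distance 2 from the axis and height 0.\<close>

definition torus_coords :: "complex \<times> real \<Rightarrow> complex \<times> complex" where
  "torus_coords q = (sgn (fst q), sgn (Complex (cmod (fst q) - 2) (snd q)))"

text \<open>The radius is \<open>3 * 1 + 1 = 4\<close> and the only tube stands on the vertical
  axis, so just the distance from the axis and the height matter: the profile is an arc of a circle
  of radius 4 closed by a vertical chord at distance 1.\<close>

lemma sphere_with_one_handle:
  "sphere_with_handles 1 = {q. (cmod (fst q))\<^sup>2 + (snd q)\<^sup>2 = 16 \<and> cmod (fst q) \<ge> 1} \<union>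
    {q. (cmod (fst q))\<^sup>2 + (snd q)\<^sup>2 \<le> 16 \<and> cmod (fst q) = 1}"
proof -
  have n: "norm q = sqrt ((cmod (fst q))\<^sup>2 + (snd q)\<^sup>2)" for q :: "complex \<times> real"
    by (simp add: norm_prod_def)
  have eq: "norm q = 4 \<longleftrightarrow> (cmod (fst q))\<^sup>2 + (snd q)\<^sup>2 = 16" for q :: "complex \<times> real"
  proof -
    have "sqrt 16 = (4::real)" using real_sqrt_abs[of 4] by simp
    then show ?thesis unfolding n by (metis real_sqrt_eq_iff)
  qed
  have le: "norm q \<le> 4 \<longleftrightarrow> (cmod (fst q))\<^sup>2 + (snd q)\<^sup>2 \<le> 16" for q :: "complex \<times> real"
  proof -
    have "sqrt 16 = (4::real)" using real_sqrt_abs[of 4] by simp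
    then show ?thesis unfolding n by (metis real_sqrt_le_iff)
  qed
  have "sphere_with_handles 1 = {q. norm q = 4 \<and> cmod (fst q) \<ge> 1} \<union> {q. norm q \<le> 4 \<and> cmod (fst q) = 1}"
    unfolding sphere_with_handles_def by (auto simp: dist_norm lessThan_Suc)
  then show ?thesis unfolding eq le .
qed

lemma torus_coords:
  "continuous_on (sphere_with_handles 1) torus_coords" "inj_on torus_coords (sphere_with_handles 1)"
  "torus_coords ` sphere_with_handles 1 \<subseteq> range tor"
proof -
  define S where "S = sphere_with_handles 1"
  have ne: "fst q \<noteq> 0" "Complex (cmod (fst q) - 2) (snd q) \<noteq> 0" if "q \<in> S" for q
  proof -
    show "fst q \<noteq> 0" using that unfolding S_def sphere_with_one_handle by auto
    show "Complex (cmod (fst q) - 2) (snd q) \<noteq> 0"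
      using that unfolding S_def sphere_with_one_handle by (auto simp: complex_eq_iff)
  qed
  show "continuous_on (sphere_with_handles 1) torus_coords"
    unfolding torus_coords_def Complex_eq sgn_div_norm S_def[symmetric]
    using ne by (intro continuous_intros) (auto simp: Complex_eq)
  have unit: "\<exists>t. sgn z = cis (2 * pi * t)" if "z \<noteq> 0" for z :: complex
    using cis_Arg[OF that] by (intro exI[of _ "Arg z / (2 * pi)"]) simp
  have "torus_coords q \<in> range tor" if q: "q \<in> S" for q
  proof -
    obtain s where "sgn (fst q) = cis (2 * pi * s)" using unit[OF ne(1)[OF q]] by blast
    moreover obtain t where "sgn (Complex (cmod (fst q) - 2) (snd q)) = cis (2 * pi * t)"
      using unit[OF ne(2)[OF q]] by blast
    ultimately
    have "torus_coords q = tor (Complex s t)" by (simp add: torus_coords_def tor_def)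
    then show ?thesis by blast
  qed
  then show "torus_coords ` sphere_with_handles 1 \<subseteq> range tor" unfolding S_def by blast
  \<comment> \<open>On a ray from the point (2, 0) of the profile plane, \<open>q'\<close> is
    \<open>m\<close> times as far out as \<open>q\<close>. Using the bound in both orders will give
    \<open>m = 1\<close>, hence injectivity.\<close>
  have le1: "m \<le> 1" if q: "q \<in> S" "q' \<in> S" and m: "cmod (fst q') - 2 = m * (cmod (fst q) - 2)" "snd q' = m * snd q" "m > 0"
    for q q' m
  proof (cases "cmod (fst q) = 1")
    case True
    have "cmod (fst q') \<ge> 1" using q(2) unfolding S_def sphere_with_one_handle by auto
    then show ?thesis using m(1) True by simp
  next
    case False
    define r z where "r = cmod (fst q)" and "z = snd q"
    have rz: "r\<^sup>2 + z\<^sup>2 = 16" using q(1) False unfolding S_def sphere_with_one_handle r_def z_def by auto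
    have "r\<^sup>2 \<le> 16" using rz zero_le_power2[of z] by linarith
    then have "r\<^sup>2 \<le> 4\<^sup>2" by simp
    then have r4: "r \<le> 4" by (rule power2_le_imp_le) simp
    have "(2 + m * (r - 2))\<^sup>2 + (m * z)\<^sup>2 \<le> 16"
    proof -
      have "cmod (fst q') = 2 + m * (r - 2)" using m(1) unfolding r_def by simp
      moreover have "(cmod (fst q'))\<^sup>2 + (snd q')\<^sup>2 \<le> 16" using q(2) unfolding S_def sphere_with_one_handle by auto
      ultimately show ?thesis using m(2) unfolding z_def by simp
    qed
    moreover have "(2 + m * (r - 2))\<^sup>2 + (m * z)\<^sup>2 = 4 + 4 * m * (r - 2) + m\<^sup>2 * (r\<^sup>2 + z\<^sup>2 - 4 * r + 4)"
      by (simp add: power2_eq_square algebra_simps)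
    ultimately have "4 + 4 * m * (r - 2) + m\<^sup>2 * (16 - 4 * r + 4) \<le> 16" using rz by simp
    \<comment> \<open>That \<open>q\<close> itself is on the circle makes \<open>m = 1\<close> a
      root of the condition on \<open>q'\<close>; the other factor is positive because
      \<open>r \<le> 4\<close>.\<close>
    then have "4 * ((m - 1) * (5 * m + 3 - r * m)) \<le> 0" by (simp add: power2_eq_square algebra_simps)
    moreover have "5 * m + 3 - r * m > 0"
    proof -
      have "r * m \<le> 4 * m" using r4 m(3) by (intro mult_right_mono) auto
      then show ?thesis using m(3) by linarith
    qed
    ultimately show ?thesis by (smt (verit) mult_pos_pos)
  qed
  show "inj_on torus_coords (sphere_with_handles 1)"
  proof (rule inj_onI)
    fix q q' assume "q \<in> sphere_with_handles 1" "q' \<in> sphere_with_handles 1" and eq: "torus_coords q = torus_coords q'"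
    then have q: "q \<in> S" "q' \<in> S" unfolding S_def by auto
    define u u' where "u = Complex (cmod (fst q) - 2) (snd q)" and "u' = Complex (cmod (fst q') - 2) (snd q')"
    have u: "u \<noteq> 0" "u' \<noteq> 0" "sgn u = sgn u'" "sgn (fst q) = sgn (fst q')"
      using ne[OF q(1)] ne[OF q(2)] eq unfolding u_def u'_def torus_coords_def by auto
    define m where "m = cmod u' / cmod u"
    have m0: "m > 0" using u unfolding m_def by simp
    have u'm: "u' = of_real m * u"
    proof -
      have "u' = of_real (cmod u') * sgn u'" "sgn u = u / of_real (cmod u)" using u by (simp_all add: sgn_eq)
      then show ?thesis using u(1,3) unfolding m_def by simp
    qed
    have inv: "1 / m > 0" "u = of_real (1 / m) * u'" using m0 unfolding u'm by auto
    have "m \<le> 1" using arg_cong[OF u'm, of Re] arg_cong[OF u'm, of Im] m0 unfolding u_def u'_def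
      by (intro le1[OF q]) auto
    moreover have "1 / m \<le> 1" using arg_cong[OF inv(2), of Re] arg_cong[OF inv(2), of Im] inv(1) unfolding u_def u'_def
      by (intro le1[OF q(2,1)]) auto
    ultimately have "m = 1" using m0 by (simp add: field_simps)
    then have "u = u'" using u'm by simp
    then have e: "cmod (fst q) = cmod (fst q')" "snd q = snd q'" unfolding u_def u'_def by auto
    have "fst q = of_real (cmod (fst q)) * sgn (fst q)" "fst q' = of_real (cmod (fst q')) * sgn (fst q')"
      using ne[OF q(1)] ne[OF q(2)] by (simp_all add: sgn_eq)
    then show "q = q'" using e u(4) by (metis prod_eqI)
  qed
qed

lemma embeds_in_tor:
  assumes "embeds_in V E (sphere_with_handles 1)" "E \<subseteq> all_pairs V"
  shows "embeds_in V E (range tor)"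
proof (rule embeds_in_image[OF assms(1) torus_coords(1,2)])
  show "e \<subseteq> V" if "e \<in> E" for e using that assms(2) unfolding all_pairs_def by auto
  show "torus_coords ` sphere_with_handles 1 \<subseteq> range tor" using torus_coords(3) by blast
qed

theorem toroidal_edge_bound:
  assumes "embeds_in V E (sphere_with_handles 1)" "E \<subseteq> all_pairs V" "finite V"
  shows "card E \<le> 3 * card V"
proof -
  obtain p c l b where "torus_drawing V E p c l b"
    using torus_drawingE[OF embeds_in_tor[OF assms(1,2)] assms(3,2)] by blast
  then show ?thesis by (rule torus_drawing.torus_edge_bound)
qed

theorem no_two_disjoint_K5:
  assumes "embeds_in V E (sphere_with_handles 1)" "E \<subseteq> all_pairs V" "finite V"
    and "A \<subseteq> V" "card A = 5" "all_pairs A \<subseteq> E" "B \<subseteq> V" "card B = 5" "all_pairs B \<subseteq> E" "A \<inter> B = {}"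
  shows False
proof -
  obtain p c l b where "torus_drawing V E p c l b"
    using torus_drawingE[OF embeds_in_tor[OF assms(1,2)] assms(3,2)] by blast
  then show ?thesis by (rule torus_drawing.two_K5[OF _ assms(4-10)])
qed

section \<open>Noncrossing chords and cluster graphs\<close>

text \<open>Points of a parabola are in convex position, and the chord from \<open>i\<close> to
  \<open>j\<close> is above the parabola by \<open>(x - i) * (j - x)\<close> at abscissa
  \<open>x\<close>; so comparing chords means comparing two products.\<close>

definition parab :: "nat \<Rightarrow> complex" where "parab i = Complex (real i) ((real i)\<^sup>2)"

lemma parab_segment:
  assumes "z \<in> closed_segment (parab i) (parab j)" "i \<le> j"
  shows "real i \<le> Re z" "Re z \<le> real j" "Im z = (Re z)\<^sup>2 + (Re z - i) * (j - Re z)"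
proof -
  obtain u where u: "0 \<le> u" "u \<le> 1" "z = (1 - u) *\<^sub>R parab i + u *\<^sub>R parab j"
    using assms(1) unfolding closed_segment_def by auto
  have re: "Re z = i + u * (real j - i)" and im: "Im z = (1 - u) * (real i)\<^sup>2 + u * (real j)\<^sup>2"
    unfolding u(3) parab_def by (simp_all add: algebra_simps)
  show "real i \<le> Re z" unfolding re using u assms(2) by simp
  have "u * (real j - i) \<le> 1 * (real j - i)" using u assms(2) by (intro mult_right_mono) auto
  then show "Re z \<le> real j" unfolding re by simp
  show "Im z = (Re z)\<^sup>2 + (Re z - i) * (j - Re z)" unfolding re im by (simp add: power2_eq_square algebra_simps)
qed

lemma parab_inject [simp]: "parab i = parab j \<longleftrightarrow> i = j" by (simp add: parab_def)

lemma parab_on_segment: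
  assumes "parab m \<in> closed_segment (parab i) (parab j)" "i \<le> j"
  shows "m = i \<or> m = j"
  using parab_segment(3)[OF assms] by (auto simp: parab_def)

text \<open>Without crossing, the two intervals are nested or overlap at most in an end. For nested
  intervals the outer chord is strictly above the inner one except at a common end.\<close>

lemma parab_segments_meet:
  assumes z: "z \<in> closed_segment (parab i) (parab j)" "z \<in> closed_segment (parab k) (parab l)"
    and ij: "i < j" and kl: "k < l" and ne: "(i, j) \<noteq> (k, l)"
    and nc: "\<not> (i < k \<and> k < j \<and> j < l)" "\<not> (k < i \<and> i < l \<and> l < j)"
  shows "\<exists>m. m \<in> {i, j} \<inter> {k, l} \<and> z = parab m"
proof -
  define x where "x = Re z"
  have le: "i \<le> j" "k \<le> l" using ij kl by auto
  note 1 = parab_segment[OF z(1) le(1), folded x_def] and 2 = parab_segment[OF z(2) le(2), folded x_def]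
  have eq: "(x - i) * (j - x) = (x - k) * (l - x)" using 1(3) 2(3) by simp
  have pt: "z = parab m" if "x = real m" "m = i \<or> m = j" for m
    using 1(3) that unfolding parab_def x_def by (auto simp: complex_eq_iff)
  have nest: "\<exists>m. m \<in> {i', j'} \<inter> {k', l'} \<and> x = real m"
    if h: "i' \<le> k'" "k' < l'" "l' \<le> j'" "(i', j') \<noteq> (k', l')" "real k' \<le> x" "x \<le> real l'"
      "(x - i') * (j' - x) = (x - k') * (l' - x)" for i' j' k' l' :: nat
  proof -
    have r: "real i' \<le> k'" "real k' < l'" "real l' \<le> j'" using h by auto
    consider "x = k'" | "x = l'" | "k' < x" "x < l'" using h(5,6) by linarith
    then show ?thesis
    proof cases
      case 1
      then have "x = i' \<or> x = j'" using h(7) by auto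
      then show ?thesis using 1 h by auto
    next
      case 2
      then have "x = i' \<or> x = j'" using h(7) by auto
      then show ?thesis using 2 h by auto
    next
      case 3
      have "(x - k') * (l' - x) < (x - i') * (j' - x)"
      proof (cases "i' < k'")
        case True
        then have "(x - k') * (l' - x) < (x - i') * (l' - x)" using 3 by (intro mult_strict_right_mono) auto
        also have "\<dots> \<le> (x - i') * (j' - x)" using 3 r by (intro mult_left_mono) auto
        finally show ?thesis .
      next
        case False
        then have "i' = k'" "l' < j'" using h by auto
        then show ?thesis using 3 by simp
      qed
      then show ?thesis using h(7) by simp
    qed
  qed
  consider "j \<le> k" | "l \<le> i" | "i \<le> k" "l \<le> j" | "k \<le> i" "j \<le> l" using nc ij kl by linarith
  then have "\<exists>m. m \<in> {i, j} \<inter> {k, l} \<and> x = real m"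
  proof cases
    case 1
    then have "x = real j" "j = k" using \<open>x \<le> real j\<close> \<open>real k \<le> x\<close> by linarith+
    then show ?thesis by auto
  next
    case 2
    then have "x = real i" "i = l" using \<open>real i \<le> x\<close> \<open>x \<le> real l\<close> by linarith+
    then show ?thesis by auto
  next
    case 3
    then show ?thesis using nest[of i k l j] kl ne 2(1,2) eq by auto
  next
    case 4
    then show ?thesis using nest[of k i j l] ij ne 1(1,2) eq by fastforce
  qed
  then show ?thesis using pt by blast
qed

text \<open>Central projection of the plane at height 1 to the upper half of the unit
  sphere.\<close>

definition to_sphere :: "complex \<Rightarrow> complex \<times> real" where
  "to_sphere z = (1 / sqrt (1 + (cmod z)\<^sup>2)) *\<^sub>R (z, 1)"

lemma to_sphere: "continuous_on S to_sphere" "inj_on to_sphere S" "to_sphere ` S \<subseteq> sphere 0 1"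
proof -
  have pos: "1 + (cmod z)\<^sup>2 > 0" for z by (simp add: add_pos_nonneg)
  show "continuous_on S to_sphere" unfolding to_sphere_def using pos by (intro continuous_intros) (auto simp: less_imp_neq[symmetric])
  show "inj_on to_sphere S"
  proof (rule inj_onI)
    fix z w assume eq: "to_sphere z = to_sphere w"
    then have s: "1 / sqrt (1 + (cmod z)\<^sup>2) = 1 / sqrt (1 + (cmod w)\<^sup>2)"
      and f: "(1 / sqrt (1 + (cmod z)\<^sup>2)) *\<^sub>R z = (1 / sqrt (1 + (cmod w)\<^sup>2)) *\<^sub>R w"
      unfolding to_sphere_def by auto
    have "1 / sqrt (1 + (cmod w)\<^sup>2) \<noteq> 0" using pos[of w] by simp
    then show "z = w" using f unfolding s by simp
  qed
  have "norm (to_sphere z) = 1" for z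
  proof -
    have "norm (z, 1::real) = sqrt (1 + (cmod z)\<^sup>2)" by (simp add: norm_prod_def add.commute)
    then show ?thesis using pos[of z] unfolding to_sphere_def norm_scaleR by simp
  qed
  then show "to_sphere ` S \<subseteq> sphere 0 1" by auto
qed

lemma noncrossing_embeds_in_sphere:
  fixes f :: "'a \<Rightarrow> nat"
  assumes f: "inj_on f V" and E: "E \<subseteq> all_pairs V"
    and nc: "\<And>u v u' v'. {u, v} \<in> E \<Longrightarrow> {u', v'} \<in> E \<Longrightarrow> \<not> (f u < f u' \<and> f u' < f v \<and> f v < f v')"
  shows "embeds_in V E (sphere_with_handles 0)"
proof -
  have eV: "e \<subseteq> V" if "e \<in> E" for e using that E unfolding all_pairs_def by auto
  have ends: "\<exists>u v. e = {u, v} \<and> f u < f v \<and> u \<in> V \<and> v \<in> V" if e: "e \<in> E" for e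
  proof -
    obtain u v where uv: "e = {u, v}" "u \<noteq> v" "u \<in> V" "v \<in> V" using e E unfolding all_pairs_def by blast
    then have "f u \<noteq> f v" using f by (auto dest: inj_onD)
    then show ?thesis using uv by (metis insert_commute linorder_neqE_nat)
  qed
  then obtain a b where ab: "\<And>e. e \<in> E \<Longrightarrow> e = {a e, b e} \<and> f (a e) < f (b e) \<and> a e \<in> V \<and> b e \<in> V" by metis
  define p where "p v = parab (f v)" for v
  define c where "c e = linepath (p (a e)) (p (b e))" for e
  have "embeds_in V E (UNIV :: complex set)" unfolding embeds_in_def
  proof (intro exI[of _ p] exI[of _ c] conjI ballI impI)
    show "inj_on p V" using f unfolding p_def inj_on_def by simp
    fix e assume e: "e \<in> E"
    note abe = ab[OF e]
    show "arc (c e)" unfolding c_def p_def using abe by (intro arc_linepath) simp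
    have "p ` e = p ` {a e, b e}" using abe by simp
    then show ends_e: "{pathstart (c e), pathfinish (c e)} = p ` e" unfolding c_def by simp
    have im: "path_image (c e) = closed_segment (parab (f (a e))) (parab (f (b e)))" unfolding c_def p_def by simp
    show "path_image (c e) \<inter> p ` V = p ` e"
    proof
      show "p ` e \<subseteq> path_image (c e) \<inter> p ` V"
      proof -
        have "p ` e \<subseteq> path_image (c e)" using ends_e by (metis insert_subset empty_subsetI pathfinish_in_path_image pathstart_in_path_image)
        moreover have "e \<subseteq> V" using eV e by blast
        ultimately show ?thesis by blast
      qed
      show "path_image (c e) \<inter> p ` V \<subseteq> p ` e"
      proof
        fix z assume "z \<in> path_image (c e) \<inter> p ` V"
        then obtain v where v: "z = parab (f v)" "v \<in> V" "parab (f v) \<in> closed_segment (parab (f (a e))) (parab (f (b e)))"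
          unfolding im p_def by auto
        then have "f v = f (a e) \<or> f v = f (b e)" using parab_on_segment abe less_imp_le by metis
        then have "v = a e \<or> v = b e" using f v(2) abe by (auto dest: inj_onD)
        then have "v \<in> {a e, b e}" by simp
        then show "z \<in> p ` e" using abe v(1) unfolding p_def by auto
      qed
    qed
    fix e' assume e': "e' \<in> E" "e \<noteq> e'"
    note abe' = ab[OF e'(1)]
    have im': "path_image (c e') = closed_segment (parab (f (a e'))) (parab (f (b e')))" unfolding c_def p_def by simp
    have inE: "{a e, b e} \<in> E" "{a e', b e'} \<in> E" using abe abe' e e' by auto
    show "path_image (c e) \<inter> path_image (c e') = p ` (e \<inter> e')"
    proof
      have "p v \<in> path_image (c d)" if "v \<in> d" "d \<in> E" for v d
      proof -
        have "v = a d \<or> v = b d" using ab[OF that(2)] that(1) by auto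
        then show ?thesis unfolding c_def by auto
      qed
      then show "p ` (e \<inter> e') \<subseteq> path_image (c e) \<inter> path_image (c e')" using e e' by blast
      show "path_image (c e) \<inter> path_image (c e') \<subseteq> p ` (e \<inter> e')"
      proof
        fix z assume "z \<in> path_image (c e) \<inter> path_image (c e')"
        then have z: "z \<in> closed_segment (parab (f (a e))) (parab (f (b e)))" "z \<in> closed_segment (parab (f (a e'))) (parab (f (b e')))"
          unfolding im im' by auto
        have "(f (a e), f (b e)) \<noteq> (f (a e'), f (b e'))"
        proof
          assume "(f (a e), f (b e)) = (f (a e'), f (b e'))"
          then have "a e = a e'" "b e = b e'" using f abe abe' by (auto dest: inj_onD)
          then show False using abe abe' e' by metis
        qed
        then obtain m where m: "m \<in> {f (a e), f (b e)} \<inter> {f (a e'), f (b e')}" "z = parab m"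
          using parab_segments_meet[OF z _ _ _ nc[OF inE] nc[OF inE(2,1)]] abe abe' by blast
        have "f ` {a d, b d} = f ` d" if "d \<in> E" for d using ab[OF that] by simp
        then have "{f (a e), f (b e)} = f ` e" "{f (a e'), f (b e')} = f ` e'" using e e' by auto
        then obtain v v' where v: "v \<in> e" "m = f v" "v' \<in> e'" "m = f v'" using m(1) by auto
        have "e \<subseteq> V" "e' \<subseteq> V" using eV e e' by auto
        then have "v = v'" using f v by (auto dest: inj_onD)
        then show "z \<in> p ` (e \<inter> e')" using v m(2) unfolding p_def by auto
      qed
    qed
  qed auto
  then have "embeds_in V E (sphere (0 :: complex \<times> real) 1)"
  proof (rule embeds_in_image)
    show "e \<subseteq> V" if "e \<in> E" for e using that E unfolding all_pairs_def by auto
  qed (rule to_sphere)+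
  then show ?thesis by (simp add: sphere_with_handles_0)
qed

lemma noncrossing_list_embeds_in_sphere:
  assumes vs: "distinct vs" "set vs = V" and E: "E \<subseteq> all_pairs V"
    and sub: "\<And>i j. i < j \<Longrightarrow> j < length vs \<Longrightarrow> {vs ! i, vs ! j} \<in> E \<Longrightarrow> (i, j) \<in> F"
    and nc: "\<And>i j k l. (i, j) \<in> F \<Longrightarrow> (k, l) \<in> F \<Longrightarrow> \<not> (i < k \<and> k < j \<and> j < l)"
  shows "embeds_in V E (sphere_with_handles 0)"
proof -
  have bij: "bij_betw ((!) vs) {..<length vs} V" using bij_betw_nth[OF vs(1) refl] vs(2) by simp
  define f where "f = inv_into {..<length vs} ((!) vs)"
  have f: "f v < length vs" "vs ! f v = v" if "v \<in> V" for v
    using that bij unfolding f_def bij_betw_def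
    by (metis inv_into_into lessThan_iff, metis f_inv_into_f)
  show ?thesis
  proof (rule noncrossing_embeds_in_sphere[OF _ E, of f])
    show "inj_on f V" using f by (intro inj_onI) metis
    fix u v u' v' assume e: "{u, v} \<in> E" "{u', v'} \<in> E"
    have "u \<in> V" "v \<in> V" "u' \<in> V" "v' \<in> V" using e E unfolding all_pairs_def by (auto simp: doubleton_eq_iff)
    then have "f u < f v \<Longrightarrow> (f u, f v) \<in> F" "f u' < f v' \<Longrightarrow> (f u', f v') \<in> F"
      using sub[of "f u" "f v"] sub[of "f u'" "f v'"] f e by auto
    then show "\<not> (f u < f u' \<and> f u' < f v \<and> f v < f v')" using nc by (metis order.strict_trans)
  qed
qed

text \<open>Adding 1 on the diagonal turns the adjacency matrix into summation over equivalence
  classes: \<open>k + 1\<close> times an entry of an eigenvector is the sum of the entries in its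
  class. Unless \<open>k = -1\<close>, the eigenvector is constant on classes, and a class where it
  is nonzero has \<open>k + 1\<close> elements.\<close>

lemma cluster_graph_integral:
  assumes E: "\<And>u v. {u, v} \<in> E \<longleftrightarrow> u \<in> V \<and> v \<in> V \<and> u \<noteq> v \<and> R u v"
    and R: "\<And>u. u \<in> V \<Longrightarrow> R u u" "\<And>u v. u \<in> V \<Longrightarrow> v \<in> V \<Longrightarrow> R u v \<Longrightarrow> R v u"
      "\<And>u v w. u \<in> V \<Longrightarrow> v \<in> V \<Longrightarrow> w \<in> V \<Longrightarrow> R u v \<Longrightarrow> R v w \<Longrightarrow> R u w"
  shows "integral_graph V E"
  unfolding integral_graph_def
proof (intro allI impI)
  fix vs k assume vs: "distinct vs \<and> set vs = V" and ev: "eigenvalue (adjacency_matrix vs E) k"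
  define n where "n = length vs"
  define A where "A = adjacency_matrix vs E"
  have dim: "A \<in> carrier_mat n n" unfolding A_def adjacency_matrix_def n_def by simp
  obtain v where v: "v \<in> carrier_vec n" "v \<noteq> 0\<^sub>v n" "A *\<^sub>v v = k \<cdot>\<^sub>v v"
    using ev dim unfolding A_def[symmetric] eigenvalue_def eigenvector_def by auto
  have inV: "vs ! i \<in> V" if "i < n" for i using vs that unfolding n_def by auto
  define N where "N i = {j \<in> {0..<n}. R (vs ! i) (vs ! j)}" for i
  have sum: "(k + 1) * vec_index v i = (\<Sum>j\<in>N i. vec_index v j)" if i: "i < n" for i
  proof -
    have "k * vec_index v i = vec_index (A *\<^sub>v v) i" using v i by simp
    also have "\<dots> = (\<Sum>j\<in>{0..<n}. A $$ (i, j) * vec_index v j)"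
      using dim v(1) i by (auto simp: scalar_prod_def)
    also have "\<dots> = (\<Sum>j\<in>{0..<n}. if j \<in> N i - {i} then vec_index v j else 0)"
    proof (rule sum.cong[OF refl])
      fix j assume j: "j \<in> {0..<n}"
      have "vs ! i = vs ! j \<longleftrightarrow> i = j" using vs i j unfolding n_def by (auto simp: nth_eq_iff_index_eq)
      then have "{vs ! i, vs ! j} \<in> E \<longleftrightarrow> j \<in> N i - {i}" using E inV i j unfolding N_def by auto
      then show "A $$ (i, j) * vec_index v j = (if j \<in> N i - {i} then vec_index v j else 0)"
        using i j unfolding A_def adjacency_matrix_def n_def by auto
    qed
    also have "\<dots> = (\<Sum>j\<in>N i - {i}. vec_index v j)"
      by (subst sum.inter_restrict[symmetric]) (auto simp: N_def intro!: sum.cong)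
    finally have "k * vec_index v i + vec_index v i = (\<Sum>j\<in>N i - {i}. vec_index v j) + vec_index v i" by simp
    also have "\<dots> = (\<Sum>j\<in>N i. vec_index v j)"
      using R(1)[OF inV[OF i]] i by (subst sum.remove[of "N i" i]) (auto simp: N_def)
    finally show ?thesis by (simp add: algebra_simps)
  qed
  show "k \<in> \<int>"
  proof (cases "k = -1")
    case True
    then show ?thesis by simp
  next
    case False
    obtain i where i: "i < n" "vec_index v i \<noteq> 0"
      using v(1,2) by (metis carrier_vecD eq_vecI index_zero_vec(1) index_zero_vec(2))
    have "vec_index v j = vec_index v i" if "j \<in> N i" for j
    proof -
      have j: "j < n" "R (vs ! i) (vs ! j)" using that unfolding N_def by auto
      have "N j = N i" unfolding N_def using R inV i(1) j by (metis (no_types, lifting) atLeastLessThan_iff)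
      then have "(k + 1) * vec_index v j = (k + 1) * vec_index v i" using sum j(1) i(1) by simp
      moreover have "k + 1 \<noteq> 0" using False by (simp add: eq_neg_iff_add_eq_0)
      ultimately show ?thesis by simp
    qed
    then have "(k + 1) * vec_index v i = of_nat (card (N i)) * vec_index v i" using sum[OF i(1)] by simp
    then have "k + 1 = of_nat (card (N i))" using i(2) by simp
    then have "k = of_nat (card (N i)) - 1" by (simp add: eq_diff_eq)
    then show ?thesis by simp
  qed
qed

section \<open>Centralizers in finite groups\<close>

locale finite_group = group G for G (structure) +
  assumes fin: "finite (carrier G)"
begin

definition "cen x = {y \<in> carrier G. x \<otimes> y = y \<otimes> x}"
definition "comm_set S \<longleftrightarrow> (\<forall>x\<in>S. \<forall>y\<in>S. x \<otimes> y = y \<otimes> x)"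
definition "cj g a = g \<otimes> a \<otimes> inv g"

lemma cen_iff: "y \<in> cen x \<longleftrightarrow> y \<in> carrier G \<and> x \<otimes> y = y \<otimes> x" by (simp add: cen_def)

lemma cen_sym: "x \<in> carrier G \<Longrightarrow> y \<in> cen x \<Longrightarrow> x \<in> cen y" by (simp add: cen_def)

lemma cen_self: "x \<in> carrier G \<Longrightarrow> x \<in> cen x" by (simp add: cen_def)

lemma commute_inv: assumes "x \<in> carrier G" "y \<in> carrier G" "x \<otimes> y = y \<otimes> x"
  shows "x \<otimes> inv y = inv y \<otimes> x"
proof -
  have "x \<otimes> inv y = inv y \<otimes> (y \<otimes> x) \<otimes> inv y" using assms(1,2) by (simp add: m_assoc[symmetric])
  also have "\<dots> = inv y \<otimes> (x \<otimes> y) \<otimes> inv y" using assms by simp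
  also have "\<dots> = inv y \<otimes> x" using assms(1,2) by (simp add: m_assoc)
  finally show ?thesis .
qed

lemma commute_mult: assumes "x \<in> carrier G" "y \<in> carrier G" "z \<in> carrier G" "x \<otimes> y = y \<otimes> x" "x \<otimes> z = z \<otimes> x"
  shows "x \<otimes> (y \<otimes> z) = (y \<otimes> z) \<otimes> x"
proof -
  have "x \<otimes> (y \<otimes> z) = (x \<otimes> y) \<otimes> z" using assms(1-3) by (simp add: m_assoc)
  also have "\<dots> = y \<otimes> (x \<otimes> z)" unfolding assms(4) using assms(1-3) by (simp add: m_assoc)
  also have "\<dots> = (y \<otimes> z) \<otimes> x" unfolding assms(5) using assms(1-3) by (simp add: m_assoc)
  finally show ?thesis .
qed

lemma cen_subgroup: assumes x: "x \<in> carrier G" shows "subgroup (cen x) G"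
proof (rule subgroupI)
  show "cen x \<noteq> {}" using cen_self[OF x] by blast
  show "inv a \<in> cen x" if "a \<in> cen x" for a using that commute_inv[OF x] by (simp add: cen_iff)
  show "a \<otimes> b \<in> cen x" if "a \<in> cen x" "b \<in> cen x" for a b using that commute_mult[OF x] by (simp add: cen_iff)
qed (auto simp: cen_def)

lemma sub_fin: "subgroup H G \<Longrightarrow> finite H" using fin finite_subset subgroup.subset by blast

lemma sub_card_dvd: assumes "subgroup H G" "subgroup K G" "H \<subseteq> K" shows "card H dvd card K"
proof -
  interpret K: group "G\<lparr>carrier := K\<rparr>" using assms(2) by (rule subgroup.subgroup_is_group) (rule is_group)
  have "card (rcosets\<^bsub>G\<lparr>carrier := K\<rparr>\<^esub> H) * card H = order (G\<lparr>carrier := K\<rparr>)"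
    by (rule K.lagrange[OF subgroup_incl[OF assms]])
  also have "\<dots> = card K" by (simp add: order_def)
  finally have "card K = card H * card (rcosets\<^bsub>G\<lparr>carrier := K\<rparr>\<^esub> H)" by (simp add: mult.commute)
  then show ?thesis by simp
qed

lemma sub_pos: "subgroup H G \<Longrightarrow> card H > 0"
  using sub_fin subgroup.one_closed by (metis card_gt_0_iff empty_iff)

lemma pow_card: assumes "subgroup P G" "x \<in> P" shows "x [^] card P = \<one>"
proof -
  interpret P: group "G\<lparr>carrier := P\<rparr>" using assms(1) by (rule subgroup.subgroup_is_group) (rule is_group)
  have "x [^]\<^bsub>G\<lparr>carrier := P\<rparr>\<^esub> order (G\<lparr>carrier := P\<rparr>) = \<one>\<^bsub>G\<lparr>carrier := P\<rparr>\<^esub>"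
    using assms(2) by (intro P.pow_order_eq_1) simp
  then show ?thesis by (simp add: nat_pow_consistent[symmetric] order_def)
qed

lemma cauchy: assumes "prime p" "subgroup H G" "p dvd card H"
  obtains P where "subgroup P G" "P \<subseteq> H" "card P = p"
proof -
  interpret H: group "G\<lparr>carrier := H\<rparr>" using assms(2) by (rule subgroup.subgroup_is_group) (rule is_group)
  \<comment> \<open>Sylow's theorem is applied with exponent 1; \<open>m\<close> may still be
    divisible by \<open>p\<close>.\<close>
  obtain m where "card H = p ^ 1 * m" using assms(3) by (auto simp: dvd_def)
  then have "\<exists>P. subgroup P (G\<lparr>carrier := H\<rparr>) \<and> card P = p ^ 1"
    using sub_fin[OF assms(2)] by (intro sylow_thm[OF assms(1)]) (auto simp: order_def H.is_group)
  then obtain P where P: "subgroup P (G\<lparr>carrier := H\<rparr>)" "card P = p" by auto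
  have "subgroup P G" using incl_subgroup[OF assms(2) P(1)] .
  moreover have "P \<subseteq> H" using subgroup.subset[OF P(1)] by simp
  ultimately show ?thesis using that P(2) by blast
qed

text \<open>A maximal commuting set consists of exactly the elements that commute with all of it, so
  it is closed under the group operations.\<close>

lemma max_commuting: assumes "S \<subseteq> carrier G" "comm_set S"
  obtains B where "S \<subseteq> B" "subgroup B G" "comm_set B"
proof -
  define F where "F = {B. B \<subseteq> carrier G \<and> S \<subseteq> B \<and> comm_set B}"
  have "finite F" unfolding F_def using fin by (auto intro: finite_subset[of _ "Pow (carrier G)"])
  moreover have "S \<in> F" using assms unfolding F_def by auto
  ultimately have "\<exists>B\<in>F. S \<subseteq> B \<and> (\<forall>B'\<in>F. B \<subseteq> B' \<longrightarrow> B = B')" by (rule finite_has_maximal2)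
  then obtain B where B: "B \<in> F" and mx: "\<forall>B'\<in>F. B \<subseteq> B' \<longrightarrow> B = B'" by blast
  have Bc: "B \<subseteq> carrier G" "S \<subseteq> B" "comm_set B" using B unfolding F_def by auto
  have ch: "x \<in> B \<longleftrightarrow> x \<in> carrier G \<and> (\<forall>b\<in>B. x \<in> cen b)" for x
  proof
    assume "x \<in> B"
    then show "x \<in> carrier G \<and> (\<forall>b\<in>B. x \<in> cen b)" using Bc by (auto simp: cen_def comm_set_def)
  next
    assume x: "x \<in> carrier G \<and> (\<forall>b\<in>B. x \<in> cen b)"
    then have "insert x B \<in> F" using Bc unfolding F_def comm_set_def cen_def by auto
    then show "x \<in> B" using mx by blast
  qed
  have "subgroup B G"
  proof (rule subgroupI)
    show "B \<subseteq> carrier G" by (rule Bc)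
    show "B \<noteq> {}" using ch[of \<one>] Bc by (auto simp: cen_def)
    fix a assume a: "a \<in> B"
    then have ac: "a \<in> carrier G" "\<And>c. c \<in> B \<Longrightarrow> c \<in> carrier G \<and> a \<in> cen c" using ch[of a] Bc(1) by auto
    then have "inv a \<in> cen c" if "c \<in> B" for c using subgroup.m_inv_closed[OF cen_subgroup] that by blast
    then show "inv a \<in> B" using ch[of "inv a"] ac(1) by simp
    fix b assume b: "b \<in> B"
    then have bc: "b \<in> carrier G" "\<And>c. c \<in> B \<Longrightarrow> b \<in> cen c" using ch[of b] by auto
    have "a \<otimes> b \<in> cen c" if "c \<in> B" for c using subgroup.m_closed[OF cen_subgroup] ac(2)[OF that] bc(2)[OF that] by blast
    then show "a \<otimes> b \<in> B" using ch[of "a \<otimes> b"] ac(1) bc(1) by simp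
  qed
  then show ?thesis using that Bc by blast
qed

section \<open>Conjugation and commuting pairs\<close>

lemma cj_closed [simp]: "g \<in> carrier G \<Longrightarrow> a \<in> carrier G \<Longrightarrow> cj g a \<in> carrier G" by (simp add: cj_def)

lemma cj_mult: "g \<in> carrier G \<Longrightarrow> a \<in> carrier G \<Longrightarrow> b \<in> carrier G \<Longrightarrow> cj g (a \<otimes> b) = cj g a \<otimes> cj g b"
  by (simp add: cj_def m_assoc inv_solve_left)

lemma cj_cj: "g \<in> carrier G \<Longrightarrow> h \<in> carrier G \<Longrightarrow> a \<in> carrier G \<Longrightarrow> cj g (cj h a) = cj (g \<otimes> h) a"
  by (simp add: cj_def m_assoc inv_mult_group)

lemma cj_one [simp]: "a \<in> carrier G \<Longrightarrow> cj \<one> a = a" by (simp add: cj_def)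
lemma cj_1 [simp]: "g \<in> carrier G \<Longrightarrow> cj g \<one> = \<one>" by (simp add: cj_def)

lemma cj_inv_cancel [simp]: "g \<in> carrier G \<Longrightarrow> a \<in> carrier G \<Longrightarrow> cj (inv g) (cj g a) = a"
  "g \<in> carrier G \<Longrightarrow> a \<in> carrier G \<Longrightarrow> cj g (cj (inv g) a) = a"
  by (simp_all add: cj_cj)

lemma cj_inject: "g \<in> carrier G \<Longrightarrow> a \<in> carrier G \<Longrightarrow> b \<in> carrier G \<Longrightarrow> cj g a = cj g b \<longleftrightarrow> a = b"
  by (metis cj_inv_cancel(1))

lemma cj_inj: "g \<in> carrier G \<Longrightarrow> S \<subseteq> carrier G \<Longrightarrow> inj_on (cj g) S"
  by (meson cj_inject inj_onI subsetD)

lemma cj_fix: assumes "g \<in> carrier G" "a \<in> carrier G" shows "cj g a = a \<longleftrightarrow> g \<otimes> a = a \<otimes> g"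
proof -
  have "cj g a = a \<longleftrightarrow> g \<otimes> a \<otimes> inv g \<otimes> g = a \<otimes> g" unfolding cj_def using assms by (metis inv_closed m_closed right_cancel)
  also have "g \<otimes> a \<otimes> inv g \<otimes> g = g \<otimes> a" using assms by (simp add: m_assoc)
  finally show ?thesis .
qed

lemma cj_subgroup: assumes g: "g \<in> carrier G" and H: "subgroup H G" shows "subgroup (cj g ` H) G"
proof (rule subgroupI)
  have Hc: "H \<subseteq> carrier G" by (rule subgroup.subset[OF H])
  show "cj g ` H \<subseteq> carrier G" using g Hc by auto
  show "cj g ` H \<noteq> {}" using subgroup.one_closed[OF H] by blast
  show "inv a \<in> cj g ` H" if a: "a \<in> cj g ` H" for a
  proof -
    obtain h where h: "h \<in> H" "a = cj g h" using a by blast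
    then have "h \<in> carrier G" using Hc by blast
    then have "inv a = cj g (inv h)" unfolding h(2) using g by (simp add: cj_def inv_mult_group m_assoc)
    then show ?thesis using subgroup.m_inv_closed[OF H h(1)] by blast
  qed
  show "a \<otimes> b \<in> cj g ` H" if ab: "a \<in> cj g ` H" "b \<in> cj g ` H" for a b
  proof -
    obtain h k where h: "h \<in> H" "a = cj g h" "k \<in> H" "b = cj g k" using ab by blast
    have "h \<in> carrier G" "k \<in> carrier G" using h Hc by auto
    then have "a \<otimes> b = cj g (h \<otimes> k)" using cj_mult[OF g] h by simp
    then show ?thesis using subgroup.m_closed[OF H h(1,3)] by blast
  qed
qed

lemma cj_commuting: assumes "g \<in> carrier G" "S \<subseteq> carrier G" "comm_set S" shows "comm_set (cj g ` S)"
  unfolding comm_set_def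
proof (intro ballI)
  fix x y assume "x \<in> cj g ` S" "y \<in> cj g ` S"
  then obtain a b where ab: "a \<in> S" "b \<in> S" "x = cj g a" "y = cj g b" by blast
  then have "a \<in> carrier G" "b \<in> carrier G" "a \<otimes> b = b \<otimes> a" using assms unfolding comm_set_def by auto
  then show "x \<otimes> y = y \<otimes> x" unfolding ab(3,4) using cj_mult[OF assms(1)] by metis
qed

lemma cj_cen: assumes g: "g \<in> carrier G" and x: "x \<in> carrier G" shows "cen (cj g x) = cj g ` cen x"
proof -
  have sub: "cj g ` cen x \<subseteq> cen (cj g x)" if "g \<in> carrier G" "x \<in> carrier G" for g x
    using that by (auto simp: cen_iff cj_mult[symmetric])
  have "cj (inv g) ` cen (cj g x) \<subseteq> cen x" using sub[of "inv g" "cj g x"] g x by simp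
  then have "y \<in> cj g ` cen x" if "y \<in> cen (cj g x)" for y
  proof -
    have "cj (inv g) y \<in> cen x" using \<open>cj (inv g) ` cen (cj g x) \<subseteq> cen x\<close> that by blast
    moreover have "y = cj g (cj (inv g) y)" using g that by (simp add: cen_iff)
    ultimately show ?thesis by (rule image_eqI[rotated])
  qed
  then have "cen (cj g x) \<subseteq> cj g ` cen x" by blast
  then show ?thesis using sub g x by blast
qed

lemma cj_card: "g \<in> carrier G \<Longrightarrow> S \<subseteq> carrier G \<Longrightarrow> card (cj g ` S) = card S"
  by (simp add: card_image cj_inj)

definition "cpairs H S = {(h, s) \<in> H \<times> S. h \<otimes> s = s \<otimes> h}"

lemma card_cpairs: assumes "finite H" "finite S"
  shows "card (cpairs H S) = (\<Sum>h\<in>H. card {s \<in> S. h \<otimes> s = s \<otimes> h})"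
    and "card (cpairs H S) = (\<Sum>s\<in>S. card {h \<in> H. h \<otimes> s = s \<otimes> h})"
proof -
  have "cpairs H S = (SIGMA h:H. {s \<in> S. h \<otimes> s = s \<otimes> h})" unfolding cpairs_def by auto
  then show "card (cpairs H S) = (\<Sum>h\<in>H. card {s \<in> S. h \<otimes> s = s \<otimes> h})" using assms by simp
  have "cpairs H S = prod.swap ` (SIGMA s:S. {h \<in> H. h \<otimes> s = s \<otimes> h})" unfolding cpairs_def by (auto simp: image_iff)
  then have "card (cpairs H S) = card (SIGMA s:S. {h \<in> H. h \<otimes> s = s \<otimes> h})" by (simp add: card_image)
  then show "card (cpairs H S) = (\<Sum>s\<in>S. card {h \<in> H. h \<otimes> s = s \<otimes> h})" using assms by simp
qed

text \<open>Burnside's lemma for \<open>H\<close> acting on \<open>S\<close> by conjugation: fixed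
  points are commuting pairs, so the number of these is \<open>card H\<close> times the number of
  orbits.\<close>

lemma burnside_commuting:
  assumes H: "subgroup H G" and S: "S \<subseteq> carrier G" and inv: "\<And>h s. h \<in> H \<Longrightarrow> s \<in> S \<Longrightarrow> cj h s \<in> S"
  shows "card H dvd card (cpairs H S)"
proof -
  have Hc: "H \<subseteq> carrier G" by (rule subgroup.subset[OF H])
  interpret H: group "G\<lparr>carrier := H\<rparr>" using H by (rule subgroup.subgroup_is_group) (rule is_group)
  define phi where "phi h = (\<lambda>s\<in>S. cj h s)" for h
  have bij: "phi h \<in> Bij S" if h: "h \<in> H" for h
  proof -
    have hi: "inv h \<in> H" using subgroup.m_inv_closed[OF H h] .
    have "bij_betw (phi h) S S"
    proof (rule bij_betw_byWitness[of _ "cj (inv h)"])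
      show "phi h ` S \<subseteq> S" "cj (inv h) ` S \<subseteq> S" using inv h hi unfolding phi_def by auto
      show "\<forall>a\<in>S. cj (inv h) (phi h a) = a" "\<forall>a'\<in>S. phi h (cj (inv h) a') = a'"
        using inv h hi S Hc unfolding phi_def by (auto simp: subset_iff)
    qed
    then show ?thesis unfolding Bij_def phi_def by auto
  qed
  have "group_action (G\<lparr>carrier := H\<rparr>) S phi"
    unfolding group_action_def group_hom_def group_hom_axioms_def
  proof (intro conjI)
    show "group (G\<lparr>carrier := H\<rparr>)" by (rule H.is_group)
    show "group (BijGroup S)" by (rule group_BijGroup)
    show "phi \<in> hom (G\<lparr>carrier := H\<rparr>) (BijGroup S)"
    proof (rule homI)
      show "phi x \<in> carrier (BijGroup S)" if "x \<in> carrier (G\<lparr>carrier := H\<rparr>)" for x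
        using bij that by (simp add: BijGroup_def)
      fix x y assume "x \<in> carrier (G\<lparr>carrier := H\<rparr>)" "y \<in> carrier (G\<lparr>carrier := H\<rparr>)"
      then have xy: "x \<in> H" "y \<in> H" by auto
      have "phi (x \<otimes> y) = compose S (phi x) (phi y)"
      proof
        fix s
        show "phi (x \<otimes> y) s = compose S (phi x) (phi y) s"
        proof (cases "s \<in> S")
          case True
          then have "x \<in> carrier G" "y \<in> carrier G" "s \<in> carrier G" using xy Hc S by auto
          then show ?thesis using True inv[OF xy(2) True] unfolding phi_def compose_def by (simp add: cj_cj)
        qed (simp add: phi_def compose_def)
      qed
      then show "phi (x \<otimes>\<^bsub>G\<lparr>carrier := H\<rparr>\<^esub> y) = phi x \<otimes>\<^bsub>BijGroup S\<^esub> phi y"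
        using bij xy by (simp add: BijGroup_def)
    qed
  qed
  then interpret A: group_action "G\<lparr>carrier := H\<rparr>" S phi .
  have finS: "finite S" using S fin finite_subset by blast
  have "card (orbits (G\<lparr>carrier := H\<rparr>) S phi) * order (G\<lparr>carrier := H\<rparr>) = (\<Sum>h\<in>H. card (invariants S phi h))"
    using A.burnside sub_fin[OF H] finS by simp
  also have "\<dots> = (\<Sum>h\<in>H. card {s \<in> S. h \<otimes> s = s \<otimes> h})"
  proof (rule sum.cong[OF refl])
    fix h assume h: "h \<in> H"
    have "invariants S phi h = {s \<in> S. h \<otimes> s = s \<otimes> h}"
      unfolding invariants_def phi_def using cj_fix h Hc S by (auto simp: subset_iff)
    then show "card (invariants S phi h) = card {s \<in> S. h \<otimes> s = s \<otimes> h}" by simp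
  qed
  also have "\<dots> = card (cpairs H S)" using card_cpairs(1)[OF sub_fin[OF H] finS] by simp
  finally have "card (orbits (G\<lparr>carrier := H\<rparr>) S phi) * order (G\<lparr>carrier := H\<rparr>) = card (cpairs H S)" .
  moreover have "order (G\<lparr>carrier := H\<rparr>) = card H" by (simp add: order_def)
  ultimately have "card (cpairs H S) = card H * card (orbits (G\<lparr>carrier := H\<rparr>) S phi)" by (simp add: mult.commute)
  then show ?thesis by simp
qed

lemma sub_two: assumes "subgroup P G" "card P = 2" obtains t where "P = {\<one>, t}" "t \<noteq> \<one>" "t \<in> carrier G" "t \<otimes> t = \<one>"
proof -
  have "\<one> \<in> P" by (rule subgroup.one_closed[OF assms(1)])
  then obtain t where t: "P = {\<one>, t}" "t \<noteq> \<one>" using assms(2) by (metis card_2_iff insertE insert_commute singletonD)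
  have tc: "t \<in> carrier G" using subgroup.subset[OF assms(1)] t by auto
  have "t [^] (2::nat) = \<one>" using pow_card[OF assms(1), of t, unfolded assms(2)] t(1) by blast
  then have "t \<otimes> t = \<one>" using tc by (simp add: numeral_2_eq_2)
  then show ?thesis using that t tc by blast
qed

lemma sub_pair: assumes "t \<in> carrier G" "t \<otimes> t = \<one>" shows "subgroup {\<one>, t} G"
proof (rule subgroupI)
  have "inv t = t" using assms by (simp add: inv_equality)
  then show "inv a \<in> {\<one>, t}" if "a \<in> {\<one>, t}" for a using that by auto
qed (use assms in auto)

lemma prime_sub_gen: assumes "prime p" "subgroup P G" "card P = p" "subgroup H G" "h \<in> P" "h \<in> H" "h \<noteq> \<one>"
  shows "P \<subseteq> H"
proof -
  have s: "subgroup (P \<inter> H) G" using assms subgroups_Inter_pair by blast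
  then have "card (P \<inter> H) dvd p" using sub_card_dvd[OF s assms(2)] assms(3) by simp
  moreover have "card (P \<inter> H) \<noteq> 1"
    using assms(5-7) subgroup.one_closed[OF s] by (metis IntI card_1_singletonE singletonD)
  ultimately have "card (P \<inter> H) = card P" using assms(1,3) by (auto simp: prime_nat_iff)
  then have "P \<inter> H = P" using sub_fin[OF assms(2)] by (metis card_subset_eq inf_le1)
  then show ?thesis by blast
qed

lemma prime_sub_commuting: assumes "prime p" "subgroup P G" "card P = p" shows "comm_set P"
  unfolding comm_set_def
proof (intro ballI)
  fix x y assume xy: "x \<in> P" "y \<in> P"
  have xc: "x \<in> carrier G" "y \<in> carrier G" using subgroup.subset[OF assms(2)] xy by auto
  show "x \<otimes> y = y \<otimes> x"
  proof (cases "x = \<one>")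
    case False
    then have "P \<subseteq> cen x" using prime_sub_gen[OF assms cen_subgroup[OF xc(1)] xy(1) cen_self[OF xc(1)]] by blast
    then show ?thesis using xy(2) by (auto simp: cen_iff)
  qed (use xc in simp)
qed

end

section \<open>Groups with toroidal commuting graph\<close>

text \<open>The two consequences of an embedding of the commuting graph in the torus that are used:
  every vertex set \<open>W\<close> spans at most \<open>3 |W|\<close> edges, here counted as ordered pairs together with the diagonal,
  and there are no two disjoint complete graphs on five vertices.\<close>

locale toroidal_group = finite_group +
  assumes sparse: "\<And>W. W \<subseteq> carrier G - group_centre G \<Longrightarrow> card (cpairs W W) \<le> 7 * card W"
    and no_two_K5: "\<And>A B. A \<subseteq> carrier G - group_centre G \<Longrightarrow> B \<subseteq> carrier G - group_centre G \<Longrightarrow>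
      comm_set A \<Longrightarrow> comm_set B \<Longrightarrow> card A \<ge> 5 \<Longrightarrow> card B \<ge> 5 \<Longrightarrow> A \<inter> B \<noteq> {}"
begin

abbreviation "Z \<equiv> group_centre G"

lemma Z_iff: "z \<in> Z \<longleftrightarrow> z \<in> carrier G \<and> (\<forall>x\<in>carrier G. z \<in> cen x)"
  unfolding group_centre_def cen_def by auto

lemma Z_sub: "subgroup Z G"
proof (rule subgroupI)
  show "Z \<subseteq> carrier G" using Z_iff by blast
  show "Z \<noteq> {}" using Z_iff[of \<one>] by (auto simp: cen_iff)
  fix a assume "a \<in> Z"
  then have a: "a \<in> carrier G" "\<And>x. x \<in> carrier G \<Longrightarrow> x \<otimes> a = a \<otimes> x" unfolding group_centre_def by auto
  have "inv a \<otimes> x = x \<otimes> inv a" if "x \<in> carrier G" for x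
    using commute_inv[OF that a(1) a(2)[OF that]] by (rule sym)
  then show "inv a \<in> Z" unfolding group_centre_def using a(1) by simp
  fix b assume "b \<in> Z"
  then have b: "b \<in> carrier G" "\<And>x. x \<in> carrier G \<Longrightarrow> x \<otimes> b = b \<otimes> x" unfolding group_centre_def by auto
  have "(a \<otimes> b) \<otimes> x = x \<otimes> (a \<otimes> b)" if "x \<in> carrier G" for x
    using commute_mult[OF that a(1) b(1) a(2)[OF that] b(2)[OF that]] by (rule sym)
  then show "a \<otimes> b \<in> Z" unfolding group_centre_def using a(1) b(1) by simp
qed

text \<open>All \<open>s * s\<close> pairs of a commuting set of \<open>s\<close> elements count, so
  \<open>s * s \<le> 7 * s\<close>.\<close>

lemma comm_set_card: assumes "S \<subseteq> carrier G - Z" "comm_set S" shows "card S \<le> 7"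
proof -
  have "finite S" using assms(1) fin finite_subset by blast
  have "cpairs S S = S \<times> S" using assms(2) unfolding cpairs_def comm_set_def by auto
  then have "card S * card S \<le> 7 * card S" using sparse[OF assms(1)] by (simp add: card_cartesian_product)
  then show ?thesis by (cases "card S = 0") auto
qed

section \<open>The centre of a nonabelian centralizer\<close>

text \<open>Let \<open>x\<close> be noncentral with nonabelian centralizer \<open>C\<close>, and let \<open>D\<close> be the centre of \<open>C\<close>. Since cosets of \<open>D\<close> by commuting
  elements form commuting sets, \<open>D\<close> is small. If \<open>|D| = 4\<close>, then \<open>C\<close> has too many commuting pairs. If \<open>|D| = 3\<close>,
  then all squares in \<open>C\<close> are central, which forces \<open>C\<close> to be abelian.\<close>

context
  fixes x assumes x: "x \<in> carrier G" "x \<notin> Z" and nab: "\<not> comm_set (cen x)"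
begin

private definition "C = cen x"
private definition "D = {d \<in> C. \<forall>c\<in>C. d \<otimes> c = c \<otimes> d}"

private lemma C_sub: "subgroup C G" unfolding C_def by (rule cen_subgroup[OF x(1)])
private lemma C_car: "C \<subseteq> carrier G" by (rule subgroup.subset[OF C_sub])

private lemma D_sub: "subgroup D G"
proof (rule subgroupI)
  show "D \<subseteq> carrier G" using C_car unfolding D_def by auto
  show "D \<noteq> {}" using subgroup.one_closed[OF C_sub] C_car unfolding D_def by force
  show "inv a \<in> D" if a: "a \<in> D" for a
  proof -
    have "inv a \<in> C" using subgroup.m_inv_closed[OF C_sub] a unfolding D_def by blast
    moreover have "inv a \<otimes> c = c \<otimes> inv a" if c: "c \<in> C" for c
    proof -
      have "c \<in> carrier G" "a \<in> carrier G" "c \<otimes> a = a \<otimes> c" using a c C_car unfolding D_def by auto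
      from commute_inv[OF this] show ?thesis by (rule sym)
    qed
    ultimately show ?thesis unfolding D_def by blast
  qed
  show "a \<otimes> b \<in> D" if a: "a \<in> D" and b: "b \<in> D" for a b
  proof -
    have "a \<otimes> b \<in> C" using subgroup.m_closed[OF C_sub] a b unfolding D_def by blast
    moreover have "a \<otimes> b \<otimes> c = c \<otimes> (a \<otimes> b)" if c: "c \<in> C" for c
    proof -
      have "c \<in> carrier G" "a \<in> carrier G" "b \<in> carrier G" "c \<otimes> a = a \<otimes> c" "c \<otimes> b = b \<otimes> c"
        using a b c C_car unfolding D_def by auto
      from commute_mult[OF this] show ?thesis by (rule sym)
    qed
    ultimately show ?thesis unfolding D_def by blast
  qed
qed

private lemma DC: "D \<subseteq> C" unfolding D_def by auto
private lemma D_car: "D \<subseteq> carrier G" using DC C_car by blast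
private lemma D_comm: "d \<in> D \<Longrightarrow> c \<in> C \<Longrightarrow> d \<otimes> c = c \<otimes> d" unfolding D_def by auto
private lemma x_D: "x \<in> D" using cen_self[OF x(1)] unfolding D_def C_def by (auto simp: cen_iff)
private lemma ZD: "Z \<subseteq> D" unfolding D_def C_def using Z_iff x(1) by (auto simp: cen_iff)
private lemma DneC: "D \<noteq> C" using nab unfolding D_def C_def comm_set_def by blast
private lemma finC: "finite C" and finD: "finite D" using C_car D_car fin finite_subset by blast+

private definition "E y = C \<inter> cen y"

private lemma E_sub: "y \<in> C \<Longrightarrow> subgroup (E y) G"
  unfolding E_def using C_sub cen_subgroup C_car subgroups_Inter_pair by blast

private definition "co y = (\<lambda>d. y \<otimes> d) ` D"

private lemma co: assumes y: "y \<in> C"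
  shows "card (co y) = card D" "co y \<subseteq> E y" "y \<in> co y" "co y \<inter> D \<noteq> {} \<Longrightarrow> y \<in> D"
proof -
  have yc: "y \<in> carrier G" using y C_car by blast
  have "inj_on (\<lambda>d. y \<otimes> d) D" using yc D_car by (intro inj_onI) (metis Units_eq Units_l_cancel subsetD)
  then show "card (co y) = card D" unfolding co_def by (rule card_image)
  show "co y \<subseteq> E y"
  proof
    fix z assume "z \<in> co y"
    then obtain d where d: "d \<in> D" "z = y \<otimes> d" unfolding co_def by blast
    have "z \<in> C" using d y DC subgroup.m_closed[OF C_sub] by blast
    moreover have "d \<in> carrier G" using d(1) D_car by blast
    then have "y \<otimes> z = z \<otimes> y" unfolding d(2)
      by (rule commute_mult[OF yc yc _ refl sym[OF D_comm[OF d(1) y]]])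
    ultimately show "z \<in> E y" using C_car by (auto simp: E_def cen_iff)
  qed
  show "y \<in> co y" unfolding co_def using subgroup.one_closed[OF D_sub] yc by (metis image_eqI r_one)
  show "y \<in> D" if "co y \<inter> D \<noteq> {}"
  proof -
    obtain d where d: "d \<in> D" "y \<otimes> d \<in> D" using \<open>co y \<inter> D \<noteq> {}\<close> unfolding co_def by blast
    then have "y \<otimes> d \<otimes> inv d \<in> D" using subgroup.m_closed[OF D_sub] subgroup.m_inv_closed[OF D_sub] by blast
    then show "y \<in> D" using yc d D_car by (auto simp: m_assoc subset_iff)
  qed
qed

private lemma co_meet: assumes "y \<in> C" "w \<in> C" "co y \<inter> co w \<noteq> {}" shows "w \<in> co y"
proof -
  obtain d d' where d: "d \<in> D" "d' \<in> D" "y \<otimes> d = w \<otimes> d'" using assms(3) unfolding co_def by blast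
  have c: "y \<in> carrier G" "w \<in> carrier G" "d \<in> carrier G" "d' \<in> carrier G" using assms d C_car D_car by auto
  have "w = w \<otimes> d' \<otimes> inv d'" using c by (simp add: m_assoc)
  also have "\<dots> = y \<otimes> (d \<otimes> inv d')" unfolding d(3)[symmetric] using c by (simp add: m_assoc)
  finally show ?thesis unfolding co_def
    using d subgroup.m_closed[OF D_sub] subgroup.m_inv_closed[OF D_sub] by blast
qed

private lemma D_co_sub: "y \<in> C \<Longrightarrow> D \<union> co y \<subseteq> E y"
proof -
  assume y: "y \<in> C"
  have "d \<in> E y" if d: "d \<in> D" for d
    using D_comm[OF d y] d DC D_car by (auto simp: E_def cen_iff)
  then show ?thesis using co(2)[OF y] by blast
qed

private lemma comm_D_co: assumes "T \<subseteq> C" "comm_set T" shows "comm_set (D \<union> (\<Union>y\<in>T. co y))"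
proof -
  have 1: "a \<otimes> b = b \<otimes> a" if "a \<in> D" "b \<in> C" for a b using D_comm that by blast
  have cC: "co y \<subseteq> C" if "y \<in> T" for y using co(2) assms(1) that unfolding E_def by blast
  have 2: "a \<otimes> b = b \<otimes> a" if yw: "y \<in> T" "w \<in> T" "a \<in> co y" "b \<in> co w" for a b y w
  proof -
    obtain d d' where d: "d \<in> D" "d' \<in> D" "a = y \<otimes> d" "b = w \<otimes> d'" using yw unfolding co_def by blast
    have c: "y \<in> carrier G" "w \<in> carrier G" "d \<in> carrier G" "d' \<in> carrier G" using assms yw d C_car D_car by auto
    have yC: "y \<in> C" "w \<in> C" using yw assms by auto
    have aC: "a \<in> carrier G" using cC yw C_car by blast
    have wy: "w \<otimes> y = y \<otimes> w" using assms(2) yw unfolding comm_set_def by blast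
    have "w \<otimes> a = a \<otimes> w" unfolding d(3)
      by (rule commute_mult[OF c(2) c(1) c(3) wy sym[OF D_comm[OF d(1) yC(2)]]])
    moreover have "a \<in> C" using cC[OF yw(1)] yw(3) by blast
    ultimately show ?thesis unfolding d(4)
      by (intro commute_mult[OF aC c(2) c(4)]) (simp_all add: D_comm[OF d(2)])
  qed
  show ?thesis unfolding comm_set_def
  proof (intro ballI)
    fix a b assume ab: "a \<in> D \<union> (\<Union>y\<in>T. co y)" "b \<in> D \<union> (\<Union>y\<in>T. co y)"
    then have "a \<in> C" "b \<in> C" using DC cC by auto
    then show "a \<otimes> b = b \<otimes> a" using ab 1[of a b] 1[of b a] 2 by (metis UN_E UnE)
  qed
qed

private lemma Z_le: "card Z \<le> card D" "card Z \<ge> 1" "card Z dvd card D" "card Z < card D"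
proof -
  show "card Z dvd card D" by (rule sub_card_dvd[OF Z_sub D_sub ZD])
  show "card Z \<le> card D" using finD ZD by (rule card_mono)
  show "card Z \<ge> 1" using sub_pos[OF Z_sub] by linarith
  have "Z \<subset> D" using ZD x_D x(2) by blast
  then show "card Z < card D" using finD psubset_card_mono by blast
qed

text \<open>\<open>D\<close> and the cosets of commuting elements form, without \<open>Z\<close>, a
  commuting set of noncentral elements, hence have at most 7 members. One coset besides
  \<open>D\<close> is always available, a second one if some \<open>w\<close> in \<open>C\<close>
  outside \<open>D\<close> and \<open>co y\<close> commutes with \<open>y\<close>.\<close>

private lemma two_cosets: assumes y: "y \<in> C" "y \<notin> D"
  shows "2 * card D \<le> 7 + card Z" and "w \<in> E y \<Longrightarrow> w \<notin> D \<union> co y \<Longrightarrow> 3 * card D \<le> 7 + card Z"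
proof -
  have dis: "D \<inter> co y = {}" using co(4)[OF y(1)] y(2) by blast
  have fc: "finite (co v)" for v unfolding co_def using finD by blast
  have cs: "comm_set {y}" unfolding comm_set_def by simp
  have sub: "(D \<union> co y) - Z \<subseteq> carrier G - Z" using D_co_sub[OF y(1)] C_car D_car unfolding E_def by blast
  have com: "comm_set ((D \<union> co y) - Z)" using comm_D_co[of "{y}"] y cs unfolding comm_set_def by auto
  have "card ((D \<union> co y) - Z) = card (D \<union> co y) - card Z"
    using ZD finD by (intro card_Diff_subset) (auto intro: finite_subset)
  also have "card (D \<union> co y) = 2 * card D" using card_Un_disjoint[OF finD fc dis] co(1)[OF y(1)] by simp
  finally show "2 * card D \<le> 7 + card Z" using comm_set_card[OF sub com] by linarith
  assume w: "w \<in> E y" "w \<notin> D \<union> co y"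
  have wC: "w \<in> C" "w \<notin> D" using w unfolding E_def by auto
  have dis2: "(D \<union> co y) \<inter> co w = {}" using co(4)[OF wC(1)] wC(2) co_meet[OF y(1) wC(1)] w(2) by blast
  have "y \<otimes> w = w \<otimes> y" using w by (simp add: E_def cen_iff)
  then have cs2: "comm_set {y, w}" unfolding comm_set_def by auto
  have "D \<union> (\<Union>y\<in>{y, w}. co y) = D \<union> co y \<union> co w" by auto
  then have com2: "comm_set ((D \<union> co y \<union> co w) - Z)" using comm_D_co[of "{y, w}"] y(1) wC(1) cs2 unfolding comm_set_def by simp
  have sub2: "(D \<union> co y \<union> co w) - Z \<subseteq> carrier G - Z"
    using D_co_sub[OF y(1)] D_co_sub[OF wC(1)] C_car D_car unfolding E_def by blast
  have "card ((D \<union> co y \<union> co w) - Z) = card (D \<union> co y \<union> co w) - card Z"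
    using ZD finD by (intro card_Diff_subset) (auto intro: finite_subset)
  also have "card (D \<union> co y \<union> co w) = 3 * card D"
    using card_Un_disjoint[OF _ fc dis2] card_Un_disjoint[OF finD fc dis] finD fc co(1)[OF y(1)] co(1)[OF wC(1)] by simp
  finally show "3 * card D \<le> 7 + card Z" using comm_set_card[OF sub2 com2] by linarith
qed

private lemma E_eq: assumes y: "y \<in> C" "y \<notin> D" and big: "3 * card D > 7 + card Z"
  shows "E y = D \<union> co y" "card (E y) = 2 * card D"
proof -
  show eq: "E y = D \<union> co y" using two_cosets(2)[OF y] D_co_sub[OF y(1)] big by (meson not_le subsetI subset_antisym)
  have "finite (co y)" unfolding co_def using finD by blast
  moreover have "D \<inter> co y = {}" using co(4)[OF y(1)] y(2) by blast
  ultimately show "card (E y) = 2 * card D" unfolding eq using finD co(1)[OF y(1)] by (simp add: card_Un_disjoint)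
qed

text \<open>With \<open>card D = card Z * k\<close> and \<open>k \<ge> 2\<close>, the bound for one
  coset besides \<open>D\<close> reads \<open>card Z * (2 * k - 1) \<le> 7\<close>.\<close>

private lemma card_D: "card Z = 1 \<and> card D \<in> {2, 3, 4} \<or> card Z = 2 \<and> card D = 4"
proof -
  obtain y where y: "y \<in> C" "y \<notin> D" using DneC DC by blast
  obtain k where k: "card D = card Z * k" using Z_le(3) by (auto simp: dvd_def)
  have "k \<noteq> 0" "k \<noteq> 1" using Z_le(2,4) k by auto
  then have "k \<ge> 2" by linarith
  have b: "2 * (card Z * k) \<le> 7 + card Z" using two_cosets(1)[OF y] k by simp
  have "2 * (card Z * 2) \<le> 2 * (card Z * k)" using \<open>k \<ge> 2\<close> by (intro mult_le_mono) auto
  then have "card Z \<le> 2" using b by linarith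
  then consider "card Z = 1" | "card Z = 2" using Z_le(2) by linarith
  then show ?thesis
  proof cases
    case 1
    then have "card D \<le> 4" "card D \<ge> 2" using b k \<open>k \<ge> 2\<close> by simp_all
    then show ?thesis using 1 by auto
  next
    case 2
    then have "k = 2" using b \<open>k \<ge> 2\<close> by simp
    then show ?thesis using 2 k by simp
  qed
qed

private lemma card_D_not4: "card D \<noteq> 4"
proof
  assume d4: "card D = 4"
  then have z: "card Z = 1 \<or> card Z = 2" using card_D by auto
  then have big: "3 * card D > 7 + card Z" using d4 by auto
  obtain y where y: "y \<in> C" "y \<notin> D" using DneC DC by blast
  have E8: "card (E w) = 8" if "w \<in> C" "w \<notin> D" for w using E_eq(2)[OF that big] d4 by simp
  have "E y \<noteq> C"
  proof
    assume "E y = C"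
    then have "\<forall>c\<in>C. y \<otimes> c = c \<otimes> y" by (auto simp: E_def cen_iff)
    then have "y \<in> D" unfolding D_def using y(1) by blast
    then show False using y by simp
  qed
  then have "card (E y) < card C" using finC by (intro psubset_card_mono) (auto simp: E_def)
  moreover have "8 dvd card C" using sub_card_dvd[OF E_sub[OF y(1)] C_sub] E8[OF y] unfolding E_def by simp
  \<comment> \<open>\<open>y\<close> is not central in \<open>C\<close>, so its centralizer there,
    of order 8, is a proper subgroup.\<close>
  ultimately have n16: "card C \<ge> 16" using E8[OF y] by (auto simp: dvd_def)
  define W where "W = C - Z"
  have finW: "finite W" unfolding W_def using finC by blast
  have ZC: "Z \<subseteq> C" using ZD DC by blast
  have finZ: "finite Z" using ZC finC finite_subset by blast
  have cW: "card W = card C - card Z" unfolding W_def using finZ ZC by (rule card_Diff_subset)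
  have cDZ: "card (D - Z) = 4 - card Z" using card_Diff_subset[OF finZ ZD] d4 by simp
  have cCD: "card (C - D) = card C - 4" using card_Diff_subset[OF finD DC] d4 by simp
  have Wsplit: "W = (D - Z) \<union> (C - D)" "(D - Z) \<inter> (C - D) = {}" unfolding W_def using ZD DC by auto
  have "card (cpairs W W) = (\<Sum>h\<in>W. card {s \<in> W. h \<otimes> s = s \<otimes> h})" by (rule card_cpairs(1)[OF finW finW])
  also have "\<dots> = (\<Sum>h\<in>D - Z. card {s \<in> W. h \<otimes> s = s \<otimes> h}) + (\<Sum>h\<in>C - D. card {s \<in> W. h \<otimes> s = s \<otimes> h})"
    unfolding Wsplit(1) using finC finD Wsplit(2) by (intro sum.union_disjoint) auto
  also have "(\<Sum>h\<in>D - Z. card {s \<in> W. h \<otimes> s = s \<otimes> h}) = (\<Sum>h\<in>D - Z. card W)"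
  proof (rule sum.cong[OF refl])
    fix h assume "h \<in> D - Z"
    then have "{s \<in> W. h \<otimes> s = s \<otimes> h} = W" using D_comm unfolding W_def by auto
    then show "card {s \<in> W. h \<otimes> s = s \<otimes> h} = card W" by simp
  qed
  also have "(\<Sum>h\<in>C - D. card {s \<in> W. h \<otimes> s = s \<otimes> h}) = (\<Sum>h\<in>C - D. 8 - card Z)"
  proof (rule sum.cong[OF refl])
    fix h assume h: "h \<in> C - D"
    have "{s \<in> W. h \<otimes> s = s \<otimes> h} = E h - Z" using C_car by (auto simp: W_def E_def cen_iff)
    moreover have "Z \<subseteq> E h" using D_co_sub[of h] ZD h by blast
    ultimately show "card {s \<in> W. h \<otimes> s = s \<otimes> h} = 8 - card Z" using card_Diff_subset[OF finZ] E8[of h] h by simp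
  qed
  finally have "card (cpairs W W) = (4 - card Z) * (card C - card Z) + (card C - 4) * (8 - card Z)"
    using cDZ cCD cW by simp
  moreover have "card (cpairs W W) \<le> 7 * card W" using C_car unfolding W_def by (intro sparse) blast
  \<comment> \<open>Elements of \<open>D - Z\<close> commute with all of \<open>W\<close>, the
    others with \<open>8 - card Z\<close> members each. For \<open>card Z = 1\<close> this forces
    \<open>card C \<le> 8\<close>, for \<open>card Z = 2\<close> it forces
    \<open>card C \<le> 14\<close>.\<close>
  ultimately have le: "(4 - card Z) * (card C - card Z) + (card C - 4) * (8 - card Z) \<le> 7 * (card C - card Z)"
    using cW by simp
  from z show False
  proof
    assume "card Z = 1"
    then show False using le n16 by simp
  next
    assume "card Z = 2"
    then show False using le n16 by simp
  qed
qed

private lemma card_D_not3: "card D \<noteq> 3"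
proof
  assume d3: "card D = 3"
  then have big: "3 * card D > 7 + card Z" using card_D by auto
  have cube: "e = \<one>" if e: "e \<in> D" "e \<otimes> e = \<one>" for e
  proof -
    have ec: "e \<in> carrier G" using e(1) D_car by blast
    have "e [^] (3::nat) = \<one>" using pow_card[OF D_sub e(1)] d3 by simp
    moreover have "e [^] (3::nat) = e \<otimes> e \<otimes> e" using ec by (simp add: numeral_3_eq_3)
    ultimately show ?thesis using e(2) ec by simp
  qed
  have sq: "y \<otimes> y \<in> D" if y: "y \<in> C" for y
  proof (cases "y \<in> D")
    case True
    then show ?thesis using subgroup.m_closed[OF D_sub] by blast
  next
    case False
    have yc: "y \<in> carrier G" using y C_car by blast
    have "y \<otimes> y \<in> E y" using subgroup.m_closed[OF E_sub[OF y]] y yc cen_self unfolding E_def by blast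
    then consider "y \<otimes> y \<in> D" | d where "d \<in> D" "y \<otimes> y = y \<otimes> d" unfolding E_eq(1)[OF y False big] co_def by blast
    then show ?thesis
    proof cases
      case 2
      then have "y = d" using yc D_car by (metis Units_eq Units_l_cancel subsetD)
      then show ?thesis using 2 False by simp
    qed
  qed
  have "y \<otimes> w = w \<otimes> y" if yw: "y \<in> C" "w \<in> C" for y w
  proof -
    have ywC: "y \<otimes> w \<in> C" using subgroup.m_closed[OF C_sub] yw by blast
    have c [simp]: "y \<in> carrier G" "w \<in> carrier G" using yw C_car by auto
    define a b d where "a = y \<otimes> y" and "b = w \<otimes> w" and "d = (y \<otimes> w) \<otimes> (y \<otimes> w)"
    have D: "a \<in> D" "b \<in> D" "d \<in> D" using sq yw ywC unfolding a_def b_def d_def by auto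
    then have abc [simp]: "a \<in> carrier G" "b \<in> carrier G" "d \<in> carrier G" using D_car by auto
    have "y \<otimes> d \<otimes> w = a \<otimes> (w \<otimes> y) \<otimes> b" unfolding a_def b_def d_def by (simp add: m_assoc)
    moreover have "y \<otimes> d = d \<otimes> y" "(w \<otimes> y) \<otimes> b = b \<otimes> (w \<otimes> y)"
      using D_comm[OF D(3) yw(1)] D_comm[OF D(2) subgroup.m_closed[OF C_sub yw(2,1)]] by auto
    ultimately have "d \<otimes> (y \<otimes> w) = (a \<otimes> b) \<otimes> (w \<otimes> y)" by (simp add: m_assoc)
    \<comment> \<open>The commutator with
      \<open>w \<otimes> y = e \<otimes> (y \<otimes> w)\<close>. It is built from squares, so it
      lies in \<open>D\<close>.\<close>
    define e where "e = inv (a \<otimes> b) \<otimes> d"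
    have eD: "e \<in> D" unfolding e_def using D subgroup.m_closed[OF D_sub] subgroup.m_inv_closed[OF D_sub] by blast
    then have ec [simp]: "e \<in> carrier G" using D_car by blast
    have we: "w \<otimes> y = e \<otimes> (y \<otimes> w)"
      unfolding e_def using \<open>d \<otimes> (y \<otimes> w) = (a \<otimes> b) \<otimes> (w \<otimes> y)\<close> by (simp add: m_assoc inv_solve_left)
    have ye: "y \<otimes> e = e \<otimes> y" using D_comm[OF eD yw(1)] by simp
    \<comment> \<open>Moving \<open>w\<close> past \<open>y\<close> twice yields the factor
      \<open>e\<close> twice. As the square \<open>a\<close> is in \<open>D\<close>, it commutes
      with \<open>w\<close>, so \<open>e \<otimes> e = \<one>\<close>, which in a group of order 3
      leaves only \<open>e = \<one>\<close>.\<close>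
    have "w \<otimes> a = (w \<otimes> y) \<otimes> y" unfolding a_def by (simp only: m_assoc c)
    also have "\<dots> = e \<otimes> (y \<otimes> w) \<otimes> y" by (simp only: we)
    also have "\<dots> = e \<otimes> y \<otimes> (w \<otimes> y)" by (simp only: m_assoc c ec m_closed)
    also have "\<dots> = e \<otimes> y \<otimes> (e \<otimes> (y \<otimes> w))" by (simp only: we)
    also have "\<dots> = e \<otimes> (y \<otimes> e) \<otimes> (y \<otimes> w)" by (simp only: m_assoc c ec m_closed)
    also have "\<dots> = (e \<otimes> e) \<otimes> (a \<otimes> w)" unfolding ye a_def by (simp only: m_assoc c ec m_closed)
    also have "a \<otimes> w = w \<otimes> a" using D_comm[OF D(1) yw(2)] .
    finally have "\<one> \<otimes> (w \<otimes> a) = (e \<otimes> e) \<otimes> (w \<otimes> a)" by (simp only: l_one m_closed c abc)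
    then have "e \<otimes> e = \<one>" using right_cancel[of "w \<otimes> a" "\<one>" "e \<otimes> e"] by (simp only: m_closed c abc ec one_closed simp_thms)
    then have "e = \<one>" using cube eD by blast
    then show ?thesis using we by simp
  qed
  then show False using nab unfolding C_def comm_set_def by blast
qed

lemma bad_element:
  "Z = {\<one>}" "x \<otimes> x = \<one>" "y \<in> cen x \<Longrightarrow> (\<forall>c\<in>cen x. y \<otimes> c = c \<otimes> y) \<Longrightarrow> y \<in> {\<one>, x}"
proof -
  have zd: "card Z = 1" "card D = 2" using card_D card_D_not3 card_D_not4 by auto
  show Z1: "Z = {\<one>}" using zd(1) subgroup.one_closed[OF Z_sub] by (metis card_1_singletonE singletonD)
  obtain t where t: "D = {\<one>, t}" "t \<otimes> t = \<one>" using sub_two[OF D_sub zd(2)] by metis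
  then have "x = t" using x_D x(2) Z1 by auto
  then show "x \<otimes> x = \<one>" using t by simp
  show "y \<in> {\<one>, x}" if "y \<in> cen x" "\<forall>c\<in>cen x. y \<otimes> c = c \<otimes> y"
    using that t \<open>x = t\<close> unfolding D_def C_def by blast
qed

end

end

section \<open>Abelian subgroups in the presence of a nonabelian centralizer\<close>

locale bad_group = toroidal_group +
  fixes t0 assumes t0: "t0 \<in> carrier G" "t0 \<notin> group_centre G" "\<not> comm_set (cen t0)"
begin

lemma Z1: "Z = {\<one>}" by (rule bad_element(1)[OF t0])

lemma t0_ne: "t0 \<noteq> \<one>" using t0(2) Z1 by auto

lemma bad: assumes "x \<in> carrier G" "x \<noteq> \<one>" "\<not> comm_set (cen x)"
  shows "x \<otimes> x = \<one>" "y \<in> cen x \<Longrightarrow> (\<forall>c\<in>cen x. y \<otimes> c = c \<otimes> y) \<Longrightarrow> y \<in> {\<one>, x}"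
  using bad_element(2,3)[OF assms(1) _ assms(3)] assms(2) Z1 by auto

lemma disjoint_cliques: assumes "S \<subseteq> carrier G - {\<one>}" "T \<subseteq> carrier G - {\<one>}" "comm_set S" "comm_set T" "card S \<ge> 5" "card T \<ge> 5"
  shows "S \<inter> T \<noteq> {}"
  using no_two_K5[of S T] assms Z1 by simp

lemma comm_set_sub: "comm_set S \<Longrightarrow> T \<subseteq> S \<Longrightarrow> comm_set T" unfolding comm_set_def by blast

lemma comm_card8: assumes "S \<subseteq> carrier G" "comm_set S" shows "card S \<le> 8"
proof -
  have "card (S - {\<one>}) \<le> 7" using assms comm_set_sub[OF assms(2), of "S - {\<one>}"] Z1 by (intro comm_set_card) auto
  then show ?thesis by (cases "\<one> \<in> S") (simp_all add: card_Diff_singleton)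
qed

lemma no_fixed_noncentral: assumes "x \<in> carrier G" "\<And>g. g \<in> carrier G \<Longrightarrow> cj g x = x" shows "x = \<one>"
proof -
  have "x \<in> Z" unfolding group_centre_def using assms cj_fix by auto
  then show ?thesis using Z1 by simp
qed

lemma even_sub: assumes "subgroup H G" "t \<in> H" "t \<otimes> t = \<one>" "t \<noteq> \<one>" shows "2 dvd card H"
proof -
  have "t \<in> carrier G" using assms subgroup.subset by blast
  then have "card {\<one>, t} dvd card H" using assms subgroup.one_closed[OF assms(1)] by (intro sub_card_dvd sub_pair) auto
  moreover have "card {\<one>, t} = 2" using assms(4) by auto
  ultimately show ?thesis by (simp only:)
qed

lemma cen_comm_if: assumes "x \<in> carrier G" "x \<otimes> x \<noteq> \<one>" shows "comm_set (cen x)"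
  using bad(1)[OF assms(1)] assms by (cases "x = \<one>") auto

lemma sub_eq: assumes "subgroup H G" "subgroup K G" "H \<subseteq> K" "card K \<le> card H" shows "H = K"
  using assms sub_fin card_seteq by metis

text \<open>Such a subgroup \<open>A\<close> is normal, because conjugates would give disjoint cliques. The centralizer of \<open>t0\<close> acts freely on
  the 6 nontrivial elements of \<open>A\<close>.\<close>

lemma no_abelian_7: assumes A: "subgroup A G" "comm_set A" "card A = 7" shows False
proof -
  have Ac: "A \<subseteq> carrier G" by (rule subgroup.subset[OF A(1)])
  have oneA: "\<one> \<in> A" by (rule subgroup.one_closed[OF A(1)])
  have p7: "prime (7::nat)" by simp
  have normal: "cj g ` A = A" if g: "g \<in> carrier G" for g
  proof (rule ccontr)
    assume ne: "cj g ` A \<noteq> A"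
    define B where "B = cj g ` A"
    have B: "subgroup B G" "comm_set B" "card B = 7" "B \<subseteq> carrier G"
      unfolding B_def using cj_subgroup[OF g A(1)] cj_commuting[OF g Ac A(2)] cj_card[OF g Ac] A(3) g Ac by auto
    have "A \<inter> B = {\<one>}"
    proof (rule ccontr)
      assume "A \<inter> B \<noteq> {\<one>}"
      then obtain h where h: "h \<in> A" "h \<in> B" "h \<noteq> \<one>" using oneA subgroup.one_closed[OF B(1)] by blast
      then have "A \<subseteq> B" using prime_sub_gen[OF p7 A(1,3) B(1)] by blast
      then have "A = B" using sub_eq[OF A(1) B(1)] A(3) B(3) by simp
      then show False using ne B_def by simp
    qed
    moreover have "card (A - {\<one>}) = 6" "card (B - {\<one>}) = 6"
      using A(3) B(3) oneA subgroup.one_closed[OF B(1)] by (simp_all add: card_Diff_singleton)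
    moreover have "(A - {\<one>}) \<inter> (B - {\<one>}) \<noteq> {}"
      using calculation(2,3) A(2) B(2,4) Ac by (intro disjoint_cliques) (auto intro: comm_set_sub)
    ultimately show False by blast
  qed
  have notinv: "a \<otimes> a \<noteq> \<one>" if "a \<in> A" "a \<noteq> \<one>" for a using even_sub[OF A(1) that(1) _ that(2)] A(3) by auto
  \<comment> \<open>A nontrivial \<open>a\<close> in \<open>A\<close> is no involution, so its
    centralizer is abelian of order at most 8, and 7 divides this order.\<close>
  have cenA: "cen a = A" if a: "a \<in> A" "a \<noteq> \<one>" for a
  proof -
    have ac: "a \<in> carrier G" using a Ac by blast
    have sub: "A \<subseteq> cen a" using A(2) a Ac unfolding comm_set_def cen_def by auto
    have "card (cen a) \<le> 8" using cen_comm_if[OF ac notinv[OF a]] by (intro comm_card8) (auto simp: cen_def)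
    moreover have "7 dvd card (cen a)" using sub_card_dvd[OF A(1) cen_subgroup[OF ac] sub] A(3) by simp
    ultimately have "card (cen a) \<le> 7" by (auto simp: dvd_def)
    then show ?thesis using sub_eq[OF A(1) cen_subgroup[OF ac] sub] A(3) by simp
  qed
  have tt: "t0 \<otimes> t0 = \<one>" using bad(1)[OF t0(1) t0_ne t0(3)] .
  have tA: "t0 \<notin> A" using notinv t0_ne tt by blast
  define C where "C = cen t0"
  have C: "subgroup C G" unfolding C_def by (rule cen_subgroup[OF t0(1)])
  have Cc: "C \<subseteq> carrier G" by (rule subgroup.subset[OF C])
  have "card C dvd card (cpairs C (A - {\<one>}))"
  proof (rule burnside_commuting[OF C])
    show "cj h s \<in> A - {\<one>}" if "h \<in> C" "s \<in> A - {\<one>}" for h s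
    proof -
      have hc: "h \<in> carrier G" "s \<in> carrier G" using that Cc Ac by auto
      have "cj h s \<in> A" using normal[OF hc(1)] that(2) by blast
      moreover have "cj h s \<noteq> \<one>" using cj_inject[OF hc(1) hc(2) one_closed] hc(1) that(2) by simp
      ultimately show ?thesis by blast
    qed
  qed (use Ac in auto)
  moreover have "cpairs C (A - {\<one>}) = {\<one>} \<times> (A - {\<one>})"
  proof -
    have "h = \<one>" if "h \<in> C" "s \<in> A" "s \<noteq> \<one>" "h \<otimes> s = s \<otimes> h" for h s
    proof (rule ccontr)
      assume h1: "h \<noteq> \<one>"
      have "h \<in> cen s" using that Cc by (auto simp: cen_iff)
      then have "cen h = A" using cenA that h1 by auto
      moreover have "t0 \<in> cen h" using that(1) t0(1) unfolding C_def by (auto simp: cen_iff)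
      ultimately show False using tA by simp
    qed
    moreover have "\<one> \<in> C" by (rule subgroup.one_closed[OF C])
    ultimately show ?thesis unfolding cpairs_def using Ac by auto
  qed
  ultimately have C6: "card C dvd 6" using A(3) oneA by (simp add: card_cartesian_product card_Diff_singleton)
  have "C \<noteq> {\<one>, t0}" using t0 unfolding C_def comm_set_def by auto
  then obtain y where y: "y \<in> C" "y \<noteq> \<one>" "y \<noteq> t0"
    using subgroup.one_closed[OF C] cen_self[OF t0(1)] unfolding C_def by blast
  have yc: "y \<in> carrier G" using y Cc by blast
  have E: "subgroup (C \<inter> cen y) G" using C cen_subgroup[OF yc] subgroups_Inter_pair by blast
  have tE: "t0 \<in> C \<inter> cen y" "y \<in> C \<inter> cen y" using cen_self[OF t0(1)] cen_self[OF yc] cen_sym[OF t0(1)] y(1) unfolding C_def by auto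
  have "2 dvd card (C \<inter> cen y)" using even_sub[OF E tE(1) tt t0_ne] .
  moreover have "card {\<one>, t0, y} \<le> card (C \<inter> cen y)" using tE subgroup.one_closed[OF E] sub_fin[OF E] by (intro card_mono) auto
  then have "3 \<le> card (C \<inter> cen y)" using y t0_ne by simp
  moreover have d: "card (C \<inter> cen y) dvd card C" by (rule sub_card_dvd[OF E C]) auto
  \<comment> \<open>The order is even, at least 3, and divides 6. So \<open>y\<close> will commute
    with all of \<open>C\<close>, whereas only \<open>\<one>\<close> and \<open>t0\<close> are
    central there.\<close>
  ultimately have "card (C \<inter> cen y) = 6"
  proof -
    assume e: "2 dvd card (C \<inter> cen y)" and g: "3 \<le> card (C \<inter> cen y)"
    have d6: "card (C \<inter> cen y) dvd 6" using d C6 by (rule dvd_trans)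
    then have "card (C \<inter> cen y) \<le> 6" by (rule dvd_imp_le) simp
    then have "card (C \<inter> cen y) \<in> {3, 4, 5, 6}" using g by auto
    then show ?thesis using e d6 by auto
  qed
  moreover have "card C \<le> 6" using C6 by (rule dvd_imp_le) simp
  ultimately have "C \<inter> cen y = C" using sub_eq[OF E C] by auto
  then have "y \<in> {\<one>, t0}" using y(1) unfolding C_def by (intro bad(2)[OF t0(1) t0_ne t0(3)]) (auto simp: cen_iff)
  then show False using y by simp
qed

text \<open>The conjugates of such a subgroup \<open>A\<close> meet \<open>A\<close> nontrivially, so every element normalizes its subgroup of order 2 or the
  one of order 3. As a group is not the union of two proper subgroups, one of them is normal.\<close>

lemma no_abelian_6: assumes A: "subgroup A G" "comm_set A" "card A = 6" shows False
proof -
  have Ac: "A \<subseteq> carrier G" by (rule subgroup.subset[OF A(1)])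
  have oneA: "\<one> \<in> A" by (rule subgroup.one_closed[OF A(1)])
  have comm: "a \<otimes> b = b \<otimes> a" if "a \<in> A" "b \<in> A" for a b using A(2) that unfolding comm_set_def by blast
  obtain P where P: "subgroup P G" "P \<subseteq> A" "card P = 2" using cauchy[of 2 A] A by auto
  obtain u where u: "P = {\<one>, u}" "u \<noteq> \<one>" "u \<in> carrier G" "u \<otimes> u = \<one>" using sub_two[OF P(1,3)] by metis
  have uA: "u \<in> A" using u P by auto
  obtain Q where Q: "subgroup Q G" "Q \<subseteq> A" "card Q = 3" using cauchy[of 3 A] A by auto
  \<comment> \<open>The kernels of squaring and cubing on \<open>A\<close>. They serve to show that
    \<open>A\<close> has only one involution and only one subgroup of order 3.\<close>
  define P2 where "P2 = {a \<in> A. a \<otimes> a = \<one>}"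
  define Q3 where "Q3 = {a \<in> A. a \<otimes> a \<otimes> a = \<one>}"
  have P2: "subgroup P2 G"
  proof (rule subgroupI)
    show "P2 \<noteq> {}" using oneA unfolding P2_def by auto
    show "inv a \<in> P2" if "a \<in> P2" for a
    proof -
      have "a \<in> carrier G" "a \<otimes> a = \<one>" "a \<in> A" using that Ac unfolding P2_def by auto
      then have "inv a = a" by (simp add: inv_equality)
      then show ?thesis using that by simp
    qed
    show "a \<otimes> b \<in> P2" if "a \<in> P2" "b \<in> P2" for a b
    proof -
      have ab: "a \<in> carrier G" "b \<in> carrier G" "a \<otimes> a = \<one>" "b \<otimes> b = \<one>" "a \<in> A" "b \<in> A" using that Ac unfolding P2_def by auto
      have "(a \<otimes> b) \<otimes> (a \<otimes> b) = a \<otimes> (b \<otimes> a) \<otimes> b" using ab(1,2) by (simp only: m_assoc m_closed)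
      also have "\<dots> = (a \<otimes> a) \<otimes> (b \<otimes> b)" unfolding comm[OF ab(6,5)] using ab(1,2) by (simp only: m_assoc m_closed)
      finally show ?thesis unfolding P2_def using ab subgroup.m_closed[OF A(1)] by simp
    qed
  qed (use Ac in \<open>auto simp: P2_def\<close>)
  have Q3: "subgroup Q3 G"
  proof (rule subgroupI)
    show "Q3 \<noteq> {}" using oneA unfolding Q3_def by auto
    show "inv a \<in> Q3" if "a \<in> Q3" for a
    proof -
      have a: "a \<in> carrier G" "a \<otimes> a \<otimes> a = \<one>" "a \<in> A" using that Ac unfolding Q3_def by auto
      have "inv a \<otimes> inv a \<otimes> inv a = inv (a \<otimes> a \<otimes> a)" using a(1) by (simp add: inv_mult_group m_assoc)
      then show ?thesis unfolding Q3_def using a subgroup.m_inv_closed[OF A(1)] by simp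
    qed
    show "a \<otimes> b \<in> Q3" if "a \<in> Q3" "b \<in> Q3" for a b
    proof -
      have ab: "a \<in> carrier G" "b \<in> carrier G" "a \<otimes> a \<otimes> a = \<one>" "b \<otimes> b \<otimes> b = \<one>" "a \<in> A" "b \<in> A" using that Ac unfolding Q3_def by auto
      have abb: "a \<otimes> b \<in> A" using ab subgroup.m_closed[OF A(1)] by blast
      have "(a \<otimes> b) \<otimes> (a \<otimes> b) = a \<otimes> (b \<otimes> a) \<otimes> b" using ab(1,2) by (simp only: m_assoc m_closed)
      also have "\<dots> = (a \<otimes> a) \<otimes> (b \<otimes> b)" unfolding comm[OF ab(6,5)] using ab(1,2) by (simp only: m_assoc m_closed)
      finally have sq: "(a \<otimes> b) \<otimes> (a \<otimes> b) = (a \<otimes> a) \<otimes> (b \<otimes> b)" .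
      have bb: "b \<otimes> b \<in> A" using ab subgroup.m_closed[OF A(1)] by blast
      have "(a \<otimes> b) \<otimes> (a \<otimes> b) \<otimes> (a \<otimes> b) = (a \<otimes> a) \<otimes> ((b \<otimes> b) \<otimes> a) \<otimes> b" unfolding sq using ab(1,2) by (simp only: m_assoc m_closed)
      also have "\<dots> = (a \<otimes> a \<otimes> a) \<otimes> (b \<otimes> b \<otimes> b)" unfolding comm[OF bb ab(5)] using ab(1,2) by (simp only: m_assoc m_closed)
      finally show ?thesis unfolding Q3_def using ab abb by simp
    qed
  qed (use Ac in \<open>auto simp: Q3_def\<close>)
  have QQ3: "R = Q3" if R: "subgroup R G" "R \<subseteq> A" "card R = 3" for R
  proof -
    have sub: "S \<subseteq> Q3" if S: "subgroup S G" "S \<subseteq> A" "card S = 3" for S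
    proof
      fix s assume s: "s \<in> S"
      then have sc: "s \<in> carrier G" using S Ac by blast
      have "s [^] (3::nat) = \<one>" using pow_card[OF S(1) s] S(3) by simp
      then have "s \<otimes> s \<otimes> s = \<one>" using sc by (simp add: numeral_3_eq_3)
      then show "s \<in> Q3" using s S unfolding Q3_def by auto
    qed
    have "3 dvd card Q3" using sub_card_dvd[OF R(1) Q3 sub[OF R]] R(3) by simp
    moreover have "Q3 \<subseteq> A" unfolding Q3_def by auto
    then have "card Q3 dvd 6" using sub_card_dvd[OF Q3 A(1)] A(3) by simp
    moreover have "card Q3 \<noteq> 6"
    proof
      assume "card Q3 = 6"
      then have "Q3 = A" using sub_eq[OF Q3 A(1) \<open>Q3 \<subseteq> A\<close>] A(3) by simp
      then have "u \<otimes> u \<otimes> u = \<one>" using uA unfolding Q3_def by auto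
      then show False using u by simp
    qed
    ultimately have "card Q3 \<le> 3"
    proof -
      assume a: "3 dvd card Q3" "card Q3 dvd 6" "card Q3 \<noteq> 6"
      then have "card Q3 \<le> 6" by (intro dvd_imp_le) auto
      then have "card Q3 \<in> {0, 1, 2, 3, 4, 5}" using a(3) by auto
      then show ?thesis using a(1) by auto
    qed
    then show ?thesis using sub_eq[OF R(1) Q3 sub[OF R]] R(3) by simp
  qed
  have cQ3: "card Q3 = 3" using QQ3[OF Q] Q(3) by simp
  have Q3A: "Q3 \<subseteq> A" unfolding Q3_def by auto
  have Q3c: "Q3 \<subseteq> carrier G" using Q3A Ac by blast
  have uniq: "v = u" if v: "v \<in> A" "v \<otimes> v = \<one>" "v \<noteq> \<one>" for v
  proof (rule ccontr)
    assume "v \<noteq> u"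
    have "card {\<one>, u, v} \<le> card P2" using v u uA oneA sub_fin[OF P2] by (intro card_mono) (auto simp: P2_def)
    then have "3 \<le> card P2" using v(3) u(2) \<open>v \<noteq> u\<close> by simp
    moreover have "P2 \<subseteq> A" unfolding P2_def by auto
    moreover have "card P2 dvd 6" using sub_card_dvd[OF P2 A(1) \<open>P2 \<subseteq> A\<close>] A(3) by simp
    moreover have "2 dvd card P2" using even_sub[OF P2 _ v(2,3)] v unfolding P2_def by auto
    ultimately have "card P2 = 6"
    proof -
      assume a: "3 \<le> card P2" "card P2 dvd 6" "2 dvd card P2"
      then have "card P2 \<le> 6" by (intro dvd_imp_le) auto
      then have "card P2 \<in> {3, 4, 5, 6}" using a(1) by auto
      then show ?thesis using a(2,3) by auto
    qed
    then have "P2 = A" using sub_eq[OF P2 A(1) \<open>P2 \<subseteq> A\<close>] A(3) by simp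
    have "Q3 \<noteq> {\<one>}" using cQ3 by auto
    then obtain s where s: "s \<in> Q3" "s \<noteq> \<one>" using subgroup.one_closed[OF Q3] by blast
    then have "s \<otimes> s = \<one>" using \<open>P2 = A\<close> Q3A unfolding P2_def by blast
    then show False using even_sub[OF Q3 s(1) _ s(2)] cQ3 by simp
  qed
  have dich: "cj g u = u \<or> cj g ` Q3 = Q3" if g: "g \<in> carrier G" for g
  proof -
    define B where "B = cj g ` A"
    have B: "subgroup B G" "comm_set B" "card B = 6" "B \<subseteq> carrier G"
      unfolding B_def using cj_subgroup[OF g A(1)] cj_commuting[OF g Ac A(2)] cj_card[OF g Ac] A(3) g Ac by auto
    have c5: "card (A - {\<one>}) = 5" "card (B - {\<one>}) = 5"
      using A(3) B(3) oneA subgroup.one_closed[OF B(1)] by (simp_all add: card_Diff_singleton)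
    have "(A - {\<one>}) \<inter> (B - {\<one>}) \<noteq> {}"
      using c5 A(2) B(2,4) Ac by (intro disjoint_cliques) (auto intro: comm_set_sub)
    then obtain m where m: "m \<in> A \<inter> B" "m \<noteq> \<one>" by blast
    have M: "subgroup (A \<inter> B) G" using A(1) B(1) subgroups_Inter_pair by blast
    have "card (A \<inter> B) dvd 6" using sub_card_dvd[OF M A(1)] A(3) by auto
    moreover have "card (A \<inter> B) \<noteq> 1" using m subgroup.one_closed[OF M] by (metis card_1_singletonE singletonD)
    ultimately have "2 dvd card (A \<inter> B) \<or> 3 dvd card (A \<inter> B)"
    proof -
      assume a: "card (A \<inter> B) dvd 6" "card (A \<inter> B) \<noteq> 1"
      then have "card (A \<inter> B) \<le> 6" by (intro dvd_imp_le) auto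
      then have "card (A \<inter> B) \<in> {0, 2, 3, 4, 5, 6}" using a(2) by auto
      then show ?thesis using a(1) by auto
    qed
    then show ?thesis
    proof
      assume "2 dvd card (A \<inter> B)"
      then obtain P' where P': "subgroup P' G" "P' \<subseteq> A \<inter> B" "card P' = 2" using cauchy[OF _ M, of 2] by auto
      obtain v where v: "P' = {\<one>, v}" "v \<noteq> \<one>" "v \<in> carrier G" "v \<otimes> v = \<one>" using sub_two[OF P'(1,3)] by metis
      have "v = u" using uniq v P' by auto
      moreover obtain w where w: "w \<in> A" "v = cj g w" using v P' unfolding B_def by auto
      have wc: "w \<in> carrier G" using w Ac by blast
      have "cj g (w \<otimes> w) = cj g \<one>" using v(4) w(2) cj_mult[OF g wc wc] g by simp
      then have "w \<otimes> w = \<one>" using cj_inject[OF g] wc by (metis m_closed one_closed)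
      moreover have "w \<noteq> \<one>" using v(2) w(2) g by auto
      ultimately have "w = u" using uniq w by blast
      then show ?thesis using w(2) \<open>v = u\<close> by simp
    next
      assume "3 dvd card (A \<inter> B)"
      then obtain R where R: "subgroup R G" "R \<subseteq> A \<inter> B" "card R = 3" using cauchy[OF _ M, of 3] by auto
      have R1: "R = Q3" using QQ3 R by simp
      have gi: "inv g \<in> carrier G" using g by simp
      have Rc: "R \<subseteq> carrier G" by (rule subgroup.subset[OF R(1)])
      have "cj (inv g) ` R \<subseteq> A"
      proof
        fix z assume "z \<in> cj (inv g) ` R"
        then obtain w where w: "w \<in> A" "z = cj (inv g) (cj g w)" using R(2) unfolding B_def by auto
        then have "z = w" using g Ac by auto
        then show "z \<in> A" using w by simp
      qed
      then have "cj (inv g) ` R = Q3" using QQ3[of "cj (inv g) ` R"] cj_subgroup[OF gi R(1)] cj_card[OF gi Rc] R(3) by simp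
      then have "cj g ` (cj (inv g) ` R) = cj g ` Q3" by simp
      moreover have "cj g ` (cj (inv g) ` R) = R"
      proof -
        have "cj g ` (cj (inv g) ` R) = (\<lambda>z. z) ` R" unfolding image_image using g Rc by (intro image_cong refl) auto
        then show ?thesis by simp
      qed
      ultimately show ?thesis using R1 by simp
    qed
  qed
  obtain g0 where g0: "g0 \<in> carrier G" "cj g0 u \<noteq> u" using no_fixed_noncentral[OF u(3)] u(2) by blast
  \<comment> \<open>\<open>g0\<close> moves \<open>u\<close>, so it normalizes \<open>Q3\<close>. If
    \<open>g\<close> did not, it would fix \<open>u\<close>; then \<open>g \<otimes> g0\<close>
    would move \<open>u\<close> and hence normalize \<open>Q3\<close>, and so would
    \<open>g\<close>.\<close>
  have Q3norm: "cj g ` Q3 = Q3" if g: "g \<in> carrier G" for g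
  proof (rule ccontr)
    assume n: "cj g ` Q3 \<noteq> Q3"
    then have gu: "cj g u = u" using dich[OF g] by blast
    have gg: "g \<otimes> g0 \<in> carrier G" using g g0 by simp
    have "cj (g \<otimes> g0) u \<noteq> u"
    proof
      assume "cj (g \<otimes> g0) u = u"
      then have "cj g (cj g0 u) = cj g u" using cj_cj[OF g g0(1) u(3)] gu by simp
      then show False using cj_inject[OF g] g0 u(3) by simp
    qed
    then have 1: "cj (g \<otimes> g0) ` Q3 = Q3" using dich[OF gg] by blast
    have 2: "cj g0 ` Q3 = Q3" using dich[OF g0(1)] g0(2) by blast
    have "cj (g \<otimes> g0) ` Q3 = cj g ` (cj g0 ` Q3)" unfolding image_image
      using cj_cj[OF g g0(1)] Q3c by (intro image_cong refl) auto
    then show False using 1 2 n by simp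
  qed
  have cenQ: "cen s = A" if s: "s \<in> Q3" "s \<noteq> \<one>" for s
  proof -
    have sc: "s \<in> carrier G" using s Q3c by blast
    have "s \<otimes> s \<noteq> \<one>" using even_sub[OF Q3 s(1) _ s(2)] cQ3 by auto
    then have "card (cen s) \<le> 8" using cen_comm_if[OF sc] by (intro comm_card8) (auto simp: cen_def)
    moreover have sub: "A \<subseteq> cen s"
    proof
      fix a assume a: "a \<in> A"
      have "s \<in> A" using s(1) Q3A by blast
      then show "a \<in> cen s" using comm[OF _ a] a Ac unfolding cen_def by blast
    qed
    moreover have "6 dvd card (cen s)" using sub_card_dvd[OF A(1) cen_subgroup[OF sc] sub] A(3) by simp
    ultimately have "card (cen s) \<le> 6" by (auto simp: dvd_def)
    then show ?thesis using sub_eq[OF A(1) cen_subgroup[OF sc] sub] A(3) by simp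
  qed
  have "Q3 \<noteq> {\<one>}" using cQ3 by auto
  then obtain s where s: "s \<in> Q3" "s \<noteq> \<one>" using subgroup.one_closed[OF Q3] by blast
  have sc: "s \<in> carrier G" using s Q3c by blast
  \<comment> \<open>All nontrivial elements of the normal subgroup \<open>Q3\<close> have
    centralizer \<open>A\<close>, so \<open>A\<close> is normal; then its only involution
    \<open>u\<close> is central, against the trivial centre.\<close>
  have "cj g u = u" if g: "g \<in> carrier G" for g
  proof -
    have "cj g s \<in> Q3" using Q3norm[OF g] s(1) by blast
    moreover have "cj g s \<noteq> \<one>" using cj_inject[OF g sc one_closed] g s(2) by simp
    ultimately have "cen (cj g s) = A" by (rule cenQ)
    then have "cj g ` A = A" using cj_cen[OF g sc] cenQ[OF s] by simp
    then have "cj g u \<in> A" using uA by blast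
    moreover have "cj g u \<otimes> cj g u = \<one>" using cj_mult[OF g u(3) u(3)] u(4) g by simp
    moreover have "cj g u \<noteq> \<one>" using cj_inject[OF g u(3) one_closed] g u(2) by simp
    ultimately show ?thesis by (rule uniq)
  qed
  then show False using no_fixed_noncentral[OF u(3)] u(2) by blast
qed

section \<open>Elements sorted by the order of their centralizers\<close>

text \<open>\<open>|S c|\<close> is a multiple of \<open>|G| / c\<close>, since \<open>S c\<close> is a union of conjugacy classes of that size.\<close>

definition "S c = {g \<in> carrier G - {\<one>}. card (cen g) = c}"

lemma finS: "finite (S c)" unfolding S_def using fin by simp

lemma card_carrier_cj: assumes "g \<in> carrier G" "x \<in> carrier G" shows "card (cen (cj g x)) = card (cen x)"
  using cj_cen[OF assms] cj_card[OF assms(1), of "cen x"] by (simp add: cen_def)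

lemma S_cj: assumes "g \<in> carrier G" "s \<in> S c" shows "cj g s \<in> S c"
proof -
  have sc: "s \<in> carrier G" "s \<noteq> \<one>" using assms unfolding S_def by auto
  then have "cj g s \<noteq> \<one>" using cj_inject[OF assms(1) sc(1) one_closed] assms(1) by simp
  then show ?thesis using assms sc card_carrier_cj unfolding S_def by auto
qed

lemma class_dvd: "card (carrier G) dvd c * card (S c)"
proof -
  have G: "subgroup (carrier G) G" by (rule subgroup_self)
  have sub: "S c \<subseteq> carrier G" unfolding S_def by auto
  have "card (carrier G) dvd card (cpairs (carrier G) (S c))"
    by (rule burnside_commuting[OF G sub S_cj])
  also have "card (cpairs (carrier G) (S c)) = (\<Sum>s\<in>S c. card {h \<in> carrier G. h \<otimes> s = s \<otimes> h})"
    by (rule card_cpairs(2)[OF fin finS])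
  also have "\<dots> = (\<Sum>s\<in>S c. c)"
  proof (rule sum.cong[OF refl])
    fix s assume "s \<in> S c"
    moreover have "{h \<in> carrier G. h \<otimes> s = s \<otimes> h} = cen s" unfolding cen_def by auto
    ultimately show "card {h \<in> carrier G. h \<otimes> s = s \<otimes> h} = c" unfolding S_def by simp
  qed
  finally show ?thesis by (simp add: mult.commute)
qed

text \<open>The number of nontrivial elements is odd, so some \<open>S c\<close> has odd size. This
  size is a multiple of \<open>n / c\<close>, which is therefore odd too, and different from 1
  because only the identity is central.\<close>

lemma odd_prime_divisor: assumes "even (card (carrier G))"
  obtains p where "prime p" "odd p" "p dvd card (carrier G)"
proof -
  define n where "n = card (carrier G)"
  define K where "K = (\<lambda>g. card (cen g)) ` (carrier G - {\<one>})"
  have n0: "n > 0" unfolding n_def using fin by (simp add: card_gt_0_iff) blast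
  have "carrier G - {\<one>} = (\<Union>c\<in>K. S c)" unfolding K_def S_def by auto
  moreover have "card (\<Union>c\<in>K. S c) = (\<Sum>c\<in>K. card (S c))"
  proof (rule card_UN_disjoint)
    show "finite K" unfolding K_def using fin by simp
    show "\<forall>c\<in>K. \<forall>d\<in>K. c \<noteq> d \<longrightarrow> S c \<inter> S d = {}" unfolding S_def by auto
  qed (use finS in blast)
  ultimately have "card (carrier G - {\<one>}) = (\<Sum>c\<in>K. card (S c))" by metis
  moreover have "card (carrier G - {\<one>}) = n - 1" unfolding n_def by (simp add: card_Diff_singleton)
  moreover have "odd (n - 1)" using assms n0 unfolding n_def[symmetric] by presburger
  ultimately have "odd (\<Sum>c\<in>K. card (S c))" by simp
  then have "\<exists>c\<in>K. odd (card (S c))" using dvd_sum[of K 2 "\<lambda>c. card (S c)"] by blast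
  then obtain c where c: "odd (card (S c))" by blast
  then have "S c \<noteq> {}" by auto
  then obtain g where g: "g \<in> carrier G" "g \<noteq> \<one>" "card (cen g) = c" unfolding S_def by auto
  have "c dvd n" using sub_card_dvd[OF cen_subgroup[OF g(1)] subgroup_self] g(3) unfolding n_def by (auto simp: cen_def)
  then obtain m where m: "n = c * m" by (auto simp: dvd_def)
  have "m \<noteq> 1"
  proof
    assume "m = 1"
    then have "card (carrier G) \<le> card (cen g)" using m g(3) unfolding n_def by simp
    then have "cen g = carrier G" using fin by (intro card_seteq) (auto simp: cen_def)
    then have "cj h g = g" if h: "h \<in> carrier G" for h
    proof -
      have "h \<in> cen g" using h \<open>cen g = carrier G\<close> by blast
      then show ?thesis using cj_fix[OF h g(1)] by (simp add: cen_iff)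
    qed
    then show False using no_fixed_noncentral[OF g(1)] g(2) by blast
  qed
  have "c * m dvd c * card (S c)" using class_dvd[of c] m unfolding n_def by simp
  then have "m dvd card (S c)" using n0 m by (simp add: dvd_mult_cancel_left) 
  then have "odd m" using c dvd_trans by blast
  obtain p where p: "prime p" "p dvd m" using prime_factor_nat[OF \<open>m \<noteq> 1\<close>] by blast
  have "odd p" using p(2) \<open>odd m\<close> dvd_trans by blast
  moreover have "p dvd card (carrier G)" using p(2) m unfolding n_def by simp
  ultimately show ?thesis using that p(1) by blast
qed

text \<open>Such a subgroup \<open>A\<close> is normal, as two subgroups of this kind carry disjoint cliques or too many edges. An element of odd
  prime order acts on the 7 nontrivial elements of \<open>A\<close>; so it has order 7, or it has a fixed point and generates with it
  an abelian subgroup of order 6.\<close>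

lemma no_abelian_8: assumes A: "subgroup A G" "comm_set A" "card A = 8" shows False
proof -
  have Ac: "A \<subseteq> carrier G" by (rule subgroup.subset[OF A(1)])
  have oneA: "\<one> \<in> A" by (rule subgroup.one_closed[OF A(1)])
  have finA: "finite A" by (rule sub_fin[OF A(1)])
  have normal: "cj g ` A = A" if g: "g \<in> carrier G" for g
  proof (rule ccontr)
    assume ne: "cj g ` A \<noteq> A"
    define B where "B = cj g ` A"
    have B: "subgroup B G" "comm_set B" "card B = 8" "B \<subseteq> carrier G"
      unfolding B_def using cj_subgroup[OF g A(1)] cj_commuting[OF g Ac A(2)] cj_card[OF g Ac] A(3) g Ac by auto
    have oneB: "\<one> \<in> B" by (rule subgroup.one_closed[OF B(1)])
    have finB: "finite B" by (rule sub_fin[OF B(1)])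
    have M: "subgroup (A \<inter> B) G" using A(1) B(1) subgroups_Inter_pair by blast
    have d8: "card (A \<inter> B) dvd 8" using sub_card_dvd[OF M A(1)] A(3) by auto
    have "card (A \<inter> B) \<noteq> 8"
    proof
      assume "card (A \<inter> B) = 8"
      then have "A \<inter> B = A" "A \<inter> B = B" using sub_eq[OF M A(1)] sub_eq[OF M B(1)] A(3) B(3) by auto
      then show False using ne B_def by auto
    qed
    moreover have "card (A \<inter> B) \<le> 8" using d8 by (rule dvd_imp_le) simp
    ultimately have "card (A \<inter> B) \<in> {0,1,2,3,4,5,6,7}" by auto
    then have cM: "card (A \<inter> B) \<in> {1, 2, 4}" using d8 by auto
    have cB: "card (B - A) = 8 - card (A \<inter> B)" using card_Diff_subset_Int[of B A] finA finB B(3) by (simp add: Int_commute)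
    have cA1: "card (A - {\<one>}) = 7" "card (B - {\<one>}) = 7" using A(3) B(3) oneA oneB by (simp_all add: card_Diff_singleton)
    show False
    proof (cases "card (A \<inter> B) = 4")
      case False
      then have "card (B - A) \<ge> 5" using cB cM by auto
      moreover have "A - {\<one>} \<subseteq> carrier G - {\<one>}" "B - A \<subseteq> carrier G - {\<one>}" using Ac B(4) oneA by auto
      ultimately have "(A - {\<one>}) \<inter> (B - A) \<noteq> {}"
        using cA1 comm_set_sub[OF A(2)] comm_set_sub[OF B(2)] by (intro disjoint_cliques) auto
      then show False by blast
    next
      case True
      \<comment> \<open>Two commuting sets of 7 elements that share 3 give
        \<open>49 + 49 - 9 = 89\<close> commuting pairs on 11 vertices, where only
        \<open>7 * 11 = 77\<close> are allowed.\<close>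
      define W where "W = (A \<union> B) - {\<one>}"
      have W: "W = (A - {\<one>}) \<union> (B - A)" unfolding W_def using oneA by auto
      have fd: "finite (A - {\<one>})" "finite (B - A)" "(A - {\<one>}) \<inter> (B - A) = {}" using finA finB by auto
      have cW: "card W = 11" unfolding W card_Un_disjoint[OF fd] using cA1(1) cB True by simp
      have fin2: "finite (cpairs W W)" 
      proof (rule finite_subset)
        show "cpairs W W \<subseteq> W \<times> W" unfolding cpairs_def by auto
        show "finite (W \<times> W)" unfolding W_def using finA finB by simp
      qed
      have sub: "(A - {\<one>}) \<times> (A - {\<one>}) \<union> (B - {\<one>}) \<times> (B - {\<one>}) \<subseteq> cpairs W W"
        using A(2) B(2) unfolding cpairs_def comm_set_def W_def by auto
      have int: "((A - {\<one>}) \<times> (A - {\<one>})) \<inter> ((B - {\<one>}) \<times> (B - {\<one>})) = ((A \<inter> B) - {\<one>}) \<times> ((A \<inter> B) - {\<one>})" by auto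
      have c3: "card ((A \<inter> B) - {\<one>}) = 3" using True oneA oneB by (simp add: card_Diff_singleton)
      have f2: "finite ((A - {\<one>}) \<times> (A - {\<one>}))" "finite ((B - {\<one>}) \<times> (B - {\<one>}))" using finA finB by simp_all
      have "card ((A - {\<one>}) \<times> (A - {\<one>}) \<union> (B - {\<one>}) \<times> (B - {\<one>})) + 9 = 98"
        using card_Un_Int[OF f2] unfolding int card_cartesian_product cA1 c3 by simp
      moreover have "card ((A - {\<one>}) \<times> (A - {\<one>}) \<union> (B - {\<one>}) \<times> (B - {\<one>})) \<le> card (cpairs W W)"
        using fin2 sub by (rule card_mono)
      moreover have "card (cpairs W W) \<le> 7 * card W" using Ac B(4) Z1 unfolding W_def by (intro sparse) auto
      ultimately show False using cW by linarith
    qed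
  qed
  have "8 dvd card (carrier G)" using sub_card_dvd[OF A(1) subgroup_self Ac] A(3) by simp
  then have "even (card (carrier G))" by (rule dvd_trans[rotated]) simp
  then obtain p where p: "prime p" "odd p" "p dvd card (carrier G)" using odd_prime_divisor by blast
  obtain P where P: "subgroup P G" "P \<subseteq> carrier G" "card P = p" using cauchy[OF p(1) subgroup_self p(3)] by blast
  have "p dvd card (cpairs P (A - {\<one>}))" unfolding P(3)[symmetric]
  proof (rule burnside_commuting[OF P(1)])
    show "cj h s \<in> A - {\<one>}" if "h \<in> P" "s \<in> A - {\<one>}" for h s
    proof -
      have hc: "h \<in> carrier G" "s \<in> carrier G" using that P(2) Ac by auto
      have "cj h s \<in> A" using normal[OF hc(1)] that(2) by blast
      moreover have "cj h s \<noteq> \<one>" using cj_inject[OF hc(1) hc(2) one_closed] hc(1) that(2) by simp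
      ultimately show ?thesis by blast
    qed
  qed (use Ac in auto)
  moreover have "cpairs P (A - {\<one>}) \<noteq> {\<one>} \<times> (A - {\<one>})"
  proof
    assume "cpairs P (A - {\<one>}) = {\<one>} \<times> (A - {\<one>})"
    then have "p dvd 7" using calculation A(3) oneA by (simp add: card_cartesian_product card_Diff_singleton)
    moreover have "prime (7::nat)" by simp
    ultimately have "p = 7" using p(1) primes_dvd_imp_eq by blast
    then show False using no_abelian_7[OF P(1) prime_sub_commuting[OF p(1) P(1,3)]] P(3) by simp
  qed
  moreover have "{\<one>} \<times> (A - {\<one>}) \<subseteq> cpairs P (A - {\<one>})"
    unfolding cpairs_def using Ac subgroup.one_closed[OF P(1)] by auto
  ultimately obtain h s where hs: "h \<in> P" "h \<noteq> \<one>" "s \<in> A" "s \<noteq> \<one>" "h \<otimes> s = s \<otimes> h"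
    unfolding cpairs_def by auto
  have "{h, s} \<subseteq> carrier G" "comm_set {h, s}" using hs P(2) Ac unfolding comm_set_def by auto
  then obtain B where B: "{h, s} \<subseteq> B" "subgroup B G" "comm_set B" using max_commuting by metis
  have B8: "card B \<le> 8" using comm_card8[OF subgroup.subset[OF B(2)] B(3)] .
  have "P \<subseteq> B" using prime_sub_gen[OF p(1) P(1,3) B(2) hs(1) _ hs(2)] B(1) by blast
  then have pB: "p dvd card B" using sub_card_dvd[OF P(1) B(2)] P(3) by simp
  have M: "subgroup (B \<inter> A) G" using A(1) B(2) subgroups_Inter_pair by blast
  have "card (B \<inter> A) dvd 8" using sub_card_dvd[OF M A(1)] A(3) by auto
  moreover have "card (B \<inter> A) \<noteq> 1" using hs(3,4) B(1) subgroup.one_closed[OF M] by (metis IntI card_1_singletonE insert_subset singletonD)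
  ultimately have "2 dvd card (B \<inter> A)"
  proof -
    assume a: "card (B \<inter> A) dvd 8" "card (B \<inter> A) \<noteq> 1"
    then have "card (B \<inter> A) \<le> 8" by (intro dvd_imp_le) auto
    then have "card (B \<inter> A) \<in> {0, 2, 3, 4, 5, 6, 7, 8}" using a(2) by auto
    then show ?thesis using a(1) by auto
  qed
  then have "2 dvd card B" using sub_card_dvd[OF M B(2)] dvd_trans by blast
  \<comment> \<open>\<open>B\<close> contains \<open>P\<close> and meets \<open>A\<close>, of order
    8, nontrivially; so \<open>p\<close> and 2 both divide the order of \<open>B\<close>, which is
    at most 8.\<close>
  then have "2 * p dvd card B" using pB p(2) by (intro divides_mult) (auto simp: coprime_left_2_iff_odd)
  moreover have B0: "card B > 0" by (rule sub_pos[OF B(2)])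
  ultimately have "2 * p \<le> 8" using B8 dvd_imp_le by (meson order_trans)
  then have "p = 3" using p(1,2) prime_ge_2_nat[OF p(1)] by (cases "p = 2"; cases "p = 4") auto
  then have "6 dvd card B" using \<open>2 * p dvd card B\<close> by simp
  then have "card B = 6" using B8 B0 by (auto simp: dvd_def)
  then show False using no_abelian_6[OF B(2,3)] by simp
qed

text \<open>A commuting set lies in an abelian subgroup, whose order is at most 8 and none of 6, 7,
  8.\<close>

lemma comm_card5: assumes "T \<subseteq> carrier G" "comm_set T" shows "card T \<le> 5"
proof -
  obtain B where B: "T \<subseteq> B" "subgroup B G" "comm_set B" using max_commuting[OF assms] by blast
  have "card B \<le> 8" using comm_card8[OF subgroup.subset[OF B(2)] B(3)] .
  moreover have "card B \<noteq> 6" "card B \<noteq> 7" "card B \<noteq> 8"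
    using no_abelian_6[OF B(2,3)] no_abelian_7[OF B(2,3)] no_abelian_8[OF B(2,3)] by auto
  moreover have "card T \<le> card B" using sub_fin[OF B(2)] B(1) by (rule card_mono)
  ultimately show ?thesis by linarith
qed

end

section \<open>The class equation and the commuting graph of S4\<close>

text \<open>\<open>N\<^sub>c\<close> stands for the number of nontrivial elements with centralizer of order \<open>c\<close>. The class equation expresses \<open>1 / n\<close> as an
  integer combination of \<open>1/2, \<dots>, 1/8\<close>, so \<open>n\<close> divides 120.\<close>

lemma class_arith:
  fixes n N2 N3 N4 N5 N8 :: nat
  assumes n: "n = 1 + N2 + N3 + N4 + N5 + N8"
    and d: "n dvd 2 * N2" "n dvd 3 * N3" "n dvd 4 * N4" "n dvd 5 * N5" "n dvd 8 * N8"
    and "8 dvd n" "n > 8" "N8 \<ge> 1" "N4 \<ge> 2 * N8"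
  shows "n = 24 \<and> N2 = 0 \<and> N3 = 8 \<and> N4 = 12 \<and> N5 = 0 \<and> N8 = 3 \<or> n = 40 \<and> N4 = 10 \<and> N8 = 5"
proof -
  obtain k2 where k2: "2 * N2 = n * k2" using d(1) by (auto simp: dvd_def)
  obtain k3 where k3: "3 * N3 = n * k3" using d(2) by (auto simp: dvd_def)
  obtain k4 where k4: "4 * N4 = n * k4" using d(3) by (auto simp: dvd_def)
  obtain k5 where k5: "5 * N5 = n * k5" using d(4) by (auto simp: dvd_def)
  obtain k8 where k8: "8 * N8 = n * k8" using d(5) by (auto simp: dvd_def)
  \<comment> \<open>120 is the least common multiple of 2, 3, 4, 5 and 8. In the application
    \<open>k2\<close> to \<open>k8\<close> are the numbers of conjugacy classes with the respective
    centralizer orders.\<close>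
  have "n * 120 = 120 + 60 * (2 * N2) + 40 * (3 * N3) + 30 * (4 * N4) + 24 * (5 * N5) + 15 * (8 * N8)"
    using n by simp
  also have "\<dots> = 120 + n * (60 * k2 + 40 * k3 + 30 * k4 + 24 * k5 + 15 * k8)"
    unfolding k2 k3 k4 k5 k8 by (simp add: algebra_simps)
  finally have eq: "n * 120 = 120 + n * (60 * k2 + 40 * k3 + 30 * k4 + 24 * k5 + 15 * k8)" .
  have "n dvd 120 + n * (60 * k2 + 40 * k3 + 30 * k4 + 24 * k5 + 15 * k8)" unfolding eq[symmetric] by simp
  then have "n dvd 120" by (simp add: dvd_add_left_iff)
  obtain m where m: "n = 8 * m" using \<open>8 dvd n\<close> by (auto simp: dvd_def)
  then have "8 * m dvd 8 * 15" using \<open>n dvd 120\<close> by simp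
  then have m15: "m dvd 15" by simp
  then have "m \<le> 15" by (rule dvd_imp_le) simp
  then have "m = 0 \<or> m = 1 \<or> m = 2 \<or> m = 3 \<or> m = 4 \<or> m = 5 \<or> m = 6 \<or> m = 7 \<or> m = 8 \<or> m = 9 \<or> m = 10 \<or>
    m = 11 \<or> m = 12 \<or> m = 13 \<or> m = 14 \<or> m = 15" by presburger
  then have "m \<in> {3, 5, 15}" using m15 m \<open>n > 8\<close> by (elim disjE) simp_all
  then consider "n = 24" | "n = 40" | "n = 120" using m by auto
  then show ?thesis
  proof cases
    case 1
    have f: "N2 = 12 * k2" "N3 = 8 * k3" "N4 = 6 * k4" "5 * N5 = 24 * k5" "N8 = 3 * k8"
      using k2 k3 k4 k5 k8 unfolding 1 by simp_all
    have "5 dvd 24 * k5" unfolding f(4)[symmetric] by simp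
    then have "5 dvd k5" by presburger
    moreover have "k5 < 5" using f(4) n unfolding 1 by linarith
    ultimately have "k5 = 0" by auto
    then have N5: "N5 = 0" using f(4) by simp
    \<comment> \<open>With \<open>k4 \<ge> k8\<close> and \<open>k8 \<ge> 1\<close> this equation
      bounds \<open>k8\<close> by 2, and parity excludes 2. The other two orders are treated in the
      same way.\<close>
    have e: "23 = 12 * k2 + 8 * k3 + 6 * k4 + 3 * k8" using n f N5 unfolding 1 by simp
    have k: "k4 \<ge> k8" "k8 \<ge> 1" using assms(9,10) f by auto
    have "k8 \<le> 2" using e k by linarith
    moreover have "k8 \<noteq> 2"
    proof
      assume "k8 = 2"
      then have "17 = 2 * (6 * k2 + 4 * k3 + 3 * k4)" using e by simp
      then have "2 dvd (17 :: nat)" by (metis dvd_triv_left)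
      then show False by simp
    qed
    ultimately have k81: "k8 = 1" using k by linarith
    then have e2: "10 = 6 * k2 + 4 * k3 + 3 * k4" using e by simp
    then have "k4 \<le> 3" by linarith
    moreover have "even k4" using e2 by presburger
    ultimately have "k4 = 2" using k k81 by presburger
    then have "4 = 6 * k2 + 4 * k3" using e2 by simp
    then have "k2 = 0 \<and> k3 = 1" by (cases k2) auto
    then show ?thesis using 1 f N5 k81 \<open>k4 = 2\<close> by simp
  next
    case 2
    have f: "N2 = 20 * k2" "3 * N3 = 40 * k3" "N4 = 10 * k4" "N5 = 8 * k5" "N8 = 5 * k8"
      using k2 k3 k4 k5 k8 unfolding 2 by simp_all
    have "3 dvd 40 * k3" unfolding f(2)[symmetric] by simp
    then have "3 dvd k3" by presburger
    moreover have "k3 < 3" using f(2) n unfolding 2 by linarith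
    ultimately have "k3 = 0" by auto
    then have N3: "N3 = 0" using f(2) by simp
    have e: "39 = 20 * k2 + 10 * k4 + 8 * k5 + 5 * k8" using n f N3 unfolding 2 by simp
    have k: "k4 \<ge> k8" "k8 \<ge> 1" using assms(9,10) f by auto
    have "k8 \<le> 2" using e k by linarith
    moreover have "k8 \<noteq> 2"
    proof
      assume "k8 = 2"
      then have "29 = 2 * (10 * k2 + 5 * k4 + 4 * k5)" using e by simp
      then have "2 dvd (29 :: nat)" by (metis dvd_triv_left)
      then show False by simp
    qed
    ultimately have k81: "k8 = 1" using k by linarith
    then have e2: "17 = 10 * k2 + 5 * k4 + 4 * k5" using e by simp
    then have "k4 \<le> 3" by linarith
    moreover have "odd k4" using e2 by presburger
    moreover have "k4 \<noteq> 3"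
    proof
      assume "k4 = 3"
      then have "1 = 5 * k2 + 2 * k5" using e2 by simp
      then show False by (cases k2) auto
    qed
    ultimately have "k4 = 1" by presburger
    then show ?thesis using 2 f k81 by simp
  next
    case 3
    have f: "N2 = 60 * k2" "N3 = 40 * k3" "N4 = 30 * k4" "N5 = 24 * k5" "N8 = 15 * k8"
      using k2 k3 k4 k5 k8 unfolding 3 by simp_all
    have e: "119 = 60 * k2 + 40 * k3 + 30 * k4 + 24 * k5 + 15 * k8" using n f unfolding 3 by simp
    have k: "k4 \<ge> k8" "k8 \<ge> 1" using assms(9,10) f by auto
    have "k8 \<le> 2" using e k by linarith
    moreover have "k8 \<noteq> 2"
    proof
      assume "k8 = 2"
      then have "89 = 2 * (30 * k2 + 20 * k3 + 15 * k4 + 12 * k5)" using e by simp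
      then have "2 dvd (89 :: nat)" by (metis dvd_triv_left)
      then show False by simp
    qed
    ultimately have k81: "k8 = 1" using k by linarith
    then have e2: "52 = 30 * k2 + 20 * k3 + 15 * k4 + 12 * k5" using e by simp
    then have "k4 \<le> 3" by linarith
    moreover have "even k4" using e2 by presburger
    ultimately have "k4 = 2" using k k81 by presburger
    then have e3: "11 = 15 * k2 + 10 * k3 + 6 * k5" using e2 by simp
    then have "k2 = 0" "k3 \<le> 1" by linarith+
    then have "k3 = 0 \<or> k3 = 1" by linarith
    then have "11 = 6 * k5 \<or> 1 = 6 * k5" using e3 \<open>k2 = 0\<close> by auto
    then have False by presburger
    then show ?thesis ..
  qed
qed

text \<open>The commuting graph of the symmetric group \<open>S\<^sub>4\<close>. The vertices 0, 5, 10 are the double transpositions, each of which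
  is followed by the two further pairs that form a triangle with it; the last four edges come from the elements of order 3.
  In this order the edges are noncrossing chords of a convex polygon.\<close>

definition S4_edges :: "(nat \<times> nat) set" where
  "S4_edges = {(0,5), (0,10), (5,10),
    (0,1), (0,2), (1,2), (0,3), (0,4), (3,4),
    (5,6), (5,7), (6,7), (5,8), (5,9), (8,9),
    (10,11), (10,12), (11,12), (10,13), (10,14), (13,14),
    (15,16), (17,18), (19,20), (21,22)}"

context bad_group
begin

text \<open>Any \<open>w\<close> commuting with \<open>t\<close> and \<open>y\<close> lies with them
  in an abelian subgroup. Its order is at most 5, and even because of the involution
  \<open>t\<close>; so the four products of \<open>t\<close> and \<open>y\<close> exhaust
  it.\<close>

lemma pair_cen:
  assumes t: "t \<in> carrier G" "t \<noteq> \<one>" "\<not> comm_set (cen t)" and y: "y \<in> cen t" "y \<noteq> \<one>" "y \<noteq> t"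
  shows "cen t \<inter> cen y = {\<one>, t, y, t \<otimes> y}" "card {\<one>, t, y, t \<otimes> y} = 4"
proof -
  have tt: "t \<otimes> t = \<one>" by (rule bad(1)[OF t])
  have yc: "y \<in> carrier G" "t \<otimes> y = y \<otimes> t" using y by (auto simp: cen_iff)
  have "t \<otimes> y \<noteq> \<one>"
  proof
    assume "t \<otimes> y = \<one>"
    then have "t \<otimes> (t \<otimes> y) = t" using t by simp
    moreover have "t \<otimes> (t \<otimes> y) = y" using t(1) tt yc(1) by (simp add: m_assoc[symmetric])
    ultimately show False using y by simp
  qed
  moreover have "t \<otimes> y \<noteq> t" "t \<otimes> y \<noteq> y" using t y yc by simp_all
  ultimately show c4: "card {\<one>, t, y, t \<otimes> y} = 4" using t y by auto
  have E: "subgroup (cen t \<inter> cen y) G" using cen_subgroup[OF t(1)] cen_subgroup[OF yc(1)] subgroups_Inter_pair by blast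
  have tE: "t \<in> cen t \<inter> cen y" "y \<in> cen t \<inter> cen y" using t(1) yc by (auto simp: cen_iff)
  have sub: "{\<one>, t, y, t \<otimes> y} \<subseteq> cen t \<inter> cen y"
    using tE subgroup.one_closed[OF E] subgroup.m_closed[OF E tE] by blast
  have "w \<in> {\<one>, t, y, t \<otimes> y}" if w: "w \<in> cen t \<inter> cen y" for w
  proof -
    have "comm_set {t, y, w}" "{t, y, w} \<subseteq> carrier G" using w yc t by (auto simp: comm_set_def cen_iff)
    then obtain B where B: "{t, y, w} \<subseteq> B" "subgroup B G" "comm_set B" using max_commuting by metis
    have "card B \<le> 5" using comm_card5[OF subgroup.subset[OF B(2)] B(3)] .
    moreover have "2 dvd card B" using even_sub[OF B(2) _ tt t(2)] B(1) by blast
    ultimately have "card B \<le> 4" by (cases "card B = 5") auto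
    moreover have "{\<one>, t, y, t \<otimes> y} \<subseteq> B" using B(1) subgroup.one_closed[OF B(2)] subgroup.m_closed[OF B(2), of t y] by blast
    ultimately have "{\<one>, t, y, t \<otimes> y} = B" using c4 sub_fin[OF B(2)] card_seteq[of B "{\<one>, t, y, t \<otimes> y}"] by simp
    then show ?thesis using B(1) by blast
  qed
  then show "cen t \<inter> cen y = {\<one>, t, y, t \<otimes> y}" using sub by blast
qed

lemma noncommuting_sub: assumes t: "t \<in> carrier G" "t \<noteq> \<one>" "\<not> comm_set (cen t)"
  obtains y where "y \<in> cen t" "y \<noteq> \<one>" "y \<noteq> t" "cen t \<inter> cen y \<noteq> cen t"
proof -
  have "\<not> comm_set {\<one>, t} \<Longrightarrow> False" using t by (auto simp: comm_set_def)
  then have "cen t \<noteq> {\<one>, t}" using t(3) by auto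
  then obtain y where y: "y \<in> cen t" "y \<noteq> \<one>" "y \<noteq> t"
    using subgroup.one_closed[OF cen_subgroup[OF t(1)]] cen_self[OF t(1)] by blast
  have "cen t \<inter> cen y \<noteq> cen t"
  proof
    assume "cen t \<inter> cen y = cen t"
    then have "\<forall>c\<in>cen t. y \<otimes> c = c \<otimes> y" by (auto simp: cen_iff)
    then show False using bad(2)[OF t y(1)] y by blast
  qed
  then show ?thesis using that y by blast
qed

text \<open>Burnside's lemma for \<open>C\<close> acting on itself: \<open>\<one>\<close> and
  \<open>t\<close> commute with all of \<open>C\<close>, every other element with exactly 4, so
  \<open>card C\<close> divides \<open>6 * card C - 8\<close>. Hence it divides 8, and it exceeds
  4.\<close>

lemma card_cen_bad: assumes t: "t \<in> carrier G" "t \<noteq> \<one>" "\<not> comm_set (cen t)" shows "card (cen t) = 8"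
proof -
  define C where "C = cen t"
  have C: "subgroup C G" unfolding C_def by (rule cen_subgroup[OF t(1)])
  have Cc: "C \<subseteq> carrier G" by (rule subgroup.subset[OF C])
  have finC: "finite C" by (rule sub_fin[OF C])
  have tC: "{\<one>, t} \<subseteq> C" using subgroup.one_closed[OF C] cen_self[OF t(1)] unfolding C_def by blast
  have "card C dvd card (cpairs C C)"
  proof (rule burnside_commuting[OF C Cc])
    show "cj h s \<in> C" if "h \<in> C" "s \<in> C" for h s
      unfolding cj_def using that subgroup.m_closed[OF C] subgroup.m_inv_closed[OF C] by blast
  qed
  also have "card (cpairs C C) = (\<Sum>h\<in>C. card {s \<in> C. h \<otimes> s = s \<otimes> h})" by (rule card_cpairs(1)[OF finC finC])
  also have "\<dots> = (\<Sum>h\<in>{\<one>, t}. card {s \<in> C. h \<otimes> s = s \<otimes> h}) + (\<Sum>h\<in>C - {\<one>, t}. card {s \<in> C. h \<otimes> s = s \<otimes> h})"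
    using sum.subset_diff[OF tC finC] by (simp add: add.commute)
  also have "(\<Sum>h\<in>{\<one>, t}. card {s \<in> C. h \<otimes> s = s \<otimes> h}) = (\<Sum>h\<in>{\<one>, t}. card C)"
  proof (rule sum.cong[OF refl])
    fix h assume "h \<in> {\<one>, t}"
    then have "{s \<in> C. h \<otimes> s = s \<otimes> h} = C" using Cc unfolding C_def by (auto simp: cen_iff)
    then show "card {s \<in> C. h \<otimes> s = s \<otimes> h} = card C" by simp
  qed
  also have "(\<Sum>h\<in>C - {\<one>, t}. card {s \<in> C. h \<otimes> s = s \<otimes> h}) = (\<Sum>h\<in>C - {\<one>, t}. 4)"
  proof (rule sum.cong[OF refl])
    fix h assume h: "h \<in> C - {\<one>, t}"
    have "{s \<in> C. h \<otimes> s = s \<otimes> h} = cen t \<inter> cen h" unfolding C_def by (auto simp: cen_iff)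
    then show "card {s \<in> C. h \<otimes> s = s \<otimes> h} = 4" using pair_cen[OF t, of h] h unfolding C_def by simp
  qed
  finally have "card C dvd card {\<one>, t} * card C + card (C - {\<one>, t}) * 4" by (simp only: sum_constant of_nat_id)
  moreover have c2: "card {\<one>, t} = 2" using t(2) by auto
  moreover have "card (C - {\<one>, t}) = card C - card {\<one>, t}" by (rule card_Diff_subset[OF _ tC]) simp
  ultimately have "card C dvd 2 * card C + (card C - 2) * 4" by (simp only:)
  moreover obtain y where y: "y \<in> cen t" "y \<noteq> \<one>" "y \<noteq> t" "cen t \<inter> cen y \<noteq> cen t" using noncommuting_sub[OF t] by blast
  have "cen t \<inter> cen y \<subset> C" using y(4) unfolding C_def by blast
  then have "card (cen t \<inter> cen y) < card C" using finC by (simp add: psubset_card_mono)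
  then have big: "card C > 4" using pair_cen[OF t y(1-3)] by simp
  ultimately have "card C dvd 2 * card C + (card C - 2) * 4" by blast
  moreover have "2 * card C + (card C - 2) * 4 + 8 = card C * 6" using big by simp
  ultimately have "card C dvd 8" by (metis dvd_add_right_iff dvd_triv_left)
  moreover have "card C \<le> 8" using calculation by (rule dvd_imp_le) simp
  ultimately have "card C \<in> {5, 6, 7, 8}" using big by auto
  then show ?thesis using \<open>card C dvd 8\<close> unfolding C_def by auto
qed

lemma S_iff: "g \<in> S c \<longleftrightarrow> g \<in> carrier G \<and> g \<noteq> \<one> \<and> card (cen g) = c" by (auto simp: S_def)

lemma cen_cases: assumes "g \<in> carrier G" "g \<noteq> \<one>"
  shows "card (cen g) \<in> {2, 3, 4, 5} \<and> comm_set (cen g) \<or> card (cen g) = 8 \<and> \<not> comm_set (cen g)"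
proof (cases "comm_set (cen g)")
  case True
  have "{\<one>, g} \<subseteq> cen g" using assms by (auto simp: cen_iff)
  then have "card {\<one>, g} \<le> card (cen g)" using sub_fin[OF cen_subgroup[OF assms(1)]] by (intro card_mono)
  moreover have "card (cen g) \<le> 5" using True by (intro comm_card5) (auto simp: cen_def)
  ultimately show ?thesis using assms(2) True by auto
qed (use card_cen_bad assms in auto)

lemma bad_class: assumes "t \<in> S 8" shows "t \<in> carrier G" "t \<noteq> \<one>" "\<not> comm_set (cen t)"
  using assms cen_cases[of t] unfolding S_iff by auto

lemma carrier_split: "carrier G - {\<one>} = S 2 \<union> S 3 \<union> S 4 \<union> S 5 \<union> S 8"
proof
  show "carrier G - {\<one>} \<subseteq> S 2 \<union> S 3 \<union> S 4 \<union> S 5 \<union> S 8"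
  proof
    fix x assume "x \<in> carrier G - {\<one>}"
    then show "x \<in> S 2 \<union> S 3 \<union> S 4 \<union> S 5 \<union> S 8" using cen_cases[of x] by (auto simp: S_iff)
  qed
qed (auto simp: S_iff)

text \<open>The common centralizer has order 4, which leaves only 4 and 8 for
  \<open>card (cen y)\<close>. In the first case it is all of \<open>cen y\<close>.\<close>

lemma neighbours: assumes t: "t \<in> S 8" and y: "y \<in> cen t" "y \<noteq> \<one>" "y \<noteq> t"
  shows "y \<in> S 4 \<and> cen y = {\<one>, t, y, t \<otimes> y} \<or> y \<in> S 8"
proof -
  note b = bad_class[OF t]
  have yc: "y \<in> carrier G" using y by (auto simp: cen_iff)
  note pc = pair_cen[OF b y]
  have E: "subgroup (cen t \<inter> cen y) G" using cen_subgroup[OF b(1)] cen_subgroup[OF yc] subgroups_Inter_pair by blast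
  have c4: "card (cen t \<inter> cen y) = 4" using pc by simp
  have "4 dvd card (cen y)" using sub_card_dvd[OF E cen_subgroup[OF yc] Int_lower2] unfolding c4 .
  then have "card (cen y) = 4 \<or> card (cen y) = 8" using cen_cases[OF yc y(2)] by auto
  then show ?thesis
  proof
    assume 4: "card (cen y) = 4"
    then have "cen t \<inter> cen y = cen y" by (intro sub_eq[OF E cen_subgroup[OF yc] Int_lower2]) (simp only: c4)
    then show ?thesis using 4 pc(1) yc y(2) by (simp add: S_iff)
  qed (use yc y in \<open>simp add: S_iff\<close>)
qed

lemma sqrt_bad: assumes t: "t \<in> S 8" and y: "y \<in> cen t" "y \<noteq> \<one>" "y \<noteq> t" "y \<otimes> y \<noteq> \<one>" shows "y \<otimes> y = t"
proof -
  note b = bad_class[OF t]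
  have yc: "y \<in> carrier G" using y by (auto simp: cen_iff)
  have "y \<otimes> y \<in> cen t \<inter> cen y"
    using subgroup.m_closed[OF cen_subgroup[OF b(1)] y(1) y(1)] yc by (auto simp: cen_iff m_assoc)
  then have "y \<otimes> y \<in> {\<one>, t, y, t \<otimes> y}" using pair_cen(1)[OF b y(1-3)] by simp
  moreover have "y \<otimes> y \<noteq> y" using yc y(2) by simp
  moreover have "y \<otimes> y \<noteq> t \<otimes> y" using right_cancel[OF yc yc b(1)] y(3) by simp
  ultimately show ?thesis using y(4) by blast
qed

definition "Q t = {y \<in> S 4. y \<otimes> y = t}"

text \<open>Whatever commutes with \<open>y\<close> commutes with its square \<open>t\<close>, so
  \<open>cen y\<close> is inside \<open>cen t\<close>, and \<open>pair_cen\<close> gives it 4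
  elements.\<close>

lemma in_Q: assumes t: "t \<in> S 8" and y: "y \<in> carrier G" "y \<otimes> y = t" shows "y \<in> Q t"
proof -
  note b = bad_class[OF t]
  have tt: "t \<otimes> t = \<one>" by (rule bad(1)[OF b])
  have y1: "y \<noteq> \<one>" "y \<noteq> t" using y b tt by auto
  have yt: "y \<in> cen t" using y by (auto simp: cen_iff m_assoc)
  have "cen y \<subseteq> cen t"
  proof
    fix z assume "z \<in> cen y"
    then have "z \<in> carrier G" "z \<otimes> y = y \<otimes> z" by (auto simp: cen_iff)
    then have "z \<otimes> (y \<otimes> y) = (y \<otimes> y) \<otimes> z" using commute_mult[OF _ y(1) y(1)] by blast
    then show "z \<in> cen t" using \<open>z \<in> carrier G\<close> y(2) by (simp add: cen_iff)
  qed
  then have "cen y = cen t \<inter> cen y" by blast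
  then have "card (cen y) = 4" using pair_cen[OF b yt y1] by simp
  then show ?thesis unfolding Q_def S_iff using y y1 by simp
qed

text \<open>A group in which all squares are trivial is abelian. So \<open>cen t\<close> has an
  element \<open>y\<close> with nontrivial square, which can only be \<open>t\<close>, and
  \<open>t \<otimes> y\<close> is a second root.\<close>

lemma card_Q: assumes t: "t \<in> S 8" shows "card (Q t) \<ge> 2"
proof -
  note b = bad_class[OF t]
  have tt: "t \<otimes> t = \<one>" by (rule bad(1)[OF b])
  have "\<exists>y\<in>cen t. y \<otimes> y \<noteq> \<one>"
  proof (rule ccontr)
    assume "\<not> (\<exists>y\<in>cen t. y \<otimes> y \<noteq> \<one>)"
    then have sq: "y \<otimes> y = \<one>" if "y \<in> cen t" for y using that by blast
    have "x \<otimes> y = y \<otimes> x" if xy: "x \<in> cen t" "y \<in> cen t" for x y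
    proof -
      have c: "x \<in> carrier G" "y \<in> carrier G" using xy by (auto simp: cen_iff)
      have "x \<otimes> y \<in> cen t" using subgroup.m_closed[OF cen_subgroup[OF b(1)]] xy by blast
      then have "inv (x \<otimes> y) = x \<otimes> y" using sq c by (intro inv_equality) auto
      moreover have "inv x = x" "inv y = y" using sq xy c by (auto intro: inv_equality)
      ultimately show ?thesis using inv_mult_group[OF c] by simp
    qed
    then show False using b(3) unfolding comm_set_def by blast
  qed
  then obtain y where y: "y \<in> cen t" "y \<otimes> y \<noteq> \<one>" by blast
  then have yc: "y \<in> carrier G" "t \<otimes> y = y \<otimes> t" by (auto simp: cen_iff)
  have y1: "y \<noteq> \<one>" "y \<noteq> t" using y(2) tt by auto
  have yy: "y \<otimes> y = t" by (rule sqrt_bad[OF t y(1) y1 y(2)])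
  have "(t \<otimes> y) \<otimes> (t \<otimes> y) = t \<otimes> (y \<otimes> t) \<otimes> y" using b(1) yc(1) by (simp only: m_assoc m_closed)
  also have "\<dots> = (t \<otimes> t) \<otimes> (y \<otimes> y)" unfolding yc(2)[symmetric] using b(1) yc(1) by (simp only: m_assoc m_closed)
  finally have "(t \<otimes> y) \<otimes> (t \<otimes> y) = t" using tt yy b(1) by simp
  then have "{y, t \<otimes> y} \<subseteq> Q t" using in_Q[OF t] yy yc b(1) by simp
  moreover have "finite (Q t)" unfolding Q_def using finS by simp
  ultimately have "card {y, t \<otimes> y} \<le> card (Q t)" by (intro card_mono)
  moreover have "t \<otimes> y \<noteq> y" using yc b by simp
  ultimately show ?thesis by simp
qed

lemma finQ: "finite (Q t)" unfolding Q_def using finS by simp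

lemma card_UQ: "card (\<Union>t\<in>S 8. Q t) = (\<Sum>t\<in>S 8. card (Q t))"
proof (rule card_UN_disjoint[OF finS])
  show "\<forall>i\<in>S 8. \<forall>j\<in>S 8. i \<noteq> j \<longrightarrow> Q i \<inter> Q j = {}" unfolding Q_def by auto
qed (use finQ in blast)

lemma UQ_sub: "(\<Union>t\<in>S 8. Q t) \<subseteq> S 4" unfolding Q_def by auto

lemma S4_S8: "card (S 4) \<ge> 2 * card (S 8)"
proof -
  have "(\<Sum>t\<in>S 8. 2) \<le> (\<Sum>t\<in>S 8. card (Q t))" using card_Q by (rule sum_mono)
  also have "\<dots> \<le> card (S 4)" unfolding card_UQ[symmetric] using finS UQ_sub by (rule card_mono)
  finally show ?thesis by simp
qed

lemma t0_S8: "t0 \<in> S 8" using t0 t0_ne card_cen_bad by (auto simp: S_iff)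

lemma class_numbers: "card (S 3) = 8 \<and> card (S 4) = 12 \<and> card (S 8) = 3 \<and> S 2 = {} \<and> S 5 = {}"
proof -
  define n where "n = card (carrier G)"
  have dis: "S a \<inter> S b = {}" if "a \<noteq> b" for a b using that by (auto simp: S_iff)
  have "card (carrier G - {\<one>}) = card (S 2) + card (S 3) + card (S 4) + card (S 5) + card (S 8)"
    unfolding carrier_split using dis finS by (simp add: card_Un_disjoint Int_Un_distrib2)
  moreover have "card (carrier G - {\<one>}) = n - 1" "n > 0" unfolding n_def
    using sub_pos[OF subgroup_self] by (simp_all add: card_Diff_singleton)
  ultimately have n: "n = 1 + card (S 2) + card (S 3) + card (S 4) + card (S 5) + card (S 8)" by simp
  have c8: "card (cen t0) = 8" using t0_S8 by (simp add: S_iff)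
  have d8: "8 dvd n" unfolding n_def using sub_card_dvd[OF cen_subgroup[OF t0(1)] subgroup_self] c8 by (auto simp: cen_def)
  have "n > 8"
  proof -
    have "cen t0 \<noteq> carrier G"
    proof
      assume "cen t0 = carrier G"
      then have "t0 \<in> Z" unfolding group_centre_def using t0(1) by (auto simp: cen_def)
      then show False using t0(2) by simp
    qed
    then have "cen t0 \<subset> carrier G" by (auto simp: cen_def)
    then have "card (cen t0) < n" unfolding n_def using fin by (rule psubset_card_mono[rotated])
    then show ?thesis using c8 by simp
  qed
  have cd: "n dvd c * card (S c)" for c unfolding n_def by (rule class_dvd)
  have S81: "card (S 8) \<ge> 1" using t0_S8 finS[of 8] by (metis One_nat_def Suc_leI card_gt_0_iff empty_iff)
  from class_arith[OF n cd cd cd cd cd d8 \<open>n > 8\<close> S81 S4_S8]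
  show ?thesis
  proof
    assume "n = 24 \<and> card (S 2) = 0 \<and> card (S 3) = 8 \<and> card (S 4) = 12 \<and> card (S 5) = 0 \<and> card (S 8) = 3"
    then show ?thesis using finS by simp
  next
    \<comment> \<open>Here \<open>S 4\<close> consists of exactly 2 square roots for each of the 5
      elements of \<open>S 8\<close>. So \<open>cen t\<close>, of order 8, consists of
      \<open>\<one>\<close>, the two roots of \<open>t\<close> and members of \<open>S 8\<close>,
      and thus contains all five of these. With \<open>\<one>\<close> they form a commuting set of 6
      elements, one too many.\<close>
    assume "n = 40 \<and> card (S 4) = 10 \<and> card (S 8) = 5"
    then have 2: "card (S 4) = 10" "card (S 8) = 5" by auto
    have "(\<Sum>t\<in>S 8. card (Q t)) \<ge> (\<Sum>t\<in>S 8. 2)" using card_Q by (rule sum_mono)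
    then have "card (\<Union>t\<in>S 8. Q t) \<ge> card (S 4)" using 2 card_UQ by simp
    then have UQ: "(\<Union>t\<in>S 8. Q t) = S 4" using card_seteq[OF finS UQ_sub] by blast
    have Q2: "card (Q t) = 2" if t: "t \<in> S 8" for t
    proof (rule ccontr)
      assume "card (Q t) \<noteq> 2"
      then have "card (Q t) > 2" using card_Q[OF t] by linarith
      then have "(\<Sum>t\<in>S 8. 2) < (\<Sum>t\<in>S 8. card (Q t))"
        using card_Q t finS by (intro sum_strict_mono_ex1) auto
      then show False using 2 card_UQ UQ by simp
    qed
    have "S 8 \<subseteq> cen t" if t: "t \<in> S 8" for t
    proof -
      note b = bad_class[OF t]
      have "cen t \<subseteq> {\<one>} \<union> Q t \<union> (cen t \<inter> S 8)"
      proof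
        fix y assume y: "y \<in> cen t"
        show "y \<in> {\<one>} \<union> Q t \<union> (cen t \<inter> S 8)"
        proof (cases "y = \<one> \<or> y \<in> S 8")
          case False
          then have y1: "y \<noteq> \<one>" "y \<noteq> t" using t by auto
          have "y \<in> S 4" using neighbours[OF t y y1] False by blast
          then obtain t' where t': "t' \<in> S 8" "y \<in> Q t'" using UQ by blast
          then have "y \<otimes> y \<noteq> \<one>" using bad_class(2) unfolding Q_def by auto
          then have "y \<otimes> y = t" by (rule sqrt_bad[OF t y y1])
          then show ?thesis using \<open>y \<in> S 4\<close> unfolding Q_def by simp
        qed (use y in auto)
      qed
      then have "card (cen t) \<le> card ({\<one>} \<union> Q t \<union> (cen t \<inter> S 8))" using finS finQ by (intro card_mono) auto
      also have "\<dots> \<le> card ({\<one>} \<union> Q t) + card (cen t \<inter> S 8)" by (rule card_Un_le)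
      also have "card ({\<one>} \<union> Q t) \<le> card {\<one>} + card (Q t)" by (rule card_Un_le)
      finally have "5 \<le> card (cen t \<inter> S 8)" using t Q2[OF t] by (simp add: S_iff)
      then have "cen t \<inter> S 8 = S 8" using 2 finS by (intro card_seteq) auto
      then show ?thesis by blast
    qed
    then have "comm_set (insert \<one> (S 8))" unfolding comm_set_def by (auto simp: cen_iff S_iff subset_iff)
    then have "card (insert \<one> (S 8)) \<le> 5" by (intro comm_card5) (auto simp: S_iff)
    moreover have "\<one> \<notin> S 8" by (simp add: S_iff)
    ultimately show ?thesis using 2 finS by simp
  qed
qed

text \<open>Conjugation permutes the three elements of \<open>S 8\<close>; if two of them commute,
  each of the two fixes both and hence the third as well. If no two commuted, the sets
  \<open>cen t - {\<one>, t}\<close> would be three disjoint sets of 6 elements in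
  \<open>S 4\<close>, which has 12.\<close>

lemma S8_comm: "comm_set (S 8)"
proof -
  have cn: "card (S 4) = 12" "card (S 8) = 3" using class_numbers by auto
  have ex: "\<exists>t\<in>S 8. \<exists>t'\<in>S 8. t \<noteq> t' \<and> t' \<in> cen t"
  proof (rule ccontr)
    assume "\<not> ?thesis"
    then have n: "t' \<notin> cen t" if "t \<in> S 8" "t' \<in> S 8" "t \<noteq> t'" for t t' using that by blast
    have D4: "y \<in> S 4 \<and> cen y = {\<one>, t, y, t \<otimes> y}" if "t \<in> S 8" "y \<in> cen t - {\<one>, t}" for t y
      using neighbours[OF that(1)] that n by blast
    have "card (\<Union>t\<in>S 8. cen t - {\<one>, t}) = (\<Sum>t\<in>S 8. card (cen t - {\<one>, t}))"
    proof (rule card_UN_disjoint[OF finS])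
      show "\<forall>t\<in>S 8. finite (cen t - {\<one>, t})" using fin by (auto simp: cen_def)
      show "\<forall>t\<in>S 8. \<forall>t'\<in>S 8. t \<noteq> t' \<longrightarrow> (cen t - {\<one>, t}) \<inter> (cen t' - {\<one>, t'}) = {}"
      proof (intro ballI impI, rule ccontr)
        fix t t' assume t: "t \<in> S 8" "t' \<in> S 8" "t \<noteq> t'" and "(cen t - {\<one>, t}) \<inter> (cen t' - {\<one>, t'}) \<noteq> {}"
        then obtain y where y: "y \<in> cen t - {\<one>, t}" "y \<in> cen t'" by blast
        have "t' \<in> cen y" using y(2) t(2) by (auto simp: cen_iff S_iff)
        then have "t' \<in> {\<one>, t, y, t \<otimes> y}" using D4[OF t(1) y(1)] by blast
        moreover have "t' \<noteq> y" using D4[OF t(1) y(1)] t(2) by (auto simp: S_iff)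
        ultimately have "t' = t \<otimes> y" using t(3) bad_class(2)[OF t(2)] by blast
        moreover have "t \<otimes> y \<in> cen t" using y(1) bad_class(1)[OF t(1)] cen_self subgroup.m_closed[OF cen_subgroup] by blast
        ultimately show False using n t by blast
      qed
    qed
    also have "\<dots> = (\<Sum>t\<in>S 8. 6)"
    proof (rule sum.cong[OF refl])
      fix t assume t: "t \<in> S 8"
      have "{\<one>, t} \<subseteq> cen t" using bad_class(1)[OF t] by (auto simp: cen_iff)
      then show "card (cen t - {\<one>, t}) = 6" using t bad_class(2)[OF t] card_Diff_subset[of "{\<one>, t}" "cen t"] by (simp add: S_iff)
    qed
    finally have "card (\<Union>t\<in>S 8. cen t - {\<one>, t}) = 18" using cn by simp
    moreover have "card (\<Union>t\<in>S 8. cen t - {\<one>, t}) \<le> card (S 4)" using D4 finS by (intro card_mono) auto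
    ultimately show False using cn by simp
  qed
  then obtain t t' where t: "t \<in> S 8" "t' \<in> S 8" "t \<noteq> t'" "t' \<in> cen t" by blast
  have "card (S 8 - {t, t'}) = 1" using t cn card_Diff_subset[of "{t, t'}" "S 8"] by simp
  then obtain t'' where t'': "S 8 - {t, t'} = {t''}" by (metis card_1_singletonE)
  have eq: "S 8 = {t, t', t''}" and mem: "t'' \<in> S 8" and ne: "t'' \<noteq> t" "t'' \<noteq> t'" using t t'' by blast+
  have c: "t \<in> carrier G" "t' \<in> carrier G" "t'' \<in> carrier G" using bad_class(1) t mem by auto
  have tt': "t \<otimes> t' = t' \<otimes> t" using t(4) by (simp add: cen_iff)
  have third: "u \<otimes> t'' = t'' \<otimes> u" if u: "u = t \<or> u = t'" for u
  proof -
    have uc: "u \<in> carrier G" using u c by auto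
    have "cj u t = t" "cj u t' = t'" using cj_fix[OF uc] u c tt' by auto
    then have "cj u t'' \<noteq> t" "cj u t'' \<noteq> t'" using cj_inject[OF uc c(3)] c ne by metis+
    moreover have "cj u t'' \<in> S 8" using S_cj[OF uc mem] .
    ultimately have "cj u t'' = t''" using eq by blast
    then show ?thesis using cj_fix[OF uc c(3)] by simp
  qed
  show ?thesis unfolding comm_set_def eq using third tt' by auto
qed

text \<open>\<open>V4\<close> becomes the normal Klein four-group of \<open>S\<^sub>4\<close>; centralizers of its involutions meet in it.\<close>

definition "V4 = insert \<one> (S 8)"
definition "R t = cen t - V4"

text \<open>An abelian subgroup containing \<open>V4\<close> has even order at most 5, so it is
  \<open>V4\<close> itself.\<close>

lemma V4_group: "subgroup V4 G" "card V4 = 4" "comm_set V4" "V4 \<subseteq> carrier G"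
proof -
  show Vc: "V4 \<subseteq> carrier G" unfolding V4_def by (auto simp: S_iff)
  show "card V4 = 4" unfolding V4_def using class_numbers finS by (simp add: S_iff)
  show com: "comm_set V4" using S8_comm unfolding V4_def comm_set_def by (auto simp: S_iff)
  obtain B where B: "V4 \<subseteq> B" "subgroup B G" "comm_set B" using max_commuting[OF Vc com] by blast
  have "card B \<le> 5" using comm_card5[OF subgroup.subset[OF B(2)] B(3)] .
  moreover have "t0 \<in> B" using t0_S8 B(1) unfolding V4_def by blast
  then have "2 dvd card B" using even_sub[OF B(2) _ bad(1)[OF bad_class[OF t0_S8]] t0_ne] by blast
  ultimately have "card B \<le> card V4" unfolding \<open>card V4 = 4\<close> by (cases "card B = 5") auto
  then have "V4 = B" using card_seteq[OF sub_fin[OF B(2)] B(1)] by simp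
  then show "subgroup V4 G" using B(2) by simp
qed

text \<open>Multiplication by \<open>t\<close> pairs off the elements of \<open>cen t\<close>
  outside \<open>V4\<close>. By the shape of \<open>cen y\<close>, the vertex \<open>y\<close> is
  adjacent only to \<open>t\<close> and to its partner, so each pair is a triangle hanging on
  \<open>t\<close>.\<close>

lemma wing: assumes t: "t \<in> S 8" and y: "y \<in> R t"
  shows "y \<in> S 4" "cen y = {\<one>, t, y, t \<otimes> y}" "t \<otimes> y \<in> R t" "t \<otimes> y \<noteq> y" "t \<otimes> (t \<otimes> y) = y" "y \<in> carrier G"
proof -
  note b = bad_class[OF t]
  have yt: "y \<in> cen t" "y \<noteq> \<one>" "y \<notin> S 8" "y \<noteq> t" using y t unfolding R_def V4_def by auto
  show "y \<in> S 4" "cen y = {\<one>, t, y, t \<otimes> y}" using neighbours[OF t yt(1,2,4)] yt(3) by auto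
  show yc: "y \<in> carrier G" using yt by (simp add: cen_iff)
  show tty: "t \<otimes> (t \<otimes> y) = y" using b(1) yc bad(1)[OF b] by (simp add: m_assoc[symmetric])
  show "t \<otimes> y \<noteq> y" using b yc by simp
  have tV: "t \<in> V4" using t unfolding V4_def by simp
  have "t \<otimes> y \<notin> V4"
  proof
    assume "t \<otimes> y \<in> V4"
    then have "t \<otimes> (t \<otimes> y) \<in> V4" using subgroup.m_closed[OF V4_group(1) tV] by blast
    then show False using tty y unfolding R_def by simp
  qed
  moreover have "t \<otimes> y \<in> cen t" using subgroup.m_closed[OF cen_subgroup[OF b(1)] cen_self[OF b(1)] yt(1)] .
  ultimately show "t \<otimes> y \<in> R t" unfolding R_def by simp
qed

lemma card_R: assumes t: "t \<in> S 8" shows "card (R t) = 4"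
proof -
  have "V4 \<subseteq> cen t"
  proof
    fix y assume y: "y \<in> V4"
    moreover have "t \<in> V4" using t unfolding V4_def by (rule insertI2)
    ultimately have "t \<otimes> y = y \<otimes> t" using V4_group(3) unfolding comm_set_def by blast
    then show "y \<in> cen t" using y V4_group(4) by (auto simp: cen_iff)
  qed
  moreover have "finite V4" unfolding V4_def using finS by simp
  ultimately have "card (cen t - V4) = card (cen t) - card V4" by (intro card_Diff_subset)
  then show ?thesis unfolding R_def using V4_group(2) t by (simp add: S_iff)
qed

lemma R_disjoint: assumes t: "t \<in> S 8" "t' \<in> S 8" "t \<noteq> t'" shows "R t \<inter> R t' = {}"
proof (rule ccontr)
  assume "R t \<inter> R t' \<noteq> {}"
  then obtain y where y: "y \<in> R t" "y \<in> R t'" by blast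
  have "t' \<in> cen y" using wing(2)[OF t(2) y(2)] by blast
  then have "t' \<in> {\<one>, t, y, t \<otimes> y}" using wing(2)[OF t(1) y(1)] by simp
  moreover have "t' \<noteq> y" using wing(1)[OF t(1) y(1)] t(2) by (auto simp: S_iff)
  ultimately have "t' = t \<otimes> y" using t(3) bad_class(2)[OF t(2)] by blast
  then have "t \<otimes> y \<in> V4" using t(2) unfolding V4_def by simp
  then show False using wing(3)[OF t(1) y(1)] unfolding R_def by simp
qed

text \<open>Three disjoint sets of 4 elements exhaust \<open>S 4\<close>, which has 12.\<close>

lemma UR: "(\<Union>t\<in>S 8. R t) = S 4"
proof (rule card_seteq[OF finS])
  show "(\<Union>t\<in>S 8. R t) \<subseteq> S 4" using wing(1) by blast
  have "card (\<Union>t\<in>S 8. R t) = (\<Sum>t\<in>S 8. card (R t))"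
    using R_disjoint fin by (intro card_UN_disjoint finS) (auto simp: R_def cen_def)
  also have "\<dots> = (\<Sum>t\<in>S 8. 4)" using card_R by (intro sum.cong) auto
  finally show "card (S 4) \<le> card (\<Union>t\<in>S 8. R t)" using class_numbers by simp
qed

lemma R_list: assumes t: "t \<in> S 8" obtains a b where "R t = {a, t \<otimes> a, b, t \<otimes> b}" "a \<in> R t" "b \<in> R t"
proof -
  have "R t \<noteq> {}" using card_R[OF t] by auto
  then obtain a where a: "a \<in> R t" by blast
  have finR: "finite (R t)" using card_R[OF t] by (metis card.infinite zero_neq_numeral)
  have "card {a, t \<otimes> a} = 2" using wing(4)[OF t a] by auto
  then have "R t \<noteq> {a, t \<otimes> a}" using card_R[OF t] by auto
  then obtain b where b: "b \<in> R t" "b \<noteq> a" "b \<noteq> t \<otimes> a" using a wing(3)[OF t a] by blast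
  have "t \<otimes> b \<noteq> a" "t \<otimes> b \<noteq> t \<otimes> a" using wing(5)[OF t a] wing(5)[OF t b(1)] b by auto
  then have "card {a, t \<otimes> a, b, t \<otimes> b} = 4" using wing(4)[OF t a] wing(4)[OF t b(1)] b by auto
  moreover have "{a, t \<otimes> a, b, t \<otimes> b} \<subseteq> R t" using a b wing(3)[OF t] by blast
  ultimately have "R t = {a, t \<otimes> a, b, t \<otimes> b}" using card_seteq[OF finR] card_R[OF t] by (metis order_refl)
  then show ?thesis using that a b by blast
qed

lemma order3_class: assumes s: "s \<in> S 3" shows "cen s = {\<one>, s, inv s}" "inv s \<in> S 3" "inv s \<noteq> s" "inv (inv s) = s"
proof -
  have c: "s \<in> carrier G" "s \<noteq> \<one>" "card (cen s) = 3" using s by (auto simp: S_iff)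
  have C: "subgroup (cen s) G" by (rule cen_subgroup[OF c(1)])
  show ii: "inv (inv s) = s" using c by simp
  show ne: "inv s \<noteq> s"
  proof
    assume "inv s = s"
    then have "s \<otimes> s = \<one>" using c(1) r_inv[of s] by simp
    then show False using even_sub[OF C cen_self[OF c(1)] _ c(2)] c(3) by simp
  qed
  have i1: "inv s \<noteq> \<one>" using c ii by (metis inv_one)
  have "{\<one>, s, inv s} \<subseteq> cen s"
    using cen_self[OF c(1)] subgroup.one_closed[OF C] subgroup.m_inv_closed[OF C] by blast
  moreover have "card {\<one>, s, inv s} = 3"
    using c(2) c(2)[symmetric] ne ne[symmetric] i1 i1[symmetric] by (simp only: card_insert_if finite.intros) simp
  ultimately show "cen s = {\<one>, s, inv s}" using card_seteq[OF sub_fin[OF C]] c(3) by (metis order_refl)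
  have "cen (inv s) = cen s"
    using commute_inv[of _ s] commute_inv[of _ "inv s"] c(1) unfolding cen_def by (auto dest: sym)
  then show "inv s \<in> S 3" using c i1 by (simp add: S_iff)
qed

lemma S3_list: obtains p q u v where "S 3 = {p, inv p, q, inv q, u, inv u, v, inv v}" "p \<in> S 3" "q \<in> S 3" "u \<in> S 3" "v \<in> S 3"
proof -
  have c8: "card (S 3) = 8" using class_numbers by simp
  have step: "\<exists>s\<in>S 3. s \<notin> set xs" if "length xs < 8" for xs
  proof (rule ccontr)
    assume "\<not> (\<exists>s\<in>S 3. s \<notin> set xs)"
    then have "card (S 3) \<le> card (set xs)" by (intro card_mono) auto
    then show False using that c8 card_length[of xs] by linarith
  qed
  obtain p where p: "p \<in> S 3" using step[of "[]"] by auto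
  obtain q where q: "q \<in> S 3" "q \<notin> {p, inv p}" using step[of "[p, inv p]"] by auto
  obtain u where u: "u \<in> S 3" "u \<notin> {p, inv p, q, inv q}" using step[of "[p, inv p, q, inv q]"] by auto
  obtain v where v: "v \<in> S 3" "v \<notin> {p, inv p, q, inv q, u, inv u}" using step[of "[p, inv p, q, inv q, u, inv u]"] by auto
  have inj: "inv a = inv b \<longleftrightarrow> a = b" if "a \<in> S 3" "b \<in> S 3" for a b using order3_class(4)[OF that(1)] order3_class(4)[OF that(2)] by metis
  have sw: "inv a = b \<longleftrightarrow> a = inv b" if "a \<in> S 3" "b \<in> S 3" for a b using order3_class(4)[OF that(1)] order3_class(4)[OF that(2)] by metis
  have d: "distinct [p, inv p, q, inv q, u, inv u, v, inv v]"
    using p q u v inj[OF q(1) p] inj[OF u(1) p] inj[OF v(1) p] inj[OF u(1) q(1)] inj[OF v(1) q(1)] inj[OF v(1) u(1)]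
      sw[OF q(1) p] sw[OF u(1) p] sw[OF v(1) p] sw[OF u(1) q(1)] sw[OF v(1) q(1)] sw[OF v(1) u(1)]
      order3_class(3)[OF p] order3_class(3)[OF q(1)] order3_class(3)[OF u(1)] order3_class(3)[OF v(1)]
    by (simp, metis)
  have "card (set [p, inv p, q, inv q, u, inv u, v, inv v]) = 8" using distinct_card[OF d] by simp
  moreover have "set [p, inv p, q, inv q, u, inv u, v, inv v] \<subseteq> S 3" using p q u v order3_class(2) by auto
  ultimately have "set [p, inv p, q, inv q, u, inv u, v, inv v] = S 3" using c8 card_seteq[OF finS] by (metis order_refl)
  then show ?thesis using that[of p q u v] p q u v by simp
qed

lemma S4_graph:
  obtains vs where "distinct vs" "set vs = carrier G - {\<one>}" "length vs = 23"
    "\<And>x y. x \<in> carrier G - {\<one>} \<Longrightarrow> y \<in> carrier G - {\<one>} \<Longrightarrow> x \<noteq> y \<Longrightarrow> x \<otimes> y = y \<otimes> x \<Longrightarrow>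
      {x, y} \<in> (\<lambda>(i, j). {vs ! i, vs ! j}) ` S4_edges"
proof -
  have cn: "card (S 3) = 8" "card (S 4) = 12" "card (S 8) = 3" "S 2 = {}" "S 5 = {}" using class_numbers by auto
  obtain t1 t2 t3 where T: "S 8 = {t1, t2, t3}" using cn(3) by (metis card_3_iff)
  then have t: "t1 \<in> S 8" "t2 \<in> S 8" "t3 \<in> S 8" by auto
  obtain a1 b1 where R1: "R t1 = {a1, t1 \<otimes> a1, b1, t1 \<otimes> b1}" "a1 \<in> R t1" "b1 \<in> R t1" using R_list[OF t(1)] by blast
  obtain a2 b2 where R2: "R t2 = {a2, t2 \<otimes> a2, b2, t2 \<otimes> b2}" "a2 \<in> R t2" "b2 \<in> R t2" using R_list[OF t(2)] by blast
  obtain a3 b3 where R3: "R t3 = {a3, t3 \<otimes> a3, b3, t3 \<otimes> b3}" "a3 \<in> R t3" "b3 \<in> R t3" using R_list[OF t(3)] by blast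
  obtain p q u v where P: "S 3 = {p, inv p, q, inv q, u, inv u, v, inv v}" "p \<in> S 3" "q \<in> S 3" "u \<in> S 3" "v \<in> S 3"
    using S3_list by blast
  define vs where "vs = [t1, a1, t1 \<otimes> a1, b1, t1 \<otimes> b1, t2, a2, t2 \<otimes> a2, b2, t2 \<otimes> b2, t3, a3, t3 \<otimes> a3, b3, t3 \<otimes> b3,
    p, inv p, q, inv q, u, inv u, v, inv v]"
  have S4eq: "S 4 = R t1 \<union> R t2 \<union> R t3" using UR T by auto
  have split: "carrier G - {\<one>} = S 8 \<union> (R t1 \<union> R t2 \<union> R t3) \<union> S 3"
    using carrier_split cn(4,5) unfolding S4eq[symmetric] by blast
  have set: "set vs = carrier G - {\<one>}" unfolding split T R1(1) R2(1) R3(1) P(1) vs_def by (simp only: list.set) blast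
  have len: "length vs = 23" unfolding vs_def by simp
  have dis: "S a \<inter> S b = {}" if "a \<noteq> b" for a b using that by (auto simp: S_iff)
  have "card (carrier G - {\<one>}) = 23"
  proof -
    have "carrier G - {\<one>} = S 3 \<union> S 4 \<union> S 8" using carrier_split cn(4,5) by blast
    then have "card (carrier G - {\<one>}) = card (S 3 \<union> S 4) + card (S 8)"
      using dis[of 3 8] dis[of 4 8] finS by (simp add: card_Un_disjoint Int_Un_distrib2)
    also have "card (S 3 \<union> S 4) = card (S 3) + card (S 4)" using dis[of 3 4] finS by (simp add: card_Un_disjoint)
    finally show ?thesis using cn by simp
  qed
  \<comment> \<open>The 23 entries cover a set of 23 elements, so none is repeated.\<close>
  then have dist: "distinct vs" using set len card_distinct by metis
  define F where "F = (\<lambda>(i, j). {vs ! i, vs ! j}) ` S4_edges"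
  have F: "F = {{t1,t2}, {t1,t3}, {t2,t3},
    {t1,a1}, {t1,t1 \<otimes> a1}, {a1,t1 \<otimes> a1}, {t1,b1}, {t1,t1 \<otimes> b1}, {b1,t1 \<otimes> b1},
    {t2,a2}, {t2,t2 \<otimes> a2}, {a2,t2 \<otimes> a2}, {t2,b2}, {t2,t2 \<otimes> b2}, {b2,t2 \<otimes> b2},
    {t3,a3}, {t3,t3 \<otimes> a3}, {a3,t3 \<otimes> a3}, {t3,b3}, {t3,t3 \<otimes> b3}, {b3,t3 \<otimes> b3},
    {p,inv p}, {q,inv q}, {u,inv u}, {v,inv v}}"
    unfolding F_def S4_edges_def vs_def by (simp add: numeral_eq_Suc)
  have FR: "{t, x} \<in> F \<and> {x, t \<otimes> x} \<in> F" if "t \<in> S 8" "x \<in> R t" for t x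
  proof -
    have "t = t1 \<or> t = t2 \<or> t = t3" using that(1) T by simp
    then show ?thesis
    proof (elim disjE)
      assume 1: "t = t1"
      then have "x = a1 \<or> x = t1 \<otimes> a1 \<or> x = b1 \<or> x = t1 \<otimes> b1" using that(2) R1(1) by blast
      moreover have "{t1 \<otimes> a1, t1 \<otimes> (t1 \<otimes> a1)} = {a1, t1 \<otimes> a1}" "{t1 \<otimes> b1, t1 \<otimes> (t1 \<otimes> b1)} = {b1, t1 \<otimes> b1}"
        unfolding wing(5)[OF t(1) R1(2)] wing(5)[OF t(1) R1(3)] by auto
      ultimately show ?thesis unfolding F 1 by (elim disjE) simp_all
    next
      assume 2: "t = t2"
      then have "x = a2 \<or> x = t2 \<otimes> a2 \<or> x = b2 \<or> x = t2 \<otimes> b2" using that(2) R2(1) by blast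
      moreover have "{t2 \<otimes> a2, t2 \<otimes> (t2 \<otimes> a2)} = {a2, t2 \<otimes> a2}" "{t2 \<otimes> b2, t2 \<otimes> (t2 \<otimes> b2)} = {b2, t2 \<otimes> b2}"
        unfolding wing(5)[OF t(2) R2(2)] wing(5)[OF t(2) R2(3)] by auto
      ultimately show ?thesis unfolding F 2 by (elim disjE) simp_all
    next
      assume 3: "t = t3"
      then have "x = a3 \<or> x = t3 \<otimes> a3 \<or> x = b3 \<or> x = t3 \<otimes> b3" using that(2) R3(1) by blast
      moreover have "{t3 \<otimes> a3, t3 \<otimes> (t3 \<otimes> a3)} = {a3, t3 \<otimes> a3}" "{t3 \<otimes> b3, t3 \<otimes> (t3 \<otimes> b3)} = {b3, t3 \<otimes> b3}"
        unfolding wing(5)[OF t(3) R3(2)] wing(5)[OF t(3) R3(3)] by auto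
      ultimately show ?thesis unfolding F 3 by (elim disjE) simp_all
    qed
  qed
  have FT: "{t, t'} \<in> F" if "t \<in> S 8" "t' \<in> S 8" "t \<noteq> t'" for t t'
  proof -
    have "{t1, t2} \<in> F" "{t1, t3} \<in> F" "{t2, t3} \<in> F" unfolding F by simp_all
    then show ?thesis using that unfolding T by (auto simp: insert_commute)
  qed
  have FS: "{s, inv s} \<in> F" if "s \<in> S 3" for s
  proof -
    have F4: "{p, inv p} \<in> F" "{q, inv q} \<in> F" "{u, inv u} \<in> F" "{v, inv v} \<in> F" unfolding F by simp_all
    have "s \<in> {p, q, u, v} \<or> inv s \<in> {p, q, u, v}" using that P(1) order3_class(4) P(2-5) by auto
    moreover have "{inv s, inv (inv s)} = {s, inv s}" using order3_class(4)[OF that] by auto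
    ultimately show ?thesis using F4 by auto
  qed
  have edge: "{x, y} \<in> F" if x: "x \<in> carrier G - {\<one>}" and y: "y \<in> carrier G - {\<one>}" "x \<noteq> y" "x \<otimes> y = y \<otimes> x" for x y
  proof -
    have yx: "y \<in> cen x" using y by (simp add: cen_iff)
    have "x \<in> S 8 \<or> x \<in> S 4 \<or> x \<in> S 3" using x split S4eq by blast
    then consider "x \<in> S 8" | t where "t \<in> S 8" "x \<in> R t" | "x \<in> S 3" using UR by blast
    then show ?thesis
    proof cases
      case 1
      have "y \<in> V4 \<or> y \<in> R x" using yx unfolding R_def by blast
      then show ?thesis
      proof
        assume "y \<in> V4"
        then have "y \<in> S 8" using y(1) unfolding V4_def by simp
        then show ?thesis using FT 1 y(2) by blast
      qed (use FR 1 in blast)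
    next
      case 2
      then have "y = t \<or> y = t \<otimes> x" using yx wing(2)[OF 2] y by blast
      then show ?thesis using FR[OF 2] by (metis insert_commute)
    next
      case 3
      then have "y = inv x" using yx order3_class(1) y by blast
      then show ?thesis using FS[OF 3] by simp
    qed
  qed
  show ?thesis by (rule that[OF dist set len]) (use edge F_def in blast)
qed

end

section \<open>The commuting graph\<close>

lemma S4_edges_noncrossing:
  "(i, j) \<in> S4_edges \<Longrightarrow> (k, l) \<in> S4_edges \<Longrightarrow> \<not> (i < k \<and> k < j \<and> j < l)"
proof -
  have "\<forall>(i, j)\<in>S4_edges. \<forall>(k, l)\<in>S4_edges. \<not> (i < k \<and> k < j \<and> j < l)"
    unfolding S4_edges_def by simp
  then show "(i, j) \<in> S4_edges \<Longrightarrow> (k, l) \<in> S4_edges \<Longrightarrow> \<not> (i < k \<and> k < j \<and> j < l)" by blast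
qed

lemma S4_edges_bounds: "(i, j) \<in> S4_edges \<Longrightarrow> i < j \<and> j < 23"
  unfolding S4_edges_def by auto

lemma S4_edges_embeds_in_sphere:
  assumes vs: "distinct vs" "set vs = V" "length vs = 23" and E: "E \<subseteq> all_pairs V"
    and sub: "E \<subseteq> (\<lambda>(i, j). {vs ! i, vs ! j}) ` S4_edges"
  shows "embeds_in V E (sphere_with_handles 0)"
proof (rule noncrossing_list_embeds_in_sphere[OF vs(1,2) E])
  fix i j assume ij: "i < j" "j < length vs" "{vs ! i, vs ! j} \<in> E"
  then obtain k l where kl: "(k, l) \<in> S4_edges" "{vs ! i, vs ! j} = {vs ! k, vs ! l}" using sub by auto
  have lt: "k < l" "l < length vs" using S4_edges_bounds[OF kl(1)] vs(3) by auto
  have "vs ! i = vs ! k \<and> vs ! j = vs ! l \<or> vs ! i = vs ! l \<and> vs ! j = vs ! k"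
    using kl(2) by (simp add: doubleton_eq_iff)
  then have "i = k \<and> j = l \<or> i = l \<and> j = k"
    using nth_eq_iff_index_eq[OF vs(1)] ij lt by auto
  then show "(i, j) \<in> S4_edges" using kl(1) ij(1) lt(1) by auto
qed (rule S4_edges_noncrossing)

lemma commuting_edges_iff:
  "{u, v} \<in> commuting_edges G \<longleftrightarrow> u \<in> commuting_vertices G \<and> v \<in> commuting_vertices G \<and> u \<noteq> v \<and>
    u \<otimes>\<^bsub>G\<^esub> v = v \<otimes>\<^bsub>G\<^esub> u"
  unfolding commuting_edges_def by (auto simp: doubleton_eq_iff)

lemma commuting_edges_pairs: "commuting_edges G \<subseteq> all_pairs (commuting_vertices G)"
  unfolding commuting_edges_def all_pairs_def by blast

text \<open>Each edge within \<open>W\<close> gives two ordered pairs and the diagonal gives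
  \<open>card W\<close> more: \<open>7 = 2 * 3 + 1\<close>.\<close>

lemma (in finite_group) cpairs_bound:
  assumes emb: "embeds_in (commuting_vertices G) (commuting_edges G) (sphere_with_handles 1)"
    and W: "W \<subseteq> commuting_vertices G"
  shows "card (cpairs W W) \<le> 7 * card W"
proof -
  have finW: "finite W" using W fin unfolding commuting_vertices_def by (meson finite_Diff finite_subset)
  define F where "F = {e \<in> commuting_edges G. e \<subseteq> W}"
  have FW: "F \<subseteq> all_pairs W" unfolding F_def commuting_edges_def all_pairs_def by blast
  have finF: "finite F" unfolding F_def using finW by (auto intro: finite_subset[of _ "Pow W"])
  have "embeds_in W F (sphere_with_handles 1)"
    by (rule embeds_in_subgraph[OF emb W]) (auto simp: F_def)
  then have F3: "card F \<le> 3 * card W" using FW finW by (rule toroidal_edge_bound)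
  define fibre where "fibre e = {(a, b). a \<noteq> b \<and> {a, b} = e}" for e :: "'a set"
  have fib: "finite (fibre e) \<and> card (fibre e) = 2" if e: "e \<in> F" for e
  proof -
    obtain u v where uv: "e = {u, v}" "u \<noteq> v" using e FW unfolding all_pairs_def by blast
    have "fibre e = {(u, v), (v, u)}" unfolding fibre_def uv(1) using uv(2) by (auto simp: doubleton_eq_iff)
    then show ?thesis using uv(2) by simp
  qed
  have "cpairs W W \<subseteq> (\<lambda>a. (a, a)) ` W \<union> (\<Union>e\<in>F. fibre e)"
  proof
    fix z assume "z \<in> cpairs W W"
    then obtain a b where ab: "z = (a, b)" "a \<in> W" "b \<in> W" "a \<otimes> b = b \<otimes> a" unfolding cpairs_def by auto
    show "z \<in> (\<lambda>a. (a, a)) ` W \<union> (\<Union>e\<in>F. fibre e)"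
    proof (cases "a = b")
      case False
      then have "{a, b} \<in> F" unfolding F_def using ab W commuting_edges_iff[of a b G] by auto
      moreover have "z \<in> fibre {a, b}" unfolding fibre_def using ab(1) False by simp
      ultimately show ?thesis by blast
    qed (use ab in auto)
  qed
  then have "card (cpairs W W) \<le> card ((\<lambda>a. (a, a)) ` W \<union> (\<Union>e\<in>F. fibre e))"
    using finW finF fib by (intro card_mono) auto
  also have "\<dots> \<le> card ((\<lambda>a. (a, a)) ` W) + card (\<Union>e\<in>F. fibre e)" by (rule card_Un_le)
  also have "\<dots> \<le> card W + (\<Sum>e\<in>F. card (fibre e))" using finW finF by (intro add_mono card_image_le card_UN_le)
  also have "(\<Sum>e\<in>F. card (fibre e)) = (\<Sum>e\<in>F. 2)" using fib by (intro sum.cong) auto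
  finally show ?thesis using F3 by simp
qed

lemma (in finite_group) toroidal_groupI:
  assumes emb: "embeds_in (commuting_vertices G) (commuting_edges G) (sphere_with_handles 1)"
  shows "toroidal_group G"
proof (rule toroidal_group.intro[OF finite_group_axioms toroidal_group_axioms.intro])
  fix W assume "W \<subseteq> carrier G - group_centre G"
  then show "card (cpairs W W) \<le> 7 * card W" using cpairs_bound[OF emb] unfolding commuting_vertices_def by blast
next
  fix A B assume AB: "A \<subseteq> carrier G - group_centre G" "B \<subseteq> carrier G - group_centre G"
    "comm_set A" "comm_set B" "5 \<le> card A" "5 \<le> card B"
  have finV: "finite (commuting_vertices G)" unfolding commuting_vertices_def using fin by simp
  have pairs: "all_pairs S \<subseteq> commuting_edges G" if "S \<subseteq> commuting_vertices G" "comm_set S" for S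
    using that unfolding all_pairs_def commuting_edges_def comm_set_def by blast
  obtain A' where A': "A' \<subseteq> A" "card A' = 5" using obtain_subset_with_card_n[OF AB(5)] by metis
  obtain B' where B': "B' \<subseteq> B" "card B' = 5" using obtain_subset_with_card_n[OF AB(6)] by metis
  have sub: "A' \<subseteq> commuting_vertices G" "B' \<subseteq> commuting_vertices G"
    using A'(1) B'(1) AB(1,2) unfolding commuting_vertices_def by auto
  have com: "comm_set A'" "comm_set B'" using A'(1) B'(1) AB(3,4) unfolding comm_set_def by blast+
  show "A \<inter> B \<noteq> {}"
  proof
    assume "A \<inter> B = {}"
    then have "A' \<inter> B' = {}" using A'(1) B'(1) by blast
    then show False
      using no_two_disjoint_K5[OF emb commuting_edges_pairs finV sub(1) A'(2) pairs[OF sub(1) com(1)]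
          sub(2) B'(2) pairs[OF sub(2) com(2)]] by blast
  qed
qed

theorem theorem3p8:
  fixes G :: "('a, 'b) monoid_scheme"
  assumes "group G"
    and "finite (carrier G)"
    and "\<not> comm_group G"
    and "toroidal (commuting_vertices G) (commuting_edges G)"
  shows "integral_graph (commuting_vertices G) (commuting_edges G)"
proof -
  interpret finite_group G using assms(1,2) by (intro finite_group.intro finite_group_axioms.intro)
  have "graph_genus (commuting_vertices G) (commuting_edges G) = enat 1"
    using assms(4) unfolding toroidal_def one_enat_def .
  then have emb: "embeds_in (commuting_vertices G) (commuting_edges G) (sphere_with_handles 1)"
    and nonplanar: "\<not> embeds_in (commuting_vertices G) (commuting_edges G) (sphere_with_handles 0)"
    unfolding graph_genus_eq_enat_iff by auto
  interpret toroidal_group G by (rule toroidal_groupI[OF emb])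
  show ?thesis
  proof (cases "\<forall>x\<in>commuting_vertices G. comm_set (cen x)")
    case True
    show ?thesis
    proof (rule cluster_graph_integral[where R = "\<lambda>u v. u \<otimes>\<^bsub>G\<^esub> v = v \<otimes>\<^bsub>G\<^esub> u"])
      show "u \<otimes>\<^bsub>G\<^esub> w = w \<otimes>\<^bsub>G\<^esub> u"
        if "u \<in> commuting_vertices G" "v \<in> commuting_vertices G" "w \<in> commuting_vertices G"
          "u \<otimes>\<^bsub>G\<^esub> v = v \<otimes>\<^bsub>G\<^esub> u" "v \<otimes>\<^bsub>G\<^esub> w = w \<otimes>\<^bsub>G\<^esub> v" for u v w
      proof -
        have "u \<in> cen v" "w \<in> cen v" using that by (auto simp: cen_iff commuting_vertices_def)
        then show ?thesis using True that(2) unfolding comm_set_def by blast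
      qed
    qed (auto simp: commuting_edges_iff)
  next
    case False
    then obtain t where "t \<in> carrier G" "t \<notin> group_centre G" "\<not> comm_set (cen t)"
      unfolding commuting_vertices_def by blast
    then interpret bad_group G t by (intro bad_group.intro bad_group_axioms.intro toroidal_group_axioms)
    have V: "commuting_vertices G = carrier G - {\<one>\<^bsub>G\<^esub>}" unfolding commuting_vertices_def Z1 ..
    obtain vs where vs: "distinct vs" "set vs = carrier G - {\<one>\<^bsub>G\<^esub>}" "length vs = 23"
      and edges: "\<And>x y. x \<in> carrier G - {\<one>\<^bsub>G\<^esub>} \<Longrightarrow> y \<in> carrier G - {\<one>\<^bsub>G\<^esub>} \<Longrightarrow> x \<noteq> y \<Longrightarrow>
        x \<otimes>\<^bsub>G\<^esub> y = y \<otimes>\<^bsub>G\<^esub> x \<Longrightarrow> {x, y} \<in> (\<lambda>(i, j). {vs ! i, vs ! j}) ` S4_edges"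
      using S4_graph by metis
    have "commuting_edges G \<subseteq> (\<lambda>(i, j). {vs ! i, vs ! j}) ` S4_edges"
      unfolding commuting_edges_def V using edges by blast
    then have "embeds_in (commuting_vertices G) (commuting_edges G) (sphere_with_handles 0)"
      by (rule S4_edges_embeds_in_sphere[OF vs(1) vs(2)[folded V] vs(3) commuting_edges_pairs])
    then show ?thesis using nonplanar by blast
  qed
qed

end
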